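(* Let $\ell>m>0$ be coprime integers. The invariant $\mathrm{Spin}(7)$-structure on $C_{\ell+m,\ell,m}$ defined by the admissible 4-form $$\Phi=e^{1234}+e^{1256}-e^{3456}-e^{1278}+e^{3478}+e^{5678}+\beta_1+\beta_2$$ is of mixed type, and its characteristic connection $\nabla$ coincides with the canonical connection $\nabla^0$ with respect to the naturally reductive structure induced by the metric $g=\sum_{i=1}^8 e^i\otimes e^i$. In particular, its torsion form $T$ is parallel, i.e. $\nabla T=0$.
   Context: Write $e^{i_1\cdots i_r}=e^{i_1}\wedge\cdots\wedge e^{i_r}$. A $\mathrm{Spin}(7)$-structure on an 8-manifold is a 4-form $\Phi$ (called admissible) such that at each point there is a basis $(f^1,\dots,f^8)$ of the cotangent space with $$\Phi=f^{1234}+f^{1256}-f^{1278}+f^{1357}+f^{1368}+f^{1458}-f^{1467}+f^{5678}+f^{3478}-f^{3456}+f^{2468}+f^{2457}-f^{2358}+f^{2367}.$$ It induces the Riemannian metric $g_\Phi$ for which such bases are orthonormal and the orientation $f^{12345678}$; $\star$ is the Hodge operator. The Lee form is $\vartheta=-\frac17\star(\star d\Phi\wedge\Phi)$. $\Phi$ is balanced if $\star d\Phi\wedge\Phi=0$, locally conformal parallel if $d\Phi=\vartheta\wedge\Phi$, and of mixed type if it is neither balanced nor locally conformal parallel. The characteristic connection of $(M,\Phi)$ is the unique connection $\nabla$ that is metric for $g_\Phi$, has totally skew-symmetric torsion $T$, and satisfies $\nabla\Phi=0$; it is $\nabla=\nabla^{g_\Phi}+\frac12T$, with $\nabla^{g_\Phi}$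 the Levi-Civita connection. $C_{k,\ell,m}=G/H$ with $G=\mathrm{SU}(2)^3$ and $H=\mathrm{U}(1)_{k,\ell,m}=\{(z^k,z^\ell,z^m):z\in \mathrm{U}(1)\}$, $z^j$ standing for $\mathrm{diag}(z^j,z^{-j})$; here $k=\ell+m$. Let $\sigma_1=\frac12\begin{pmatrix}0&i\\ i&0\end{pmatrix}$, $\sigma_2=\frac12\begin{pmatrix}0&1\\-1&0\end{pmatrix}$, $\sigma_3=\frac12\begin{pmatrix}i&0\\0&-i\end{pmatrix}$, and view $\mathfrak g=3\mathfrak{su}(2)$ as block matrices $\mathrm{diag}(X,Y,Z)$. Put $c_7=\sqrt{k^2+\ell^2}\sqrt{k^2+\ell^2+m^2}$, $c_8=\sqrt{k^2+\ell^2}$ and $e_1=\mathrm{diag}(\sigma_1,0,0)$, $e_2=\mathrm{diag}(\sigma_2,0,0)$, $e_3=\mathrm{diag}(0,\sigma_1,0)$, $e_4=\mathrm{diag}(0,\sigma_2,0)$, $e_5=\mathrm{diag}(0,0,\sigma_1)$, $e_6=\mathrm{diag}(0,0,\sigma_2)$, $e_7=\frac1{c_7}\mathrm{diag}(mk\sigma_3,m\ell\sigma_3,-(k^2+\ell^2)\sigma_3)$, $e_8=\frac1{c_8}\mathrm{diag}(\ell\sigma_3,-k\sigma_3,0)$. Then $\mathfrak m=\mathrm{span}\{e_1,\dots,e_8\}$ is the orthogonal complement of $\mathfrak h$ with respect to the bi-invariant product $\langle A,B\rangle=-2\,\mathrm{tr}(AB)$, is identified with the tangent space at $eH$, and $e^1,\dots,e^8$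 is the dual basis; $g$ is the normal metric induced by $\langle\cdot,\cdot\rangle$. $G$-invariant forms and metrics are identified with $\mathrm{Ad}(H)$-invariant forms and inner products on $\mathfrak m$. Put $\alpha_1=e^{135}-e^{146}+e^{245}+e^{236}$, $\alpha_2=e^{136}+e^{145}+e^{246}-e^{235}$, $\beta_1=\alpha_1\wedge e^7$, $\beta_2=\alpha_2\wedge e^8$. The canonical connection $\nabla^0$ of the reductive space $G/H$ with decomposition $\mathfrak g=\mathfrak h\oplus\mathfrak m$ is the $G$-invariant connection whose Nomizu map $\mathfrak m\to\mathfrak{gl}(\mathfrak m)$ vanishes; its torsion at $eH$ is $T(X,Y)=-[X,Y]_{\mathfrak m}$. The pair ($g$, $\mathfrak g=\mathfrak h\oplus\mathfrak m$) is naturally reductive if $g([X,Y]_{\mathfrak m},Z)$ is totally skew-symmetric in $X,Y,Z\in\mathfrak m$. *)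

theory Defs
  imports "HOL-Analysis.Analysis" "HOL-Combinatorics.Combinatorics"
begin

text \<open>
  \<^bold>\<open>Exterior algebra.\<close>
  Tangent vectors are elements of \<open>real^8\<close>.  The index type \<open>8\<close> is \<open>{1,...,8}\<close>, with \<open>8 = 0\<close> in
  it; its order is never used.  A \<open>p\<close>-form (or covariant \<open>p\<close>-tensor) is a function of a sequence of
  vectors of which only the entries \<open>0,...,p-1\<close> matter.
\<close>

type_synonym vec8 = "real^8"
type_synonym tensor = "(nat \<Rightarrow> vec8) \<Rightarrow> real"

text \<open>Normalised so that \<open>(f \<and> g)(x,y) = f x * g y - f y * g x\<close> for 1-forms.\<close>

definition wedge :: "nat \<Rightarrow> nat \<Rightarrow> tensor \<Rightarrow> tensor \<Rightarrow> tensor" where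
  "wedge p q \<alpha> \<beta> = (\<lambda>X. (\<Sum>\<pi> | \<pi> permutes {..<p+q}.
      of_int (sign \<pi>) * \<alpha> (\<lambda>i. X (\<pi> i)) * \<beta> (\<lambda>i. X (\<pi> (i + p)))) / (fact p * fact q))"

definition one_form :: "(vec8 \<Rightarrow> real) \<Rightarrow> tensor" where
  "one_form f = (\<lambda>X. f (X 0))"

text \<open>\<open>wmono f [i, j, ...]\<close> is \<open>f\<^sup>i \<and> f\<^sup>j \<and> ...\<close>.\<close>

fun wmono :: "(8 \<Rightarrow> vec8 \<Rightarrow> real) \<Rightarrow> 8 list \<Rightarrow> tensor" where
  "wmono f [] = (\<lambda>X. 1)"
| "wmono f (i # is) = wedge 1 (length is) (one_form (f i)) (wmono f is)"

text \<open>A metric is a function of two vectors.  The vectors \<open>dual_axis g i\<close> form the basis that is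
  \<open>g\<close>-reciprocal to the standard basis \<open>axis i 1\<close>; it serves to raise indices in the Hodge operator
  \<open>(\<star>\<beta>)(Y) = 1/p! \<Sum> \<beta>\<^sup>i\<^sup>.\<^sup>.\<^sup>.\<^sup>j vol\<^sub>i\<^sub>.\<^sub>.\<^sub>.\<^sub>j(Y)\<close>, so that \<open>\<alpha> \<and> \<star>\<beta> = \<langle>\<alpha>,\<beta>\<rangle> vol\<close>.\<close>

definition dual_axis :: "(vec8 \<Rightarrow> vec8 \<Rightarrow> real) \<Rightarrow> 8 \<Rightarrow> vec8" where
  "dual_axis g i = (\<Sum>j\<in>UNIV. matrix_inv (\<chi> a b. g (axis a 1) (axis b 1)) $ i $ j *\<^sub>R axis j 1)"

definition hodge :: "(vec8 \<Rightarrow> vec8 \<Rightarrow> real) \<Rightarrow> tensor \<Rightarrow> nat \<Rightarrow> tensor \<Rightarrow> tensor" where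
  "hodge g vol p \<beta> = (\<lambda>Y. (\<Sum>I\<in>{..<p} \<rightarrow>\<^sub>E UNIV.
      \<beta> (\<lambda>n. dual_axis g (I n)) * vol (\<lambda>n. if n < p then axis (I n) 1 else Y (n - p))) / fact p)"

text \<open>\<^bold>\<open>Admissible 4-forms.\<close>\<close>

definition coframe :: "(8 \<Rightarrow> vec8 \<Rightarrow> real) \<Rightarrow> bool" where
  "coframe f \<longleftrightarrow> (\<forall>i. linear (f i)) \<and>
     (\<forall>c. (\<forall>x. (\<Sum>i\<in>UNIV. c i * f i x) = 0) \<longrightarrow> (\<forall>i. c i = 0))"

definition spin7_form :: "(8 \<Rightarrow> vec8 \<Rightarrow> real) \<Rightarrow> tensor" where
  "spin7_form f = (\<lambda>X.
     wmono f [1,2,3,4] X + wmono f [1,2,5,6] X - wmono f [1,2,7,8] X + wmono f [1,3,5,7] X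
   + wmono f [1,3,6,8] X + wmono f [1,4,5,8] X - wmono f [1,4,6,7] X + wmono f [5,6,7,8] X
   + wmono f [3,4,7,8] X - wmono f [3,4,5,6] X + wmono f [2,4,6,8] X + wmono f [2,4,5,7] X
   - wmono f [2,3,5,8] X + wmono f [2,3,6,7] X)"

definition adapted :: "tensor \<Rightarrow> (8 \<Rightarrow> vec8 \<Rightarrow> real) \<Rightarrow> bool" where
  "adapted \<Phi> f \<longleftrightarrow> coframe f \<and> \<Phi> = spin7_form f"

definition admissible :: "tensor \<Rightarrow> bool" where
  "admissible \<Phi> \<longleftrightarrow> (\<exists>f. adapted \<Phi> f)"

text \<open>For admissible \<open>\<Phi>\<close> these are well defined, since the stabiliser of the model form in
  \<open>GL(8)\<close> is \<open>Spin(7) \<subseteq> SO(8)\<close>.\<close>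

definition spin7_metric :: "tensor \<Rightarrow> vec8 \<Rightarrow> vec8 \<Rightarrow> real" where
  "spin7_metric \<Phi> = (THE g. \<forall>f. adapted \<Phi> f \<longrightarrow> g = (\<lambda>x y. \<Sum>i\<in>UNIV. f i x * f i y))"

definition spin7_vol :: "tensor \<Rightarrow> tensor" where
  "spin7_vol \<Phi> = (THE v. \<forall>f. adapted \<Phi> f \<longrightarrow> v = wmono f [1,2,3,4,5,6,7,8])"

definition spin7_hodge :: "tensor \<Rightarrow> nat \<Rightarrow> tensor \<Rightarrow> tensor" where
  "spin7_hodge \<Phi> = hodge (spin7_metric \<Phi>) (spin7_vol \<Phi>)"

text \<open>
  \<^bold>\<open>The groups \<open>G = SU(2)\<^sup>3\<close> and \<open>H = U(1)\<^sub>k\<^sub>,\<^sub>l\<^sub>,\<^sub>m\<close>.\<close>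
  A triple \<open>(X, Y, Z)\<close> stands for the block matrix \<open>diag(X, Y, Z)\<close>.
\<close>

type_synonym mat2 = "complex^2^2"
type_synonym block = "mat2 \<times> mat2 \<times> mat2"

fun bmul :: "block \<Rightarrow> block \<Rightarrow> block" where
  "bmul (A, B, C) (A', B', C') = (A ** A', B ** B', C ** C')"

fun binv :: "block \<Rightarrow> block" where
  "binv (A, B, C) = (matrix_inv A, matrix_inv B, matrix_inv C)"

definition bracket :: "block \<Rightarrow> block \<Rightarrow> block" where
  "bracket X Y = bmul X Y - bmul Y X"

definition mexp :: "mat2 \<Rightarrow> mat2" where
  "mexp A = (\<Sum>n. (1 / fact n) *\<^sub>R (((**) A ^^ n) (mat 1)))"

fun bexp :: "block \<Rightarrow> block" where
  "bexp (A, B, C) = (mexp A, mexp B, mexp C)"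

definition dagger :: "mat2 \<Rightarrow> mat2" where
  "dagger A = (\<chi> i j. cnj (A $ j $ i))"

definition SU2 :: "mat2 set" where
  "SU2 = {A. A ** dagger A = mat 1 \<and> det A = 1}"

definition su2 :: "mat2 set" where
  "su2 = {A. dagger A = - A \<and> trace A = 0}"

definition GG :: "block set" where
  "GG = SU2 \<times> SU2 \<times> SU2"

definition gg :: "block set" where
  "gg = su2 \<times> su2 \<times> su2"

definition u1 :: "int \<Rightarrow> complex \<Rightarrow> mat2" where
  "u1 j z = vector [vector [z powi j, 0], vector [0, z powi (- j)]]"

definition HH :: "int \<Rightarrow> int \<Rightarrow> int \<Rightarrow> block set" where
  "HH k l m = {(u1 k z, u1 l z, u1 m z) | z. cmod z = 1}"

definition \<sigma>1 :: mat2 where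
  "\<sigma>1 = (1/2) *\<^sub>R vector [vector [0, \<i>], vector [\<i>, 0]]"

definition \<sigma>2 :: mat2 where
  "\<sigma>2 = (1/2) *\<^sub>R vector [vector [0, 1], vector [- 1, 0]]"

definition \<sigma>3 :: mat2 where
  "\<sigma>3 = (1/2) *\<^sub>R vector [vector [\<i>, 0], vector [0, - \<i>]]"

text \<open>The Lie algebra of \<open>H\<close>: the tangent vector of \<open>t \<mapsto> (e\<^sup>i\<^sup>k\<^sup>t, e\<^sup>i\<^sup>l\<^sup>t, e\<^sup>i\<^sup>m\<^sup>t)\<close> at \<open>0\<close> is
  \<open>2 diag(k \<sigma>3, l \<sigma>3, m \<sigma>3)\<close>.\<close>

definition hh :: "int \<Rightarrow> int \<Rightarrow> int \<Rightarrow> block set" where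
  "hh k l m = {t *\<^sub>R (of_int k *\<^sub>R \<sigma>3, of_int l *\<^sub>R \<sigma>3, of_int m *\<^sub>R \<sigma>3) | t. True}"

definition c7 :: "int \<Rightarrow> int \<Rightarrow> int \<Rightarrow> real" where
  "c7 k l m = sqrt (of_int (k^2 + l^2)) * sqrt (of_int (k^2 + l^2 + m^2))"

definition c8 :: "int \<Rightarrow> int \<Rightarrow> real" where
  "c8 k l = sqrt (of_int (k^2 + l^2))"

definition e_vec :: "int \<Rightarrow> int \<Rightarrow> int \<Rightarrow> 8 \<Rightarrow> block" where
  "e_vec k l m i =
    (if i = 1 then (\<sigma>1, 0, 0) else if i = 2 then (\<sigma>2, 0, 0)
     else if i = 3 then (0, \<sigma>1, 0) else if i = 4 then (0, \<sigma>2, 0)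
     else if i = 5 then (0, 0, \<sigma>1) else if i = 6 then (0, 0, \<sigma>2)
     else if i = 7 then (1 / c7 k l m) *\<^sub>R
       (of_int (m * k) *\<^sub>R \<sigma>3, of_int (m * l) *\<^sub>R \<sigma>3, of_int (- (k^2 + l^2)) *\<^sub>R \<sigma>3)
     else (1 / c8 k l) *\<^sub>R (of_int l *\<^sub>R \<sigma>3, of_int (- k) *\<^sub>R \<sigma>3, 0))"

text \<open>From here on, \<open>real^8\<close> is identified with the complement \<open>\<mm>\<close> of \<open>\<hh>\<close> spanned by the \<open>e\<^sub>i\<close>.
  \<open>comp_m X\<close> is the component of \<open>X\<close> in \<open>\<mm>\<close> along \<open>\<hh>\<close>.\<close>

definition frame :: "int \<Rightarrow> int \<Rightarrow> int \<Rightarrow> vec8 \<Rightarrow> block" where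
  "frame k l m x = (\<Sum>i\<in>UNIV. x $ i *\<^sub>R e_vec k l m i)"

definition comp_m :: "int \<Rightarrow> int \<Rightarrow> int \<Rightarrow> block \<Rightarrow> vec8" where
  "comp_m k l m X = (THE x. X - frame k l m x \<in> hh k l m)"

definition bracket_m :: "int \<Rightarrow> int \<Rightarrow> int \<Rightarrow> vec8 \<Rightarrow> vec8 \<Rightarrow> vec8" where
  "bracket_m k l m x y = comp_m k l m (bracket (frame k l m x) (frame k l m y))"

definition isotropy :: "int \<Rightarrow> int \<Rightarrow> int \<Rightarrow> block \<Rightarrow> vec8 \<Rightarrow> vec8" where
  "isotropy k l m h x = comp_m k l m (bmul (bmul h (frame k l m x)) (binv h))"

text \<open>
  \<^bold>\<open>Tensor fields on \<open>G/H\<close>.\<close>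
  The tangent bundle of \<open>G/H\<close> is the bundle associated to the principal bundle \<open>G \<rightarrow> G/H\<close> and the
  isotropy representation on \<open>\<mm>\<close>.  Hence a covariant tensor field on \<open>G/H\<close> is an \<open>H\<close>-equivariant
  map from \<open>G\<close> to tensors on \<open>\<mm>\<close>: its value at \<open>a\<close> on \<open>X\<^sub>1, X\<^sub>2, ...\<close> is the value of the field at \<open>aH\<close>
  on the projections of the left-invariant vector fields \<open>X\<^sub>1, X\<^sub>2, ...\<close>.  \<open>G\<close>-invariant fields
  correspond to constant maps, that is to \<open>Ad(H)\<close>-invariant tensors on \<open>\<mm>\<close>.

  A function on \<open>G\<close> is smooth iff all its iterated derivatives along left-invariant fields exist and
  are continuous, which is what the following coinductive definition says.
\<close>

coinductive smooth :: "(block \<Rightarrow> real) \<Rightarrow> bool" where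
  "continuous_on GG f \<Longrightarrow>
   (\<forall>X\<in>gg. \<exists>f'. smooth f' \<and>
      (\<forall>a\<in>GG. ((\<lambda>t. f (bmul a (bexp (t *\<^sub>R X)))) has_real_derivative f' a) (at 0))) \<Longrightarrow>
   smooth f"

definition smooth_equivariant :: "int \<Rightarrow> int \<Rightarrow> int \<Rightarrow> (block \<Rightarrow> tensor) \<Rightarrow> bool" where
  "smooth_equivariant k l m \<tau> \<longleftrightarrow>
     (\<forall>X. smooth (\<lambda>a. \<tau> a X)) \<and>
     (\<forall>a\<in>GG. \<forall>h\<in>HH k l m. \<forall>X. \<tau> (bmul a h) X = \<tau> a (\<lambda>n. isotropy k l m h (X n)))"

definition G_invariant :: "(block \<Rightarrow> tensor) \<Rightarrow> bool" where
  "G_invariant \<tau> \<longleftrightarrow> (\<forall>b\<in>GG. \<forall>a\<in>GG. \<tau> (bmul b a) = \<tau> a)"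

definition omit :: "nat \<Rightarrow> (nat \<Rightarrow> 'a) \<Rightarrow> nat \<Rightarrow> 'a" where
  "omit i X n = (if n < i then X n else X (Suc n))"

text \<open>The exterior derivative of a \<open>p\<close>-form: Palais' formula applied to the pull-back of the form
  to \<open>G\<close> and left-invariant fields in \<open>\<mm>\<close>.  The pull-back vanishes on \<open>\<hh>\<close>, so only
  \<open>\<mm>\<close>-components of brackets enter.\<close>

definition ext_d :: "int \<Rightarrow> int \<Rightarrow> int \<Rightarrow> nat \<Rightarrow> (block \<Rightarrow> tensor) \<Rightarrow> block \<Rightarrow> tensor" where
  "ext_d k l m p \<omega> a X =
     (\<Sum>i\<le>p. (-1) ^ i * deriv (\<lambda>t. \<omega> (bmul a (bexp (t *\<^sub>R frame k l m (X i)))) (omit i X)) 0)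
   + (\<Sum>j\<le>p. \<Sum>i<j. (-1) ^ (i + j) *
        \<omega> a (case_nat (bracket_m k l m (X i) (X j)) (omit i (omit j X))))"

text \<open>
  \<^bold>\<open>Connections on \<open>G/H\<close>.\<close>
  An affine connection differs from the canonical one by a tensor field \<open>\<Lambda>\<close>, viewed again as an
  \<open>H\<close>-equivariant map on \<open>G\<close>.  \<open>G\<close>-invariant connections are those with constant \<open>\<Lambda>\<close>, which is then
  the Nomizu map.  For the canonical connection the covariant derivative of the equivariant map
  in direction \<open>x \<in> \<mm>\<close> is the derivative along the left-invariant field \<open>x\<close>.
\<close>

definition connection ::
  "int \<Rightarrow> int \<Rightarrow> int \<Rightarrow> (block \<Rightarrow> vec8 \<Rightarrow> vec8 \<Rightarrow> vec8) \<Rightarrow> bool" where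
  "connection k l m \<Lambda> \<longleftrightarrow>
     (\<forall>a\<in>GG. bilinear (\<Lambda> a)) \<and>
     (\<forall>x y i. smooth (\<lambda>a. \<Lambda> a x y $ i)) \<and>
     (\<forall>a\<in>GG. \<forall>h\<in>HH k l m. \<forall>x y.
        isotropy k l m h (\<Lambda> (bmul a h) x y) = \<Lambda> a (isotropy k l m h x) (isotropy k l m h y))"

definition canonical_connection :: "block \<Rightarrow> vec8 \<Rightarrow> vec8 \<Rightarrow> vec8" where
  "canonical_connection = (\<lambda>a x y. 0)"

definition cov_deriv ::
  "int \<Rightarrow> int \<Rightarrow> int \<Rightarrow> (block \<Rightarrow> vec8 \<Rightarrow> vec8 \<Rightarrow> vec8) \<Rightarrow>
   nat \<Rightarrow> (block \<Rightarrow> tensor) \<Rightarrow> block \<Rightarrow> vec8 \<Rightarrow> tensor" where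
  "cov_deriv k l m \<Lambda> p \<tau> a x Y =
     deriv (\<lambda>t. \<tau> (bmul a (bexp (t *\<^sub>R frame k l m x))) Y) 0
   - (\<Sum>j<p. \<tau> a (Y(j := \<Lambda> a x (Y j))))"

definition parallel ::
  "int \<Rightarrow> int \<Rightarrow> int \<Rightarrow> (block \<Rightarrow> vec8 \<Rightarrow> vec8 \<Rightarrow> vec8) \<Rightarrow> nat \<Rightarrow> (block \<Rightarrow> tensor) \<Rightarrow> bool" where
  "parallel k l m \<Lambda> p \<tau> \<longleftrightarrow> (\<forall>a\<in>GG. \<forall>x Y. cov_deriv k l m \<Lambda> p \<tau> a x Y = 0)"

text \<open>For the canonical connection this is \<open>-[x,y]\<^sub>\<mm>\<close>.\<close>

definition torsion ::
  "int \<Rightarrow> int \<Rightarrow> int \<Rightarrow> (block \<Rightarrow> vec8 \<Rightarrow> vec8 \<Rightarrow> vec8) \<Rightarrow> block \<Rightarrow> vec8 \<Rightarrow> vec8 \<Rightarrow> vec8" where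
  "torsion k l m \<Lambda> a x y = \<Lambda> a x y - \<Lambda> a y x - bracket_m k l m x y"

definition torsion_form ::
  "int \<Rightarrow> int \<Rightarrow> int \<Rightarrow> (block \<Rightarrow> tensor) \<Rightarrow> (block \<Rightarrow> vec8 \<Rightarrow> vec8 \<Rightarrow> vec8) \<Rightarrow> block \<Rightarrow> tensor" where
  "torsion_form k l m \<Phi> \<Lambda> a X = spin7_metric (\<Phi> a) (torsion k l m \<Lambda> a (X 0) (X 1)) (X 2)"

definition totally_skew :: "(vec8 \<Rightarrow> vec8 \<Rightarrow> vec8 \<Rightarrow> real) \<Rightarrow> bool" where
  "totally_skew t \<longleftrightarrow> (\<forall>x y z. t x y z = - t y x z \<and> t x y z = - t x z y)"

definition naturally_reductive :: "int \<Rightarrow> int \<Rightarrow> int \<Rightarrow> (vec8 \<Rightarrow> vec8 \<Rightarrow> real) \<Rightarrow> bool" where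
  "naturally_reductive k l m g \<longleftrightarrow> totally_skew (\<lambda>x y z. g (bracket_m k l m x y) z)"

text \<open>\<^bold>\<open>\<open>Spin(7)\<close>-structures on \<open>G/H\<close>.\<close>\<close>

definition spin7_structure :: "int \<Rightarrow> int \<Rightarrow> int \<Rightarrow> (block \<Rightarrow> tensor) \<Rightarrow> bool" where
  "spin7_structure k l m \<Phi> \<longleftrightarrow> smooth_equivariant k l m \<Phi> \<and> (\<forall>a\<in>GG. admissible (\<Phi> a))"

definition star_d_wedge :: "int \<Rightarrow> int \<Rightarrow> int \<Rightarrow> (block \<Rightarrow> tensor) \<Rightarrow> block \<Rightarrow> tensor" where
  "star_d_wedge k l m \<Phi> a = wedge 3 4 (spin7_hodge (\<Phi> a) 5 (ext_d k l m 4 \<Phi> a)) (\<Phi> a)"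

definition lee_form :: "int \<Rightarrow> int \<Rightarrow> int \<Rightarrow> (block \<Rightarrow> tensor) \<Rightarrow> block \<Rightarrow> tensor" where
  "lee_form k l m \<Phi> a = (\<lambda>X. - (1/7) * spin7_hodge (\<Phi> a) 7 (star_d_wedge k l m \<Phi> a) X)"

definition balanced :: "int \<Rightarrow> int \<Rightarrow> int \<Rightarrow> (block \<Rightarrow> tensor) \<Rightarrow> bool" where
  "balanced k l m \<Phi> \<longleftrightarrow> (\<forall>a\<in>GG. star_d_wedge k l m \<Phi> a = (\<lambda>X. 0))"

definition locally_conformal_parallel :: "int \<Rightarrow> int \<Rightarrow> int \<Rightarrow> (block \<Rightarrow> tensor) \<Rightarrow> bool" where
  "locally_conformal_parallel k l m \<Phi> \<longleftrightarrow>
     (\<forall>a\<in>GG. ext_d k l m 4 \<Phi> a = wedge 1 4 (lee_form k l m \<Phi> a) (\<Phi> a))"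

definition mixed_type :: "int \<Rightarrow> int \<Rightarrow> int \<Rightarrow> (block \<Rightarrow> tensor) \<Rightarrow> bool" where
  "mixed_type k l m \<Phi> \<longleftrightarrow> \<not> balanced k l m \<Phi> \<and> \<not> locally_conformal_parallel k l m \<Phi>"

definition metric_skew_parallel ::
  "int \<Rightarrow> int \<Rightarrow> int \<Rightarrow> (block \<Rightarrow> tensor) \<Rightarrow> (block \<Rightarrow> vec8 \<Rightarrow> vec8 \<Rightarrow> vec8) \<Rightarrow> bool" where
  "metric_skew_parallel k l m \<Phi> \<Lambda> \<longleftrightarrow>
     connection k l m \<Lambda> \<and>
     parallel k l m \<Lambda> 2 (\<lambda>a X. spin7_metric (\<Phi> a) (X 0) (X 1)) \<and>
     (\<forall>a\<in>GG. totally_skew (\<lambda>x y z. spin7_metric (\<Phi> a) (torsion k l m \<Lambda> a x y) z)) \<and>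
     parallel k l m \<Lambda> 4 \<Phi>"

definition characteristic_connection ::
  "int \<Rightarrow> int \<Rightarrow> int \<Rightarrow> (block \<Rightarrow> tensor) \<Rightarrow> (block \<Rightarrow> vec8 \<Rightarrow> vec8 \<Rightarrow> vec8) \<Rightarrow> bool" where
  "characteristic_connection k l m \<Phi> \<Lambda> \<longleftrightarrow>
     metric_skew_parallel k l m \<Phi> \<Lambda> \<and>
     (\<forall>\<Lambda>'. metric_skew_parallel k l m \<Phi> \<Lambda>' \<longrightarrow> (\<forall>a\<in>GG. \<Lambda>' a = \<Lambda> a))"

text \<open>\<^bold>\<open>The 4-form \<open>\<Phi>\<close> and the metric \<open>\<Sum> e\<^sup>i \<otimes> e\<^sup>i\<close> on \<open>\<mm>\<close>.\<close>\<close>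

definition e_form :: "8 \<Rightarrow> vec8 \<Rightarrow> real" where
  "e_form i x = x $ i"

definition g_std :: "vec8 \<Rightarrow> vec8 \<Rightarrow> real" where
  "g_std x y = (\<Sum>i\<in>UNIV. e_form i x * e_form i y)"

definition alpha1 :: tensor where
  "alpha1 = (\<lambda>X. wmono e_form [1,3,5] X - wmono e_form [1,4,6] X
                + wmono e_form [2,4,5] X + wmono e_form [2,3,6] X)"

definition alpha2 :: tensor where
  "alpha2 = (\<lambda>X. wmono e_form [1,3,6] X + wmono e_form [1,4,5] X
                + wmono e_form [2,4,6] X - wmono e_form [2,3,5] X)"

definition beta1 :: tensor where
  "beta1 = wedge 3 1 alpha1 (one_form (e_form 7))"

definition beta2 :: tensor where
  "beta2 = wedge 3 1 alpha2 (one_form (e_form 8))"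

definition Phi_m :: tensor where
  "Phi_m = (\<lambda>X. wmono e_form [1,2,3,4] X + wmono e_form [1,2,5,6] X - wmono e_form [3,4,5,6] X
              - wmono e_form [1,2,7,8] X + wmono e_form [3,4,7,8] X + wmono e_form [5,6,7,8] X
              + beta1 X + beta2 X)"

definition Phi_inv :: "block \<Rightarrow> tensor" where
  "Phi_inv = (\<lambda>a. Phi_m)"

end

theory Submission
  imports Defs "Jordan_Normal_Form.Determinant"
begin

text \<open>
  The metric and the volume form are recovered from \<open>\<Phi>\<close> by wedge products alone: \<open>\<Phi> \<and> \<Phi> = 14 vol\<close>, and
  \<open>\<omega> = \<Phi>(v, w, _, _)\<close> satisfies \<open>\<Phi> \<and> \<omega> \<and> \<omega> = -6 |v \<and> w|\<^sup>2 vol\<close>; the areas \<open>|v \<and> w|\<close> determine a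
  Euclidean metric.  The given 4-form is the model form in the coframe \<open>e\<^sup>1, ..., e\<^sup>8\<close>, and it is
  \<open>Ad(H)\<close>-invariant because its cubic part is the real part of \<open>\<zeta>\<^sub>1\<^sup>* \<and> \<zeta>\<^sub>2 \<and> \<zeta>\<^sub>3 \<and> (e\<^sup>8 - ie\<^sup>7)\<close> with
  \<open>\<zeta>\<^sub>1, \<zeta>\<^sub>2, \<zeta>\<^sub>3\<close> of weights \<open>2k, 2l, 2m\<close>, where \<open>k = l + m\<close>.

  With \<open>a = mk/c\<^sub>7\<close>, \<open>b = ml/c\<^sub>7\<close>, \<open>c = -(k\<^sup>2 + l\<^sup>2)/c\<^sub>7\<close>, the components of \<open>d\<Phi>\<close> on \<open>e\<^sub>1\<^sub>2\<^sub>3\<^sub>4\<^sub>8\<close> and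
  \<open>e\<^sub>1\<^sub>2\<^sub>5\<^sub>6\<^sub>8\<close> are \<open>a - b\<close> and \<open>a - c\<close>, whereas those of \<open>\<theta> \<and> \<Phi>\<close> agree for every 1-form \<open>\<theta>\<close>; the
  component of \<open>\<star>d\<Phi> \<and> \<Phi>\<close> on \<open>e\<^sub>1\<^sub>2\<^sub>3\<^sub>4\<^sub>5\<^sub>6\<^sub>7\<close> is \<open>-6(a - b - c)\<close>.  Hence the structure is of mixed type.

  Invariant tensors are parallel for the canonical connection, whose torsion is skew by natural
  reductivity.  The difference of two characteristic connections is a 3-form with values \<open>x \<lrcorner> T\<close> in
  \<open>spin(7)\<close>, and such a 3-form vanishes.
\<close>

no_notation vec_index (infixl "$" 100)
hide_const (open) Determinant.det Matrix.mat Matrix.vec Matrix.row Matrix.smult_vec Matrix.orthogonal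
hide_type (open) Matrix.mat Matrix.vec
hide_fact (open) Matrix.vec_eq_iff Matrix.orthogonal_def Matrix.mat_def

section \<open>Determinantal forms and the wedge product\<close>

text \<open>This is the wedge product of the 1-forms in \<open>fs\<close>. Values lie in any
  commutative ring, so that it serves complex-valued coframes as well.\<close>

definition detform :: "('v \<Rightarrow> 'a::comm_ring_1) list \<Rightarrow> (nat \<Rightarrow> 'v) \<Rightarrow> 'a" where
  "detform fs X = (\<Sum>\<pi> | \<pi> permutes {..<length fs}.
     of_int (sign \<pi>) * (\<Prod>a<length fs. (fs ! a) (X (\<pi> a))))"

lemma detform_eq_det:
  "detform fs X = Determinant.det (Matrix.mat (length fs) (length fs) (\<lambda>(a, b). (fs ! a) (X b)))"
proof -
  have *: "Matrix.mat (length fs) (length fs) (\<lambda>(a, b). (fs ! a) (X b)) $$ (a, \<pi> a) = (fs ! a) (X (\<pi> a))"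
    if "\<pi> permutes {..<length fs}" "a < length fs" for \<pi> a
    using that permutes_in_image[OF that(1), of a] by simp
  show ?thesis
    unfolding detform_def
    by (subst det_def'[of _ "length fs"])
       (auto simp: * lessThan_atLeast0[symmetric] intro!: sum.cong prod.cong)
qed

text \<open>Laplace expansion along the first row; deleting column \<open>n\<close> of the matrix
  amounts to \<open>omit n\<close> on the arguments.\<close>

lemma detform_Cons:
  "detform (f # fs) X = (\<Sum>n\<le>length fs. (-1) ^ n * f (X n) * detform fs (omit n X))"
proof -
  let ?N = "Suc (length fs)"
  let ?A = "Matrix.mat ?N ?N (\<lambda>(a, b). ((f # fs) ! a) (X b))"
  have "detform (f # fs) X = (\<Sum>j<?N. ?A $$ (0, j) * cofactor ?A 0 j)"
    unfolding detform_eq_det list.size add_Suc_right add_0_right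
    by (rule laplace_expansion_row) auto
  also have "\<dots> = (\<Sum>j<?N. (-1) ^ j * f (X j) * detform fs (omit j X))"
  proof (rule sum.cong)
    fix j assume "j \<in> {..<?N}"
    then have j: "j < ?N" by simp
    have "mat_delete ?A 0 j
        = Matrix.mat (length fs) (length fs) (\<lambda>(a, b). (fs ! a) (omit j X b))"
      by (rule eq_matI) (auto simp: mat_delete_def omit_def)
    then show "?A $$ (0, j) * cofactor ?A 0 j = (-1) ^ j * f (X j) * detform fs (omit j X)"
      using j by (simp add: cofactor_def detform_eq_det)
  qed simp
  finally show ?thesis by (simp add: lessThan_Suc_atMost)
qed

lemma detform_Nil [simp]: "detform [] X = 1"
  by (simp add: detform_def)

lemma detform_repeated:
  assumes "i < j" "j < length fs" "fs ! i = fs ! j"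
  shows "detform fs X = 0"
  unfolding detform_eq_det
  by (rule det_identical_rows[of _ "length fs" i j])
     (use assms in \<open>simp_all add: row_mat\<close>)

text \<open>The row at position \<open>length fs\<close> is pulled out of each product, which makes
  linearity in that row visible. \<open>undefined\<close> merely fills its place in the remaining
  list and is never evaluated.\<close>

lemma detform_split:
  "detform (fs @ f # gs) X = (\<Sum>\<pi> | \<pi> permutes {..<Suc (length fs + length gs)}.
     of_int (sign \<pi>) * f (X (\<pi> (length fs))) *
     (\<Prod>a\<in>{..<Suc (length fs + length gs)} - {length fs}. ((fs @ undefined # gs) ! a) (X (\<pi> a))))"
proof -
  have nth: "(fs @ f # gs) ! a = (fs @ undefined # gs) ! a" if "a \<noteq> length fs" for a
    using that by (simp add: nth_append nth_Cons')
  have "(\<Prod>a<Suc (length fs + length gs). ((fs @ f # gs) ! a) (X (\<pi> a))) =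
     f (X (\<pi> (length fs))) *
     (\<Prod>a\<in>{..<Suc (length fs + length gs)} - {length fs}. ((fs @ undefined # gs) ! a) (X (\<pi> a)))" for \<pi>
    by (subst prod.remove[of _ "length fs"]) (simp_all add: nth)
  then show ?thesis
    unfolding detform_def by (simp add: mult.assoc)
qed

lemma detform_add:
  "detform (fs @ (\<lambda>x. f x + g x) # gs) X = detform (fs @ f # gs) X + detform (fs @ g # gs) X"
  unfolding detform_split by (simp add: algebra_simps sum.distrib)

lemma detform_scale:
  "detform (fs @ (\<lambda>x. c * f x) # gs) X = c * detform (fs @ f # gs) X"
  unfolding detform_split by (simp add: algebra_simps sum_distrib_left)

text \<open>The determinant with the row \<open>f + g\<close> in both places vanishes; expanding it
  by additivity leaves the two mixed terms.\<close>

lemma detform_swap: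
  "detform (fs @ f # g # gs) X = - detform (fs @ g # f # gs) X"
proof -
  let ?h = "\<lambda>x. f x + g x"
  have rep: "detform (fs @ k # k # gs) X = 0" for k
    by (rule detform_repeated[of "length fs" "Suc (length fs)"]) (auto simp: nth_append)
  have 1: "detform (fs @ ?h # k # gs) X = detform (fs @ f # k # gs) X + detform (fs @ g # k # gs) X" for k
    by (rule detform_add)
  have 2: "detform (fs @ k # ?h # gs) X = detform (fs @ k # f # gs) X + detform (fs @ k # g # gs) X" for k
    using detform_add[of "fs @ [k]" f g gs X] by simp
  from rep[of ?h] show ?thesis
    unfolding 1 2 rep by (simp add: add_eq_0_iff)
qed

text \<open>Both factors are sums over permutations; the block permutation \<open>\<rho> \<oplus> \<tau>\<close> is absorbed into the
  outer one, which cancels the factorials in the definition of the wedge product.\<close>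

lemma wedge_detform:
  "wedge (length fs) (length gs) (detform fs) (detform gs) = detform (fs @ gs)"
proof
  fix X :: "nat \<Rightarrow> vec8"
  let ?p = "length fs" and ?q = "length gs"
  let ?P = "{\<rho>. \<rho> permutes {..<?p}}" and ?Q = "{\<tau>. \<tau> permutes {..<?q}}"
  let ?N = "{\<pi>. \<pi> permutes {..<?p + ?q}}"
  \<comment> \<open>\<open>sh \<tau>\<close> is \<tau> transported to the last \<open>?q\<close>
    positions, so that \<open>\<rho> \<circ> sh \<tau>\<close> is the block permutation.\<close>
  define sh where "sh \<tau> = map_permutation {..<?q} (\<lambda>i. i + ?p) \<tau>" for \<tau>
  have inj: "inj_on (\<lambda>i. i + ?p) {..<?q}" by (auto simp: inj_on_def)
  have bij: "bij_betw (\<lambda>i. i + ?p) {..<?q} {?p..<?p + ?q}"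
    by (rule bij_betw_byWitness[where f' = "\<lambda>i. i - ?p"]) auto
  have sh: "sh \<tau> permutes {?p..<?p + ?q}" "sign (sh \<tau>) = sign \<tau>"
    "\<And>b. b < ?q \<Longrightarrow> sh \<tau> (b + ?p) = \<tau> b + ?p" if "\<tau> permutes {..<?q}" for \<tau>
    using map_permutation_permutes[OF bij that] sign_map_permutation[OF inj that]
      map_permutation_apply[OF inj, of _ \<tau>] by (simp_all add: sh_def)
  define F where "F \<pi> = of_int (sign \<pi>) * (\<Prod>a<?p + ?q. ((fs @ gs) ! a) (X (\<pi> a)))" for \<pi>
  have key: "of_int (sign \<pi>) * (of_int (sign \<rho>) * (\<Prod>a<?p. (fs ! a) (X (\<pi> (\<rho> a))))) *
      (of_int (sign \<tau>) * (\<Prod>b<?q. (gs ! b) (X (\<pi> (\<tau> b + ?p))))) = F (\<pi> \<circ> (\<rho> \<circ> sh \<tau>))"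
    if \<pi>: "\<pi> permutes {..<?p + ?q}" and \<rho>: "\<rho> permutes {..<?p}" and \<tau>: "\<tau> permutes {..<?q}" for \<pi> \<rho> \<tau>
  proof -
    have pm: "permutation \<pi>" "permutation \<rho>" "permutation (sh \<tau>)"
      using \<pi> \<rho> sh(1)[OF \<tau>] by (auto simp: permutation_permutes)
    have lo: "(\<rho> \<circ> sh \<tau>) a = \<rho> a" if "a < ?p" for a
      using permutes_not_in[OF sh(1)[OF \<tau>], of a] that by simp
    have hi: "(\<rho> \<circ> sh \<tau>) (b + ?p) = \<tau> b + ?p" if "b < ?q" for b
      using sh(3)[OF \<tau> that] permutes_not_in[OF \<rho>, of "\<tau> b + ?p"] by simp
    have "(\<Prod>a<?p + ?q. ((fs @ gs) ! a) (X ((\<pi> \<circ> (\<rho> \<circ> sh \<tau>)) a))) =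
      (\<Prod>a<?p. ((fs @ gs) ! a) (X (\<pi> ((\<rho> \<circ> sh \<tau>) a)))) *
      (\<Prod>a\<in>{?p..<?p + ?q}. ((fs @ gs) ! a) (X (\<pi> ((\<rho> \<circ> sh \<tau>) a))))"
      by (subst prod.union_disjoint[symmetric]) (auto intro!: prod.cong simp: ivl_disj_un)
    also have "(\<Prod>a\<in>{?p..<?p + ?q}. ((fs @ gs) ! a) (X (\<pi> ((\<rho> \<circ> sh \<tau>) a)))) =
      (\<Prod>b<?q. ((fs @ gs) ! (b + ?p)) (X (\<pi> ((\<rho> \<circ> sh \<tau>) (b + ?p)))))"
      by (rule prod.reindex_bij_betw[OF bij, symmetric])
    finally show ?thesis
      using lo hi sh(2)[OF \<tau>] by (simp add: F_def sign_compose pm permutation_compose nth_append)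
  qed
  have "wedge ?p ?q (detform fs) (detform gs) X =
      (\<Sum>\<pi>\<in>?N. \<Sum>\<rho>\<in>?P. \<Sum>\<tau>\<in>?Q. F (\<pi> \<circ> (\<rho> \<circ> sh \<tau>))) / (fact ?p * fact ?q)"
    unfolding wedge_def detform_def mult.assoc sum_product unfolding sum_distrib_left
    by (intro arg_cong2[of _ _ _ _ "(/)"] sum.cong refl) (simp add: key[symmetric] mult.assoc)
  also have "(\<Sum>\<pi>\<in>?N. \<Sum>\<rho>\<in>?P. \<Sum>\<tau>\<in>?Q. F (\<pi> \<circ> (\<rho> \<circ> sh \<tau>))) =
      (\<Sum>\<rho>\<in>?P. \<Sum>\<tau>\<in>?Q. \<Sum>\<pi>\<in>?N. F (\<pi> \<circ> (\<rho> \<circ> sh \<tau>)))"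
    by (rule trans[OF sum.swap], rule sum.cong[OF refl], rule sum.swap)
  \<comment> \<open>Composition with a fixed block permutation only reorders the sum over \<pi>, so
    the inner sum is independent of \<rho> and \<tau>.\<close>
  also have "\<dots> = (\<Sum>\<rho>\<in>?P. \<Sum>\<tau>\<in>?Q. sum F ?N)"
  proof (rule sum.cong[OF refl], rule sum.cong[OF refl])
    fix \<rho> \<tau> assume "\<rho> \<in> ?P" "\<tau> \<in> ?Q"
    then have "\<rho> permutes {..<?p + ?q}" "sh \<tau> permutes {..<?p + ?q}"
      using sh(1)[of \<tau>] by (auto elim!: permutes_subset)
    then have "(\<rho> \<circ> sh \<tau>) permutes {..<?p + ?q}" by (rule permutes_compose[rotated])
    from sum_permutations_compose_right[OF this, of F]
    show "(\<Sum>\<pi>\<in>?N. F (\<pi> \<circ> (\<rho> \<circ> sh \<tau>))) = sum F ?N" by simp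
  qed
  also have "\<dots> = fact ?p * fact ?q * sum F ?N"
    by (simp add: card_permutations[OF refl])
  finally show "wedge ?p ?q (detform fs) (detform gs) X = detform (fs @ gs) X"
    by (simp add: detform_def[of "fs @ gs"] F_def)
qed

lemma wmono_eq_detform: "wmono f is = detform (map f is)"
proof (induction "is")
  case Nil
  then show ?case by (simp add: fun_eq_iff)
next
  case (Cons i "is")
  have "one_form (f i) = detform [f i]"
    by (simp add: fun_eq_iff one_form_def detform_Cons)
  then show ?case
    using Cons wedge_detform[of "[f i]" "map f is"] by simp
qed

section \<open>Linear combinations of monomials\<close>

lemma wedge_sum_list_left:
  "wedge p q (\<lambda>X. \<Sum>x\<leftarrow>L. c x * f x X) g X = (\<Sum>x\<leftarrow>L. c x * wedge p q (f x) g X)"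
proof (induction L)
  case (Cons x L)
  then show ?case
    by (simp add: wedge_def algebra_simps sum.distrib sum_distrib_left add_divide_distrib)
qed (simp add: wedge_def)

lemma wedge_sum_list_right:
  "wedge p q g (\<lambda>X. \<Sum>x\<leftarrow>L. c x * f x X) X = (\<Sum>x\<leftarrow>L. c x * wedge p q g (f x) X)"
proof (induction L)
  case (Cons x L)
  then show ?case
    by (simp add: wedge_def algebra_simps sum.distrib sum_distrib_left add_divide_distrib)
qed (simp add: wedge_def)

text \<open>Natural numbers serve as indices of coframes, so that index lists can be sorted.  Usually
  \<open>F n\<close> is \<open>f (of_nat n)\<close>, and the index \<open>8\<close> stands for \<open>0\<close> of type \<open>8\<close>.\<close>

definition emono :: "(nat \<Rightarrow> 'v \<Rightarrow> 'a::comm_ring_1) \<Rightarrow> nat list \<Rightarrow> (nat \<Rightarrow> 'v) \<Rightarrow> 'a" where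
  "emono F is = detform (map F is)"

lemma wedge_emono: "length is = p \<Longrightarrow> length js = q \<Longrightarrow> wedge p q (emono F is) (emono F js) = emono F (is @ js)"
  using wedge_detform[of "map F is" "map F js"] by (auto simp: emono_def)

text \<open>Insertion that also records the sign of the transpositions, with 0 for a repeated index.
  Being executable, it lets signs of concrete monomials be computed by evaluation.\<close>

fun ins_sign :: "nat \<Rightarrow> nat list \<Rightarrow> int \<times> nat list" where
  "ins_sign x [] = (1, [x])"
| "ins_sign x (y # ys) = (if x < y then (1, x # y # ys) else if x = y then (0, x # y # ys)
     else let (s, zs) = ins_sign x ys in (- s, y # zs))"

fun sort_sign :: "nat list \<Rightarrow> int \<times> nat list" where
  "sort_sign [] = (1, [])"
| "sort_sign (x # xs) = (let (s, ys) = sort_sign xs; (t, zs) = ins_sign x ys in (s * t, zs))"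

text \<open>The prefix \<open>us\<close> is arbitrary because, in the induction, every index that
  \<open>x\<close> passes moves into it.\<close>

lemma emono_ins_sign:
  "emono F (us @ x # ys) X = of_int (fst (ins_sign x ys)) * emono F (us @ snd (ins_sign x ys)) X"
proof (induction ys arbitrary: us)
  case (Cons y ys)
  consider "x < y" | "x = y" | "x > y" by linarith
  then show ?case
  proof cases
    case 2
    then show ?thesis
      using detform_repeated[of "length us" "Suc (length us)" "map F (us @ x # y # ys)" X]
      by (simp add: emono_def nth_append)
  next
    case 3
    have "emono F (us @ x # y # ys) X = - emono F ((us @ [y]) @ x # ys) X"
      using detform_swap[of "map F us" "F x" "F y" "map F ys" X] by (simp add: emono_def)
    with 3 show ?thesis
      using Cons.IH[of "us @ [y]"] by (simp add: split_beta)
  qed simp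
qed simp

lemma emono_sort_sign:
  "emono F (us @ xs) X = of_int (fst (sort_sign xs)) * emono F (us @ snd (sort_sign xs)) X"
proof (induction xs arbitrary: us)
  case (Cons x xs)
  have "emono F (us @ x # xs) X = emono F ((us @ [x]) @ xs) X" by simp
  also have "\<dots> = of_int (fst (sort_sign xs)) * emono F (us @ x # snd (sort_sign xs)) X"
    by (subst Cons.IH) simp
  finally show ?case
    by (simp add: emono_ins_sign[of F us x] split_beta)
qed simp

section \<open>Small determinants and the terms of the model form\<close>

lemma detform_singleton: "detform [f] X = f (X 0)"
  by (simp add: detform_Cons)

lemma detform_pair: "detform [f, g] X = f (X 0) * g (X 1) - f (X 1) * g (X 0)"
  by (simp add: detform_Cons omit_def atMost_Suc algebra_simps numeral_eq_Suc)

lemma detform_triple: "detform [f, g, h] X =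
   f (X 0) * detform [g, h] (\<lambda>n. X (n + 1)) - f (X 1) * (g (X 0) * h (X 2) - g (X 2) * h (X 0))
   + f (X 2) * detform [g, h] X"
  unfolding detform_Cons[of f]
  by (simp add: detform_pair omit_def atMost_Suc algebra_simps numeral_eq_Suc)

lemma detform_quad: "detform [f, g, h, k] X =
   f (X 0) * (g (X 1) * (h (X 2) * k (X 3) - h (X 3) * k (X 2)) - g (X 2) * (h (X 1) * k (X 3) - h (X 3) * k (X 1)) + g (X 3) * (h (X 1) * k (X 2) - h (X 2) * k (X 1)))
 - f (X 1) * (g (X 0) * (h (X 2) * k (X 3) - h (X 3) * k (X 2)) - g (X 2) * (h (X 0) * k (X 3) - h (X 3) * k (X 0)) + g (X 3) * (h (X 0) * k (X 2) - h (X 2) * k (X 0)))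
 + f (X 2) * (g (X 0) * (h (X 1) * k (X 3) - h (X 3) * k (X 1)) - g (X 1) * (h (X 0) * k (X 3) - h (X 3) * k (X 0)) + g (X 3) * (h (X 0) * k (X 1) - h (X 1) * k (X 0)))
 - f (X 3) * (g (X 0) * (h (X 1) * k (X 2) - h (X 2) * k (X 1)) - g (X 1) * (h (X 0) * k (X 2) - h (X 2) * k (X 0)) + g (X 2) * (h (X 0) * k (X 1) - h (X 1) * k (X 0)))"
  unfolding detform_Cons[of f]
  by (simp add: detform_triple detform_pair omit_def atMost_Suc numeral_eq_Suc)

definition spin7_terms :: "(int \<times> nat list) list" where
  "spin7_terms = [(1, [1,2,3,4]), (1, [1,2,5,6]), (-1, [1,2,7,8]), (1, [1,3,5,7]),
     (1, [1,3,6,8]), (1, [1,4,5,8]), (-1, [1,4,6,7]), (1, [5,6,7,8]),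
     (1, [3,4,7,8]), (-1, [3,4,5,6]), (1, [2,4,6,8]), (1, [2,4,5,7]),
     (-1, [2,3,5,8]), (1, [2,3,6,7])]"


lemma ins_sign_length: "length (snd (ins_sign x ys)) = Suc (length ys)"
  by (induction ys) (auto simp: split_beta)

lemma sort_sign_length: "length (snd (sort_sign xs)) = length xs"
  by (induction xs) (auto simp: split_beta ins_sign_length)

lemma ins_sign_sorted:
  assumes "sorted_wrt (<) ys" "fst (ins_sign x ys) \<noteq> 0"
  shows "sorted_wrt (<) (snd (ins_sign x ys)) \<and> set (snd (ins_sign x ys)) = insert x (set ys)"
  using assms by (induction ys) (auto simp: split_beta split: if_splits)

lemma sort_sign_sorted:
  assumes "fst (sort_sign xs) \<noteq> 0"
  shows "sorted_wrt (<) (snd (sort_sign xs)) \<and> set (snd (sort_sign xs)) = set xs"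
  using assms by (induction xs) (auto simp: split_beta ins_sign_sorted)

text \<open>If the sign is nonzero, \<open>n\<close> distinct indices among 1, ..., \<open>n\<close>
  exhaust the range, so the sorted list is the full one.\<close>

lemma emono_top:
  assumes "length xs = n" "set xs \<subseteq> {1..n}"
  shows "emono F xs X = of_int (fst (sort_sign xs)) * emono F [1..<Suc n] X"
proof (cases "fst (sort_sign xs) = 0")
  case False
  let ?ys = "snd (sort_sign xs)"
  note s = sort_sign_sorted[OF False]
  have "card (set ?ys) = n"
    using s assms(1) sort_sign_length[of xs]
    by (metis distinct_card strict_sorted_iff)
  then have "set ?ys = {1..n}"
    using s assms(2) by (intro card_subset_eq) auto
  then have "set ?ys = set [1..<Suc n]"
    by (simp add: atLeastLessThanSuc_atLeastAtMost del: upt_Suc)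
  moreover have "sorted_wrt (<) ?ys"
    using s by simp
  ultimately have "?ys = [1..<Suc n]"
    by (intro strict_sorted_equal sorted_wrt_upt)
  then show ?thesis
    using emono_sort_sign[of F "[]" xs X] by simp
next
  case True
  then show ?thesis
    using emono_sort_sign[of F "[]" xs X] by simp
qed

section \<open>Products of combinations of monomials\<close>

definition comb :: "(nat \<Rightarrow> 'v \<Rightarrow> 'a::comm_ring_1) \<Rightarrow> ('a \<times> nat list) list \<Rightarrow> (nat \<Rightarrow> 'v) \<Rightarrow> 'a" where
  "comb F L X = (\<Sum>(c, is)\<leftarrow>L. c * emono F is X)"

text \<open>Index lists are concatenated unsorted and like terms are not collected; signs are left
  to \<open>sort_sign\<close>.\<close>

definition comb_mult :: "('a::times \<times> nat list) list \<Rightarrow> ('a \<times> nat list) list \<Rightarrow> ('a \<times> nat list) list" where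
  "comb_mult L K = concat (map (\<lambda>(c, is). map (\<lambda>(d, js). (c * d, is @ js)) K) L)"

abbreviation of_int_terms :: "(int \<times> nat list) list \<Rightarrow> ('a::ring_1 \<times> nat list) list" where
  "of_int_terms \<equiv> map (map_prod of_int id)"

lemma comb_mult_of_int_terms:
  "comb_mult (of_int_terms L) (of_int_terms K) = of_int_terms (comb_mult L K)"
  by (simp add: comb_mult_def map_concat comp_def split_beta map_prod_def)


definition terms :: "nat \<Rightarrow> ('a \<times> nat list) list \<Rightarrow> bool" where
  "terms p L \<longleftrightarrow> (\<forall>x\<in>set L. length (snd x) = p \<and> set (snd x) \<subseteq> {1..8})"

lemma terms_comb_mult: "terms p L \<Longrightarrow> terms q K \<Longrightarrow> terms (p + q) (comb_mult L K)"
  by (fastforce simp: terms_def comb_mult_def)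

lemma terms_of_int: "terms p L \<Longrightarrow> terms p (of_int_terms L)"
  by (auto simp: terms_def)

lemma sum_list_concat_map: "sum_list (concat xss) = (\<Sum>xs\<leftarrow>xss. sum_list (xs :: 'a::monoid_add list))"
  by (induction xss) auto

lemma of_int_sum_list_map: "of_int (\<Sum>x\<leftarrow>xs. f x) = (\<Sum>x\<leftarrow>xs. of_int (f x))"
  by (induction xs) auto

lemma wedge_comb:
  assumes "terms p L" "terms q K"
  shows "wedge p q (comb F L) (comb F K) = comb F (comb_mult L K)"
proof
  fix X
  have *: "wedge p q (emono F (snd x)) (emono F (snd y)) = emono F (snd x @ snd y)"
    if "x \<in> set L" "y \<in> set K" for x y
    using assms that by (intro wedge_emono) (auto simp: terms_def)
  have "wedge p q (comb F L) (comb F K) X =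
    (\<Sum>x\<leftarrow>L. fst x * (\<Sum>y\<leftarrow>K. fst y * wedge p q (emono F (snd x)) (emono F (snd y)) X))"
    unfolding comb_def split_beta wedge_sum_list_left wedge_sum_list_right ..
  also have "\<dots> = (\<Sum>x\<leftarrow>L. \<Sum>y\<leftarrow>K. fst x * fst y * emono F (snd x @ snd y) X)"
    unfolding sum_list_const_mult[symmetric] mult.assoc
    by (intro arg_cong[of _ _ sum_list] map_cong refl) (simp add: *)
  also have "\<dots> = comb F (comb_mult L K) X"
    by (simp add: comb_def comb_mult_def comp_def split_beta map_concat sum_list_concat_map)
  finally show "wedge p q (comb F L) (comb F K) X = comb F (comb_mult L K) X" .
qed

lemma comb_top:
  assumes "terms 8 L"
  shows "comb F L X = (\<Sum>(c, is)\<leftarrow>L. c * of_int (fst (sort_sign is))) * emono F [1,2,3,4,5,6,7,8] X"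
proof -
  have [simp]: "[Suc 0..<9] = [Suc 0,2,3,4,5,6,7,8]" by code_simp
  have "emono F (snd x) X = of_int (fst (sort_sign (snd x))) * emono F [1,2,3,4,5,6,7,8] X" if "x \<in> set L" for x
    using emono_top[of "snd x" 8 F X] assms that by (simp add: terms_def)
  then have "comb F L X = (\<Sum>x\<leftarrow>L. fst x * of_int (fst (sort_sign (snd x))) * emono F [1,2,3,4,5,6,7,8] X)"
    unfolding comb_def split_beta by (intro arg_cong[of _ _ sum_list] map_cong) (auto simp: mult.assoc)
  then show ?thesis by (simp add: sum_list_mult_const case_prod_unfold)
qed

lemma spin7_form_comb:
  "spin7_form f = comb (\<lambda>n. f (of_nat n)) (of_int_terms spin7_terms)"
  by (simp add: fun_eq_iff spin7_form_def spin7_terms_def wmono_eq_detform comb_def emono_def)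

lemma terms_spin7: "terms 4 spin7_terms"
  by (simp add: terms_def spin7_terms_def)

text \<open>Only complementary terms have a nonzero product, and each of the 14 ordered pairs of
  them contributes 1. The sum is evaluated over the integers.\<close>

lemma spin7_form_square:
  "wedge 4 4 (spin7_form f) (spin7_form f) X = 14 * wmono f [1,2,3,4,5,6,7,8] X"
proof -
  let ?F = "\<lambda>n. f (of_nat n)"
  let ?L = "comb_mult spin7_terms spin7_terms"
  have "wedge 4 4 (spin7_form f) (spin7_form f) X = comb ?F (of_int_terms ?L) X"
    unfolding spin7_form_comb comb_mult_of_int_terms[symmetric]
    by (subst wedge_comb) (auto intro: terms_of_int terms_spin7)
  also have "\<dots> = (\<Sum>(c, is)\<leftarrow>of_int_terms ?L. c * of_int (fst (sort_sign is))) * emono ?F [1,2,3,4,5,6,7,8] X"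
    using terms_comb_mult[OF terms_spin7 terms_spin7] by (intro comb_top terms_of_int) simp
  also have "(\<Sum>(c, is)\<leftarrow>of_int_terms ?L. c * of_int (fst (sort_sign is))) =
      of_int (\<Sum>(c, is)\<leftarrow>?L. c * fst (sort_sign is))"
    by (simp add: of_int_sum_list_map comp_def split_beta)
  also have "(\<Sum>(c, is)\<leftarrow>?L. c * fst (sort_sign is)) = 14"
    by code_simp
  also have "emono ?F [1,2,3,4,5,6,7,8] X = wmono f [1,2,3,4,5,6,7,8] X"
    by (simp add: wmono_eq_detform emono_def)
  finally show ?thesis by simp
qed

section \<open>Contractions of the Spin(7)-form\<close>

definition pairs8 :: "nat list list" where
  "pairs8 = [[1,2],[1,3],[1,4],[1,5],[1,6],[1,7],[1,8],[2,3],[2,4],[2,5],[2,6],[2,7],[2,8],[3,4],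
     [3,5],[3,6],[3,7],[3,8],[4,5],[4,6],[4,7],[4,8],[5,6],[5,7],[5,8],[6,7],[6,8],[7,8]]"

definition quads8 :: "nat list list" where
  "quads8 = [[a, b, c, d]. a \<leftarrow> [1,2,3,4,5,6,7,8], b \<leftarrow> [1,2,3,4,5,6,7,8], a < b,
     c \<leftarrow> [1,2,3,4,5,6,7,8], b < c, d \<leftarrow> [1,2,3,4,5,6,7,8], c < d]"

definition spin7_coeff :: "nat list \<Rightarrow> int" where
  "spin7_coeff t = (\<Sum>(d, B)\<leftarrow>spin7_terms. if B = t then d else 0)"

text \<open>The model form equals its Hodge dual, checked on all 70 increasing quadruples.\<close>

lemma spin7_self_dual:
  "\<forall>t\<in>set quads8. (\<Sum>(d, B)\<leftarrow>spin7_terms. d * fst (sort_sign (B @ t))) = spin7_coeff t"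
  by code_simp

text \<open>The components of the 2-form \<open>\<Phi>(v, w, _, _)\<close>, given those of \<open>p = v \<and> w\<close>.\<close>

definition spin7_contr :: "(nat \<Rightarrow> nat \<Rightarrow> 'a::comm_ring_1) \<Rightarrow> nat list \<Rightarrow> 'a" where
  "spin7_contr p k = the (map_of [
     ([1,2], p 3 4 + p 5 6 - p 7 8), ([1,3], - p 2 4 + p 5 7 + p 6 8),
     ([1,4], p 2 3 + p 5 8 - p 6 7), ([1,5], - p 2 6 - p 3 7 - p 4 8),
     ([1,6], p 2 5 - p 3 8 + p 4 7), ([1,7], p 2 8 + p 3 5 - p 4 6),
     ([1,8], - p 2 7 + p 3 6 + p 4 5), ([2,3], p 1 4 - p 5 8 + p 6 7),
     ([2,4], - p 1 3 + p 5 7 + p 6 8), ([2,5], p 1 6 + p 3 8 - p 4 7),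
     ([2,6], - p 1 5 - p 3 7 - p 4 8), ([2,7], - p 1 8 + p 3 6 + p 4 5),
     ([2,8], p 1 7 - p 3 5 + p 4 6), ([3,4], p 1 2 - p 5 6 + p 7 8),
     ([3,5], p 1 7 - p 2 8 + p 4 6), ([3,6], p 1 8 + p 2 7 - p 4 5),
     ([3,7], - p 1 5 - p 2 6 - p 4 8), ([3,8], - p 1 6 + p 2 5 + p 4 7),
     ([4,5], p 1 8 + p 2 7 - p 3 6), ([4,6], - p 1 7 + p 2 8 + p 3 5),
     ([4,7], p 1 6 - p 2 5 + p 3 8), ([4,8], - p 1 5 - p 2 6 - p 3 7),
     ([5,6], p 1 2 - p 3 4 + p 7 8), ([5,7], p 1 3 + p 2 4 - p 6 8),
     ([5,8], p 1 4 - p 2 3 + p 6 7), ([6,7], - p 1 4 + p 2 3 + p 5 8),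
     ([6,8], p 1 3 + p 2 4 - p 5 7), ([7,8], - p 1 2 + p 3 4 + p 5 6)] k)"

text \<open>The coefficient of \<open>f\<^sup>k \<and> f\<^sup>k' \<and> \<Phi>\<close> with respect to the volume form, by self-duality of \<open>\<Phi>\<close>.\<close>

definition pair_coeff :: "nat list \<Rightarrow> nat list \<Rightarrow> int" where
  "pair_coeff k k' = (case sort_sign (k @ k') of (s, t) \<Rightarrow> if s = 0 then 0 else s * spin7_coeff t)"

text \<open>Every pair of indices lies in exactly three terms of \<Phi>, so 84 of the 784
  coefficients are nonzero. Listing them keeps the symbolic sum small.\<close>

definition pair_table :: "(nat list \<times> nat list \<times> int) list" where
  "pair_table = [
     ([1,2], [3,4], 1), ([1,2], [5,6], 1), ([1,2], [7,8], -1), ([1,3], [2,4], -1), ([1,3], [5,7], 1),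
     ([1,3], [6,8], 1), ([1,4], [2,3], 1), ([1,4], [5,8], 1), ([1,4], [6,7], -1), ([1,5], [2,6], -1),
     ([1,5], [3,7], -1), ([1,5], [4,8], -1), ([1,6], [2,5], 1), ([1,6], [3,8], -1), ([1,6], [4,7], 1),
     ([1,7], [2,8], 1), ([1,7], [3,5], 1), ([1,7], [4,6], -1), ([1,8], [2,7], -1), ([1,8], [3,6], 1),
     ([1,8], [4,5], 1), ([2,3], [1,4], 1), ([2,3], [5,8], -1), ([2,3], [6,7], 1), ([2,4], [1,3], -1),
     ([2,4], [5,7], 1), ([2,4], [6,8], 1), ([2,5], [1,6], 1), ([2,5], [3,8], 1), ([2,5], [4,7], -1),
     ([2,6], [1,5], -1), ([2,6], [3,7], -1), ([2,6], [4,8], -1), ([2,7], [1,8], -1), ([2,7], [3,6], 1),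
     ([2,7], [4,5], 1), ([2,8], [1,7], 1), ([2,8], [3,5], -1), ([2,8], [4,6], 1), ([3,4], [1,2], 1),
     ([3,4], [5,6], -1), ([3,4], [7,8], 1), ([3,5], [1,7], 1), ([3,5], [2,8], -1), ([3,5], [4,6], 1),
     ([3,6], [1,8], 1), ([3,6], [2,7], 1), ([3,6], [4,5], -1), ([3,7], [1,5], -1), ([3,7], [2,6], -1),
     ([3,7], [4,8], -1), ([3,8], [1,6], -1), ([3,8], [2,5], 1), ([3,8], [4,7], 1), ([4,5], [1,8], 1),
     ([4,5], [2,7], 1), ([4,5], [3,6], -1), ([4,6], [1,7], -1), ([4,6], [2,8], 1), ([4,6], [3,5], 1),
     ([4,7], [1,6], 1), ([4,7], [2,5], -1), ([4,7], [3,8], 1), ([4,8], [1,5], -1), ([4,8], [2,6], -1),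
     ([4,8], [3,7], -1), ([5,6], [1,2], 1), ([5,6], [3,4], -1), ([5,6], [7,8], 1), ([5,7], [1,3], 1),
     ([5,7], [2,4], 1), ([5,7], [6,8], -1), ([5,8], [1,4], 1), ([5,8], [2,3], -1), ([5,8], [6,7], 1),
     ([6,7], [1,4], -1), ([6,7], [2,3], 1), ([6,7], [5,8], 1), ([6,8], [1,3], 1), ([6,8], [2,4], 1),
     ([6,8], [5,7], -1), ([7,8], [1,2], -1), ([7,8], [3,4], 1), ([7,8], [5,6], 1)]"

lemma pair_table:
  "filter (\<lambda>(k, k', e). e \<noteq> 0) [(k, k', pair_coeff k k'). k \<leftarrow> pairs8, k' \<leftarrow> pairs8] = pair_table"
  by code_simp

lemma spin7_contraction:
  fixes v w :: vec8 and f
  defines "F \<equiv> \<lambda>n. f (of_nat n)"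
  defines "p \<equiv> \<lambda>i j. F i v * F j w - F j v * F i w"
  shows "(\<lambda>X. spin7_form f (case_nat v (case_nat w X))) = comb F (map (\<lambda>k. (spin7_contr p k, k)) pairs8)"
proof
  fix X
  \<comment> \<open>Laplace expansion along the first two columns, whose minors are the numbers
    \<open>p i j\<close>.\<close>
  have quad: "emono F [a, b, c, d] (case_nat v (case_nat w X)) =
      p a b * emono F [c, d] X - p a c * emono F [b, d] X + p a d * emono F [b, c] X
    + p b c * emono F [a, d] X - p b d * emono F [a, c] X + p c d * emono F [a, b] X" for a b c d
    by (simp add: emono_def detform_quad detform_pair p_def algebra_simps)
  show "spin7_form f (case_nat v (case_nat w X)) = comb F (map (\<lambda>k. (spin7_contr p k, k)) pairs8) X"
    unfolding spin7_form_comb F_def[symmetric]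
    by (simp add: comb_def spin7_terms_def quad spin7_contr_def pairs8_def)
       (simp only: distrib_left distrib_right left_diff_distrib right_diff_distrib mult_minus_left mult_minus_right)
qed


text \<open>The 28 pairs fall into seven groups of four, one for each of \<open>e1\<close> to
  \<open>e7\<close>. On a group, contraction with \<Phi> is a symmetric matrix S with eigenvalues 1,
  1, 1, -3, so S^3 = 7S - 6. The left side is the form S evaluated at q = Sp, that is S^3 evaluated
  at p. The \<open>P\<close> are Pluecker expressions.\<close>

lemma pair_table_sum:
  fixes p :: "nat \<Rightarrow> nat \<Rightarrow> real"
  defines "P \<equiv> \<lambda>a b c d. p a b * p c d - p a c * p b d + p a d * p b c"
  shows "(\<Sum>(k, k', e)\<leftarrow>pair_table. spin7_contr p k * spin7_contr p k' * of_int e) =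
    14 * (P 1 2 3 4 + P 1 2 5 6 - P 1 2 7 8 + P 1 3 5 7 + P 1 3 6 8 + P 1 4 5 8 - P 1 4 6 7 + P 5 6 7 8 + P 3 4 7 8 - P 3 4 5 6 + P 2 4 6 8 + P 2 4 5 7 - P 2 3 5 8 + P 2 3 6 7) - 6 * (\<Sum>k\<leftarrow>pairs8. (p (k ! 0) (k ! 1))\<^sup>2)"
proof -
  define q where "q i j = spin7_contr p [i, j]" for i j
  have e1: "2 * (q 1 2 * q 3 4 + q 1 2 * q 5 6 - q 1 2 * q 7 8 - q 3 4 * q 5 6 + q 3 4 * q 7 8 + q 5 6 * q 7 8) = - 6 * ((p 1 2)\<^sup>2 + (p 3 4)\<^sup>2 + (p 5 6)\<^sup>2 + (p 7 8)\<^sup>2)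
      + 14 * (p 1 2 * p 3 4 + p 1 2 * p 5 6 - p 1 2 * p 7 8 - p 3 4 * p 5 6 + p 3 4 * p 7 8 + p 5 6 * p 7 8)"
    by (simp add: q_def spin7_contr_def algebra_simps power2_eq_square)
  have e2: "2 * (- q 1 3 * q 2 4 + q 1 3 * q 5 7 + q 1 3 * q 6 8 + q 2 4 * q 5 7 + q 2 4 * q 6 8 - q 5 7 * q 6 8) = - 6 * ((p 1 3)\<^sup>2 + (p 2 4)\<^sup>2 + (p 5 7)\<^sup>2 + (p 6 8)\<^sup>2)
      + 14 * (- p 1 3 * p 2 4 + p 1 3 * p 5 7 + p 1 3 * p 6 8 + p 2 4 * p 5 7 + p 2 4 * p 6 8 - p 5 7 * p 6 8)"
    by (simp add: q_def spin7_contr_def algebra_simps power2_eq_square)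
  have e3: "2 * (q 1 4 * q 2 3 + q 1 4 * q 5 8 - q 1 4 * q 6 7 - q 2 3 * q 5 8 + q 2 3 * q 6 7 + q 5 8 * q 6 7) = - 6 * ((p 1 4)\<^sup>2 + (p 2 3)\<^sup>2 + (p 5 8)\<^sup>2 + (p 6 7)\<^sup>2)
      + 14 * (p 1 4 * p 2 3 + p 1 4 * p 5 8 - p 1 4 * p 6 7 - p 2 3 * p 5 8 + p 2 3 * p 6 7 + p 5 8 * p 6 7)"
    by (simp add: q_def spin7_contr_def algebra_simps power2_eq_square)
  have e4: "2 * (- q 1 5 * q 2 6 - q 1 5 * q 3 7 - q 1 5 * q 4 8 - q 2 6 * q 3 7 - q 2 6 * q 4 8 - q 3 7 * q 4 8) = - 6 * ((p 1 5)\<^sup>2 + (p 2 6)\<^sup>2 + (p 3 7)\<^sup>2 + (p 4 8)\<^sup>2)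
      + 14 * (- p 1 5 * p 2 6 - p 1 5 * p 3 7 - p 1 5 * p 4 8 - p 2 6 * p 3 7 - p 2 6 * p 4 8 - p 3 7 * p 4 8)"
    by (simp add: q_def spin7_contr_def algebra_simps power2_eq_square)
  have e5: "2 * (q 1 6 * q 2 5 - q 1 6 * q 3 8 + q 1 6 * q 4 7 + q 2 5 * q 3 8 - q 2 5 * q 4 7 + q 3 8 * q 4 7) = - 6 * ((p 1 6)\<^sup>2 + (p 2 5)\<^sup>2 + (p 3 8)\<^sup>2 + (p 4 7)\<^sup>2)
      + 14 * (p 1 6 * p 2 5 - p 1 6 * p 3 8 + p 1 6 * p 4 7 + p 2 5 * p 3 8 - p 2 5 * p 4 7 + p 3 8 * p 4 7)"
    by (simp add: q_def spin7_contr_def algebra_simps power2_eq_square)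
  have e6: "2 * (q 1 7 * q 2 8 + q 1 7 * q 3 5 - q 1 7 * q 4 6 - q 2 8 * q 3 5 + q 2 8 * q 4 6 + q 3 5 * q 4 6) = - 6 * ((p 1 7)\<^sup>2 + (p 2 8)\<^sup>2 + (p 3 5)\<^sup>2 + (p 4 6)\<^sup>2)
      + 14 * (p 1 7 * p 2 8 + p 1 7 * p 3 5 - p 1 7 * p 4 6 - p 2 8 * p 3 5 + p 2 8 * p 4 6 + p 3 5 * p 4 6)"
    by (simp add: q_def spin7_contr_def algebra_simps power2_eq_square)
  have e7: "2 * (- q 1 8 * q 2 7 + q 1 8 * q 3 6 + q 1 8 * q 4 5 + q 2 7 * q 3 6 + q 2 7 * q 4 5 - q 3 6 * q 4 5) = - 6 * ((p 1 8)\<^sup>2 + (p 2 7)\<^sup>2 + (p 3 6)\<^sup>2 + (p 4 5)\<^sup>2)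
      + 14 * (- p 1 8 * p 2 7 + p 1 8 * p 3 6 + p 1 8 * p 4 5 + p 2 7 * p 3 6 + p 2 7 * p 4 5 - p 3 6 * p 4 5)"
    by (simp add: q_def spin7_contr_def algebra_simps power2_eq_square)
  show ?thesis
    using e1 e2 e3 e4 e5 e6 e7
    by (simp add: pair_table_def pairs8_def P_def q_def[symmetric] mult.commute)
qed

section \<open>The metric and the volume form of an admissible 4-form\<close>

lemma UNIV_8: "(UNIV :: 8 set) = {1, 2, 3, 4, 5, 6, 7, 8}" "card {1, 2, 3, 4, 5, 6, 7, 8 :: 8} = 8"
proof -
  show "card {1, 2, 3, 4, 5, 6, 7, 8 :: 8} = 8"
    by simp
  then show "(UNIV :: 8 set) = {1, 2, 3, 4, 5, 6, 7, 8}"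
    by (intro card_subset_eq[symmetric]) auto
qed

lemma sum_8: "(\<Sum>i\<in>(UNIV :: 8 set). h i) = h 1 + h 2 + h 3 + h 4 + h 5 + h 6 + h 7 + (h 8 :: 'a::comm_monoid_add)"
  unfolding UNIV_8 by (simp add: add_ac)

lemma sum_list_flatten:
  "(\<Sum>x\<leftarrow>concat (map (\<lambda>a. map (g a) K) L). h x) = (\<Sum>a\<leftarrow>L. \<Sum>b\<leftarrow>K. (h (g a b) :: 'a::monoid_add))"
  by (induction L) (auto simp: comp_def)

lemma sum_list_swap:
  "(\<Sum>x\<leftarrow>A. \<Sum>y\<leftarrow>B. g x y) = (\<Sum>y\<leftarrow>B. \<Sum>x\<leftarrow>A. (g x y :: 'a::comm_monoid_add))"
  by (induction A) (simp_all add: sum_list_addf)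

lemma sum_list_nonzero:
  "(\<Sum>(k, k', e)\<leftarrow>filter (\<lambda>(k, k', e). e \<noteq> 0) L. h k k' * of_int e) =
   (\<Sum>(k, k', e)\<leftarrow>L. h k k' * (of_int e :: real))"
  by (induction L) auto

lemma quads8_I:
  assumes "length t = 4" "set t \<subseteq> {1..8}" "sorted_wrt (<) t"
  shows "t \<in> set quads8"
proof -
  obtain a b c d where t: "t = [a, b, c, d]"
    using assms(1) by (auto simp: length_Suc_conv numeral_eq_Suc)
  have *: "{1..8} = set [1,2,3,4,5,6,7,8::nat]" by auto
  have "[a, b, c, d] \<in> set [[a, b, c, d]. a \<leftarrow> A, b \<leftarrow> A, a < b, c \<leftarrow> A, b < c, d \<leftarrow> A, c < d]"
    if "{a, b, c, d} \<subseteq> set A" "a < b" "b < c" "c < d" for A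
    using that by auto
  from this[of "[1,2,3,4,5,6,7,8]"] show ?thesis
    using assms(2,3) unfolding * t quads8_def by (simp only: list.set sorted_wrt.simps) blast
qed

text \<open>Sorting the last four indices turns this into the wedge product of \<Phi> with an
  increasing monomial, where self-duality applies.\<close>

lemma spin7_wedge_pair:
  assumes "length k = 2" "length k' = 2" "set k \<subseteq> {1..8}" "set k' \<subseteq> {1..8}"
  shows "(\<Sum>(d, B)\<leftarrow>spin7_terms. of_int d * emono F (B @ k @ k') X) =
    of_int (pair_coeff k k') * emono F [1,2,3,4,5,6,7,8] X"
proof -
  obtain s t where st: "sort_sign (k @ k') = (s, t)" by fastforce
  have 1: "emono F (B @ k @ k') X = of_int s * emono F (B @ t) X" for B
    using emono_sort_sign[of F B "k @ k'" X] by (simp add: st)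
  show ?thesis
  proof (cases "s = 0")
    case True
    then show ?thesis by (simp add: 1 pair_coeff_def st case_prod_unfold)
  next
    case False
    have t: "length t = 4" "set t \<subseteq> {1..8}" "sorted_wrt (<) t"
      using sort_sign_length[of "k @ k'"] sort_sign_sorted[of "k @ k'"] False assms by (auto simp: st)
    have "terms 8 (comb_mult spin7_terms [(1, t)])"
      using terms_comb_mult[OF terms_spin7, of 4 "[(1, t)]"] t by (simp add: terms_def)
    then have "terms 8 (of_int_terms (comb_mult spin7_terms [(1, t)]))"
      by (rule terms_of_int)
    from comb_top[OF this, of F X]
    have "(\<Sum>(d, B)\<leftarrow>spin7_terms. of_int d * emono F (B @ t) X) =
       of_int (\<Sum>(d, B)\<leftarrow>spin7_terms. d * fst (sort_sign (B @ t))) * emono F [1,2,3,4,5,6,7,8] X"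
      by (simp add: comb_def comb_mult_def case_prod_unfold comp_def of_int_sum_list_map sum_list_concat_map map_concat)
    also have "(\<Sum>(d, B)\<leftarrow>spin7_terms. d * fst (sort_sign (B @ t))) = spin7_coeff t"
      using spin7_self_dual quads8_I[OF t] by blast
    finally show ?thesis
      using False by (simp add: 1 pair_coeff_def st case_prod_unfold mult.left_commute[of _ "of_int s"] sum_list_const_mult)
  qed
qed

lemma pairs8_cases: "k \<in> set pairs8 \<Longrightarrow> length k = 2 \<and> set k \<subseteq> {1..8}"
  by (auto simp: pairs8_def)

lemma lagrange_8:
  fixes a b :: "8 \<Rightarrow> real"
  defines "p \<equiv> \<lambda>i j. a (of_nat i) * b (of_nat j) - a (of_nat j) * b (of_nat i)"
  shows "(\<Sum>k\<leftarrow>pairs8. (p (k ! 0) (k ! 1))\<^sup>2) =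
    (\<Sum>i\<in>UNIV. (a i)\<^sup>2) * (\<Sum>i\<in>UNIV. (b i)\<^sup>2) - (\<Sum>i\<in>UNIV. a i * b i)\<^sup>2"
  by (simp add: pairs8_def p_def sum_8 algebra_simps power2_eq_square)

lemma spin7_norm_identity:
  fixes f and v w :: vec8
  defines "\<omega> \<equiv> (\<lambda>X. spin7_form f (case_nat v (case_nat w X)))"
  shows "wedge 4 4 (spin7_form f) (wedge 2 2 \<omega> \<omega>) X =
    - 6 * ((\<Sum>i\<in>UNIV. (f i v)\<^sup>2) * (\<Sum>i\<in>UNIV. (f i w)\<^sup>2) - (\<Sum>i\<in>UNIV. f i v * f i w)\<^sup>2) *
    wmono f [1,2,3,4,5,6,7,8] X"
proof -
  define F where "F = (\<lambda>n. f (of_nat n))"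
  define p where "p = (\<lambda>i j. F i v * F j w - F j v * F i w)"
  let ?L = "map (\<lambda>k. (spin7_contr p k, k)) pairs8"
  let ?T = "emono F [1,2,3,4,5,6,7,8] X"
  have L: "terms 2 ?L"
    using pairs8_cases by (auto simp: terms_def)
  have W: "(\<Sum>(d, B)\<leftarrow>spin7_terms. of_int d * emono F (B @ k @ k') X) = of_int (pair_coeff k k') * ?T"
    if "k \<in> set pairs8" "k' \<in> set pairs8" for k k'
    using spin7_wedge_pair[of k k' F X] pairs8_cases that by blast
  have \<omega>: "\<omega> = comb F ?L"
    unfolding \<omega>_def F_def p_def by (rule spin7_contraction)
  have \<Phi>: "spin7_form f = comb F (of_int_terms spin7_terms)"
    unfolding F_def by (rule spin7_form_comb)
  have "wedge 4 4 (spin7_form f) (wedge 2 2 \<omega> \<omega>) X =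
     comb F (comb_mult (of_int_terms spin7_terms) (comb_mult ?L ?L)) X"
    unfolding \<omega> \<Phi> using wedge_comb[OF terms_of_int[OF terms_spin7] terms_comb_mult[OF L L]]
    by (simp add: wedge_comb[OF L L])
  also have "\<dots> = (\<Sum>x\<leftarrow>spin7_terms. \<Sum>k\<leftarrow>pairs8. \<Sum>k'\<leftarrow>pairs8.
      spin7_contr p k * spin7_contr p k' * (of_int (fst x) * emono F (snd x @ k @ k') X))"
    by (simp add: comb_def comb_mult_def case_prod_unfold comp_def map_concat sum_list_concat_map mult_ac)
  also have "\<dots> = (\<Sum>k\<leftarrow>pairs8. \<Sum>k'\<leftarrow>pairs8. spin7_contr p k * spin7_contr p k' *
      (\<Sum>(d, B)\<leftarrow>spin7_terms. of_int d * emono F (B @ k @ k') X))"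
    by (rule trans[OF sum_list_swap], rule arg_cong[of _ _ sum_list], rule map_cong[OF refl], rule trans[OF sum_list_swap])
       (simp add: case_prod_unfold sum_list_const_mult[symmetric])
  also have "\<dots> = (\<Sum>k\<leftarrow>pairs8. \<Sum>k'\<leftarrow>pairs8. spin7_contr p k * spin7_contr p k' * of_int (pair_coeff k k') * ?T)"
    by (intro arg_cong[of _ _ sum_list] map_cong refl) (simp add: W mult.assoc del: One_nat_def)
  also have "\<dots> = (\<Sum>(k, k', e)\<leftarrow>pair_table. spin7_contr p k * spin7_contr p k' * of_int e) * ?T"
    unfolding pair_table[symmetric] sum_list_nonzero sum_list_flatten
    by (simp add: sum_list_mult_const)
  \<comment> \<open>Here \<open>p\<close> consists of the coordinates of the decomposable bivector v
    \<and> w, so the Pluecker expressions vanish and only the squares remain.\<close>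
  also have "(\<Sum>(k, k', e)\<leftarrow>pair_table. spin7_contr p k * spin7_contr p k' * of_int e) =
      - 6 * (\<Sum>k\<leftarrow>pairs8. (p (k ! 0) (k ! 1))\<^sup>2)"
    unfolding pair_table_sum by (simp add: p_def algebra_simps)
  also have "(\<Sum>k\<leftarrow>pairs8. (p (k ! 0) (k ! 1))\<^sup>2) =
      (\<Sum>i\<in>UNIV. (f i v)\<^sup>2) * (\<Sum>i\<in>UNIV. (f i w)\<^sup>2) - (\<Sum>i\<in>UNIV. f i v * f i w)\<^sup>2"
    using lagrange_8[of "\<lambda>i. f i v" "\<lambda>i. f i w"] by (simp add: p_def F_def)
  also have "?T = wmono f [1,2,3,4,5,6,7,8] X"
    by (simp add: wmono_eq_detform emono_def F_def)
  finally show ?thesis .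
qed

lemma wmono_dual_basis:
  assumes "\<And>i j :: 8. f i (u j) = (if i = j then 1 else 0)"
  shows "wmono f [1,2,3,4,5,6,7,8] (\<lambda>n. u (of_nat (Suc n))) = 1"
proof -
  let ?l = "[1,2,3,4,5,6,7,8::8]"
  have l: "?l ! b = of_nat (Suc b)" if "b < 8" for b
  proof -
    have "b \<in> {0,1,2,3,4,5,6,7}" using that by auto
    then show ?thesis by auto
  qed
  have "distinct ?l" by simp
  then have "(?l ! a = of_nat (Suc b)) = (a = b)" if "a < 8" "b < 8" for a b
    using nth_eq_iff_index_eq[of ?l a b] that l[of b] by simp
  then have "(map f ?l ! a) (u (of_nat (Suc b))) = (if a = b then 1 else 0)" if "a < 8" "b < 8" for a b
    using that by (simp add: nth_map assms del: list.map of_nat_Suc)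
  then have "Matrix.mat 8 8 (\<lambda>(a, b). (map f ?l ! a) (u (of_nat (Suc b)))) = 1\<^sub>m 8"
    by (intro eq_matI) (simp_all del: of_nat_Suc list.map)
  moreover have "length (map f ?l) = 8" by simp
  ultimately show ?thesis
    unfolding wmono_eq_detform detform_eq_det by (simp only: det_one)
qed

text \<open>Linear independence says that no nonzero vector is orthogonal to the range of
  \<open>L\<close>, so \<open>L\<close> is onto and, by dimension, bijective. The \<open>u j\<close>
  are the preimages of the standard basis.\<close>

lemma coframe_dual_basis:
  assumes "coframe f"
  obtains u where "\<And>i j :: 8. f i (u j) = (if i = j then 1 else 0)"
    "\<And>x. x = (\<Sum>i\<in>UNIV. f i x *\<^sub>R u i)"
proof -
  define L where "L x = (\<chi> i. f i x)" for x
  have lin: "linear L"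
    using assms unfolding coframe_def L_def
    by (intro linearI) (auto simp: vec_eq_iff linear_add linear_scale)
  have surj: "surj L"
  proof (rule ccontr)
    assume "\<not> surj L"
    then have "span (range L) \<noteq> UNIV"
      using linear_subspace_image[OF lin subspace_UNIV] by (metis span_eq_iff)
    then have "span (range L) \<subset> UNIV" by blast
    then obtain c where c: "c \<noteq> 0" "\<And>y. y \<in> span (range L) \<Longrightarrow> orthogonal c y"
      using orthogonal_to_subspace_exists_gen[of "range L" UNIV] by auto
    have "orthogonal c (L x)" for x
      using c(2) by (blast intro: span_base)
    then have "\<forall>x. (\<Sum>i\<in>UNIV. c $ i * f i x) = 0"
      by (simp add: orthogonal_def inner_vec_def L_def)
    with assms have "\<forall>i. c $ i = 0" unfolding coframe_def by blast
    with c(1) show False by (simp add: vec_eq_iff)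
  qed
  have "\<forall>j. \<exists>x. L x = axis j 1"
    using surj by (metis surjD)
  then obtain u where Lu: "\<And>j. L (u j) = axis j 1"
    by metis
  have u: "f i (u j) = (if i = j then 1 else 0)" for i j
    using arg_cong[OF Lu[of j], of "\<lambda>y. y $ i"] by (simp add: L_def axis_def)
  have "L x = L (\<Sum>i\<in>UNIV. f i x *\<^sub>R u i)" for x
  proof -
    have "f j (\<Sum>i\<in>UNIV. f i x *\<^sub>R u i) = f j x" for j
      using assms u unfolding coframe_def
      by (simp add: linear_sum linear_scale if_distrib[of "\<lambda>t. _ * t"] cong: if_cong)
    then show ?thesis by (simp add: L_def)
  qed
  then have "x = (\<Sum>i\<in>UNIV. f i x *\<^sub>R u i)" for x
    using linear_surjective_imp_injective[OF lin surj] by (simp add: inj_eq)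
  with u that show ?thesis by blast
qed

lemma spin7_form_determines_volume:
  assumes "spin7_form f = spin7_form f'"
  shows "wmono f [1,2,3,4,5,6,7,8] = wmono f' [1,2,3,4,5,6,7,8]"
  using spin7_form_square[of f] spin7_form_square[of f'] assms by (auto simp: fun_eq_iff)

text \<open>Both metrics have the same areas \<open>|v \<and> w|\<close>, hence Gram matrices with the same \<open>2 \<times> 2\<close> minors,
  which determine a positive matrix of size at least 3.\<close>

lemma spin7_form_determines_metric:
  assumes f: "coframe f" and f': "coframe f'" and eq: "spin7_form f = spin7_form f'"
  shows "(\<Sum>i\<in>UNIV. f i x * f i y) = (\<Sum>i\<in>UNIV. f' i x * f' i y)"
proof -
  define g where "g v w = (\<Sum>i\<in>UNIV. f' i v * f' i w)" for v w
  define h where "h v w = (\<Sum>i\<in>UNIV. f i v * f i w)" for v w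
  obtain u where u: "\<And>i j. f i (u j) = (if i = j then 1 else 0)"
    and exp: "\<And>x. x = (\<Sum>i\<in>UNIV. f i x *\<^sub>R u i)"
    using coframe_dual_basis[OF f] by metis
  have lin: "linear (f i)" "linear (f' i)" for i
    using f f' by (auto simp: coframe_def)
  have bil: "g (v + w) z = g v z + g w z" "g z (v + w) = g z v + g z w" "g (c *\<^sub>R v) z = c * g v z"
    "g z (c *\<^sub>R v) = c * g z v" "h (v + w) z = h v z + h w z" "h z (v + w) = h z v + h z w" for v w z c
    by (simp_all add: g_def h_def linear_add[OF lin(1)] linear_add[OF lin(2)] linear_scale[OF lin(2)]
        algebra_simps sum.distrib sum_distrib_left)
  have sym: "g v w = g w v" "h v w = h w v" for v w
    by (simp_all add: g_def h_def mult.commute)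
  have area: "g v v * g w w - (g v w)\<^sup>2 = h v v * h w w - (h v w)\<^sup>2" for v w
  proof -
    \<comment> \<open>On the basis dual to \<open>f\<close> the common volume form equals 1, so it
      can be cancelled from the two norm identities.\<close>
    define X where "X n = u (of_nat (Suc n))" for n
    have "wmono f [1,2,3,4,5,6,7,8] X = 1"
      unfolding X_def using u by (rule wmono_dual_basis)
    then show ?thesis
      using spin7_norm_identity[of f v w X] spin7_norm_identity[of f' v w X]
      unfolding eq spin7_form_determines_volume[OF eq]
      by (simp add: g_def h_def power2_eq_square del: wmono.simps)
  qed
  \<comment> \<open>Polarisation of \<open>area\<close> in its second argument.\<close>
  have pol: "g v v * g w z - g v w * g v z = h v v * h w z - h v w * h v z" for v w z
    using area[of v w] area[of v z] area[of v "w + z"] sym[of w z]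
    by (simp add: bil power2_eq_square algebra_simps)
  have hu: "h (u i) (u j) = (if i = j then 1 else 0)" for i j
    by (simp add: h_def u if_distrib[of "\<lambda>t. _ * t"] cong: if_cong)
  have gu: "g (u i) (u j) = 0 \<and> g (u i) (u i) = 1" if "i \<noteq> j" for i j
  proof -
    \<comment> \<open>A third index is essential: for a 2 \<times> 2 Gram matrix the minors fix only
      the determinant.\<close>
    have "\<exists>k. k \<noteq> i \<and> k \<noteq> j"
    proof (rule ccontr)
      assume "\<not> ?thesis"
      then have "(UNIV :: 8 set) \<subseteq> {i, j}" by auto
      from card_mono[OF _ this] show False by (simp add: card_insert_if split: if_splits)
    qed
    then obtain k where k: "k \<noteq> i" "k \<noteq> j" by blast
    define a b c p q r where "a = g (u i) (u i)" and "b = g (u j) (u j)" and "c = g (u k) (u k)"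
      and "p = g (u i) (u j)" and "q = g (u i) (u k)" and "r = g (u j) (u k)"
    note d = this
    have e: "a * r = p * q" "b * q = p * r" "c * p = q * r" "a * b = 1 + p\<^sup>2" "a * c = 1 + q\<^sup>2" "b * c = 1 + r\<^sup>2"
      using pol[of "u i" "u j" "u k"] pol[of "u j" "u i" "u k"] pol[of "u k" "u i" "u j"]
        area[of "u i" "u j"] area[of "u i" "u k"] area[of "u j" "u k"] that k sym
      by (auto simp: d hu algebra_simps)
    have pos: "0 \<le> a" "0 \<le> b" "0 \<le> c"
      by (auto simp: d g_def intro!: sum_nonneg)
    have nz: "a \<noteq> 0" "b \<noteq> 0" "c \<noteq> 0"
      using e(4-6) by (auto simp: add_nonneg_eq_0_iff)
    \<comment> \<open>Multiplying \<open>q * r\<close> by \<open>a * b = 1 + p\<^sup>2\<close> and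
      rearranging with the off-diagonal equations gives \<open>p\<^sup>2 * (q * r)\<close>, hence
      \<open>q * r\<close> vanishes. The other two products are treated alike.\<close>
    have "q * r = 0"
    proof -
      have "(a * b) * (q * r) = (a * r) * (b * q)" by (simp only: mult_ac)
      also have "\<dots> = p\<^sup>2 * (q * r)" unfolding e(1) e(2) by (simp only: power2_eq_square mult_ac)
      finally show ?thesis unfolding e(4) by (simp add: algebra_simps)
    qed
    moreover have "p * q = 0"
    proof -
      have "(b * c) * (p * q) = (b * q) * (c * p)" by (simp only: mult_ac)
      also have "\<dots> = r\<^sup>2 * (p * q)" unfolding e(2) e(3) by (simp only: power2_eq_square mult_ac)
      finally show ?thesis unfolding e(6) by (simp add: algebra_simps)
    qed
    moreover have "p * r = 0"
    proof -
      have "(a * c) * (p * r) = (a * r) * (c * p)" by (simp only: mult_ac)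
      also have "\<dots> = q\<^sup>2 * (p * r)" unfolding e(1) e(3) by (simp only: power2_eq_square mult_ac)
      finally show ?thesis unfolding e(5) by (simp add: algebra_simps)
    qed
    ultimately have "p = 0" "q = 0" "r = 0"
      using e(1-3) nz by auto
    then have "a * b = 1" "a * c = 1" "b * c = 1" using e by auto
    then have "a * a = 1" by (metis mult.assoc mult.commute mult_1_right)
    then have "a = 1" using pos by (simp add: square_eq_1_iff)
    with \<open>p = 0\<close> show ?thesis by (simp add: d)
  qed
  have "\<exists>j. j \<noteq> i" for i :: 8
    by (rule exI[of _ "i + 1"]) simp
  then have gu': "g (u i) (u j) = (if i = j then 1 else 0)" for i j
    using gu by (metis (full_types))
  have gsum: "g (\<Sum>i\<in>S. c i *\<^sub>R u i) z = (\<Sum>i\<in>S. c i * g (u i) z)" if "finite S" for S c z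
    using that by (induction S) (auto simp: bil, simp add: g_def linear_0[OF lin(2)])
  have ge: "g x z = (\<Sum>i\<in>UNIV. f i x * g (u i) z)" for x z
    by (subst exp[of x], subst gsum) auto
  have "g x y = (\<Sum>i\<in>UNIV. f i x * g (u i) y)"
    by (rule ge)
  also have "\<dots> = (\<Sum>i\<in>UNIV. f i x * (\<Sum>j\<in>UNIV. f j y * g (u j) (u i)))"
    by (intro sum.cong refl arg_cong[of _ _ "\<lambda>t. _ * t"]) (rule trans[OF sym(1) ge])
  also have "\<dots> = h x y"
    by (simp add: gu' h_def if_distrib[of "\<lambda>t. _ * t"] cong: if_cong)
  finally show ?thesis by (simp add: g_def h_def)
qed

section \<open>The invariant structure on the isotropy module\<close>

lemma e_form_coframe: "coframe e_form"
proof -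
  have "c i = 0" if "\<forall>x. (\<Sum>i\<in>UNIV. c i * e_form i x) = 0" for c i
    using that[rule_format, of "axis i 1"]
    by (simp add: e_form_def axis_def if_distrib[of "\<lambda>t. _ * t"] cong: if_cong)
  then show ?thesis
    unfolding coframe_def by (auto simp: e_form_def intro!: linearI)
qed

text \<open>Appending 7 to the terms of \<open>alpha1\<close> and 8 to those of
  \<open>alpha2\<close> keeps the index lists increasing, so the 14 monomials match without sign
  changes.\<close>

lemma Phi_m_eq_spin7_form: "Phi_m = spin7_form e_form"
proof
  fix X
  let ?F = "\<lambda>n. e_form (of_nat n)"
  have one: "one_form (e_form i) = comb ?F [(1, [n])]" if "i = of_nat n" for i n
    using that by (simp add: fun_eq_iff one_form_def comb_def emono_def detform_singleton)
  have a1: "alpha1 = comb ?F [(1, [1,3,5]), (-1, [1,4,6]), (1, [2,4,5]), (1, [2,3,6])]"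
    by (simp add: fun_eq_iff alpha1_def comb_def emono_def wmono_eq_detform)
  have a2: "alpha2 = comb ?F [(1, [1,3,6]), (1, [1,4,5]), (1, [2,4,6]), (-1, [2,3,5])]"
    by (simp add: fun_eq_iff alpha2_def comb_def emono_def wmono_eq_detform)
  have b1: "beta1 = comb ?F (comb_mult [(1, [1,3,5]), (-1, [1,4,6]), (1, [2,4,5]), (1, [2,3,6])] [(1, [7])])"
    unfolding beta1_def a1 one[of 7 7, simplified] by (rule wedge_comb) (simp_all add: terms_def)
  have b2: "beta2 = comb ?F (comb_mult [(1, [1,3,6]), (1, [1,4,5]), (1, [2,4,6]), (-1, [2,3,5])] [(1, [8])])"
    unfolding beta2_def a2 one[of 8 8, simplified] by (rule wedge_comb) (simp_all add: terms_def)
  show "Phi_m X = spin7_form e_form X"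
    unfolding Phi_m_def b1 b2 spin7_form_def
    by (simp add: comb_def comb_mult_def emono_def wmono_eq_detform)
qed

lemma adapted_e_form: "adapted Phi_m e_form"
  by (simp add: adapted_def e_form_coframe Phi_m_eq_spin7_form)

lemma spin7_metric_Phi_m: "spin7_metric Phi_m = g_std"
  unfolding spin7_metric_def
proof (rule the_equality)
  show "\<forall>f. adapted Phi_m f \<longrightarrow> g_std = (\<lambda>x y. \<Sum>i\<in>UNIV. f i x * f i y)"
    using spin7_form_determines_metric[OF e_form_coframe]
    by (auto simp: adapted_def Phi_m_eq_spin7_form g_std_def fun_eq_iff)
  show "g = g_std" if "\<forall>f. adapted Phi_m f \<longrightarrow> g = (\<lambda>x y. \<Sum>i\<in>UNIV. f i x * f i y)" for g
    using that adapted_e_form by (auto simp: g_std_def fun_eq_iff)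
qed

lemma spin7_vol_Phi_m: "spin7_vol Phi_m = wmono e_form [1,2,3,4,5,6,7,8]"
  unfolding spin7_vol_def
proof (rule the_equality)
  show "\<forall>f. adapted Phi_m f \<longrightarrow> wmono e_form [1,2,3,4,5,6,7,8] = wmono f [1,2,3,4,5,6,7,8]"
    using spin7_form_determines_volume by (metis adapted_def Phi_m_eq_spin7_form)
  show "v = wmono e_form [1,2,3,4,5,6,7,8]"
    if "\<forall>f. adapted Phi_m f \<longrightarrow> v = wmono f [1,2,3,4,5,6,7,8]" for v
    using that adapted_e_form by blast
qed

lemma matrix_inv_eqI:
  fixes A :: "'a::comm_ring_1^'n^'n"
  assumes "A ** B = mat 1" "B ** A = mat 1"
  shows "matrix_inv A = B"
proof -
  have "A ** matrix_inv A = mat 1 \<and> matrix_inv A ** A = mat 1"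
    unfolding matrix_inv_def by (rule someI[of _ B]) (use assms in simp)
  then show ?thesis
    using assms by (metis matrix_mul_assoc matrix_mul_lid matrix_mul_rid)
qed

lemma dual_axis_g_std: "dual_axis g_std i = axis i 1"
proof -
  have "(\<chi> a b. g_std (axis a 1) (axis b 1)) = (mat 1 :: real^8^8)"
    by (simp add: vec_eq_iff g_std_def e_form_def axis_def mat_def if_distrib[of "\<lambda>t. _ * t"] cong: if_cong)
  moreover have "matrix_inv (mat 1 :: real^8^8) = mat 1"
    by (rule matrix_inv_eqI) simp_all
  ultimately have "dual_axis g_std i = (\<Sum>j\<in>UNIV. (mat 1 :: real^8^8) $ i $ j *\<^sub>R axis j 1)"
    unfolding dual_axis_def by simp
  also have "\<dots> = (\<Sum>j\<in>UNIV. if i = j then axis j 1 else 0)"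
    by (intro sum.cong) (auto simp: mat_def)
  finally show ?thesis by simp
qed

section \<open>Coordinates on three copies of su(2): projection, bracket, isotropy action\<close>

definition sig :: "real \<Rightarrow> real \<Rightarrow> real \<Rightarrow> mat2" where
  "sig p q r = p *\<^sub>R \<sigma>1 + q *\<^sub>R \<sigma>2 + r *\<^sub>R \<sigma>3"

lemma sig_entries:
  "sig p q r $ 1 $ 1 = Complex 0 (r / 2)" "sig p q r $ 1 $ 2 = Complex (q / 2) (p / 2)"
  "sig p q r $ 2 $ 1 = Complex (- q / 2) (p / 2)" "sig p q r $ 2 $ 2 = Complex 0 (- r / 2)"
  by (simp_all add: sig_def \<sigma>1_def \<sigma>2_def \<sigma>3_def vector_2 complex_eq_iff)

lemma sig_eq_iff: "sig p q r = sig p' q' r' \<longleftrightarrow> p = p' \<and> q = q' \<and> r = r'"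
  by (auto simp: vec_eq_iff forall_2 sig_entries)

lemma sig_diff: "sig p q r - sig p' q' r' = sig (p - p') (q - q') (r - r')"
  by (simp add: sig_def algebra_simps)

text \<open>With this basis the bracket is minus the cross product; for instance, the bracket of
  \<open>\<sigma>1\<close> and \<open>\<sigma>2\<close> is \<open>- \<sigma>3\<close>.\<close>

lemma sig_commutator:
  "sig p q r ** sig p' q' r' - sig p' q' r' ** sig p q r =
   sig (r * q' - q * r') (p * r' - r * p') (q * p' - p * q')"
  by (simp add: vec_eq_iff forall_2 sum_2 matrix_matrix_mult_def sig_entries complex_eq_iff field_simps)

text \<open>\<open>rot1\<close>, \<open>rot2\<close>, \<open>rot3\<close> are the
  \<open>\<sigma>3\<close>-coordinates of the three blocks, contributed by the directions 7 and
  8.\<close>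

definition rot1 :: "int \<Rightarrow> int \<Rightarrow> int \<Rightarrow> vec8 \<Rightarrow> real" where
  "rot1 k l m x = of_int (m * k) / c7 k l m * x $ 7 + of_int l / c8 k l * x $ 8"

definition rot2 :: "int \<Rightarrow> int \<Rightarrow> int \<Rightarrow> vec8 \<Rightarrow> real" where
  "rot2 k l m x = of_int (m * l) / c7 k l m * x $ 7 - of_int k / c8 k l * x $ 8"

definition rot3 :: "int \<Rightarrow> int \<Rightarrow> int \<Rightarrow> vec8 \<Rightarrow> real" where
  "rot3 k l m x = - of_int (k\<^sup>2 + l\<^sup>2) / c7 k l m * x $ 7"

lemma frame_sig:
  "frame k l m x = (sig (x $ 1) (x $ 2) (rot1 k l m x), sig (x $ 3) (x $ 4) (rot2 k l m x),
     sig (x $ 5) (x $ 6) (rot3 k l m x))"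
  by (simp add: frame_def sum_8 e_vec_def sig_def rot1_def rot2_def rot3_def prod_eq_iff algebra_simps add_divide_distrib diff_divide_distrib)

definition vec8_of :: "real \<Rightarrow> real \<Rightarrow> real \<Rightarrow> real \<Rightarrow> real \<Rightarrow> real \<Rightarrow> real \<Rightarrow> real \<Rightarrow> vec8" where
  "vec8_of a1 a2 a3 a4 a5 a6 a7 a8 = (\<chi> i. if i = 1 then a1 else if i = 2 then a2 else if i = 3 then a3
     else if i = 4 then a4 else if i = 5 then a5 else if i = 6 then a6 else if i = 7 then a7 else a8)"

lemma vec8_of_nth [simp]:
  "vec8_of a1 a2 a3 a4 a5 a6 a7 a8 $ 1 = a1" "vec8_of a1 a2 a3 a4 a5 a6 a7 a8 $ 2 = a2"
  "vec8_of a1 a2 a3 a4 a5 a6 a7 a8 $ 3 = a3" "vec8_of a1 a2 a3 a4 a5 a6 a7 a8 $ 4 = a4"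
  "vec8_of a1 a2 a3 a4 a5 a6 a7 a8 $ 5 = a5" "vec8_of a1 a2 a3 a4 a5 a6 a7 a8 $ 6 = a6"
  "vec8_of a1 a2 a3 a4 a5 a6 a7 a8 $ 7 = a7" "vec8_of a1 a2 a3 a4 a5 a6 a7 a8 $ 8 = a8"
  by (simp_all add: vec8_of_def)

lemma vec8_eq_iff:
  "(x :: vec8) = y \<longleftrightarrow> x $ 1 = y $ 1 \<and> x $ 2 = y $ 2 \<and> x $ 3 = y $ 3 \<and> x $ 4 = y $ 4 \<and>
     x $ 5 = y $ 5 \<and> x $ 6 = y $ 6 \<and> x $ 7 = y $ 7 \<and> x $ 8 = y $ 8"
proof -
  have "(\<forall>i::8. P i) \<longleftrightarrow> (\<forall>i\<in>{1, 2, 3, 4, 5, 6, 7, 8}. P i)" for P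
    unfolding UNIV_8(1)[symmetric] by simp
  then show ?thesis unfolding vec_eq_iff by simp
qed

text \<open>On the \<open>\<sigma>3\<close>-parts, the generator (k, l, m) of the isotropy algebra
  and the directions 7 and 8 are mutually orthogonal, the last two being unit vectors. The
  coordinates 7 and 8 are therefore inner products with these; \<open>l \<noteq> 0\<close> keeps the
  normalising constants nonzero.\<close>

lemma
  fixes k l m :: int and p1 q1 t1 p2 q2 t2 p3 q3 t3 :: real
  assumes "l \<noteq> 0"
  defines "x0 \<equiv> vec8_of p1 q1 p2 q2 p3 q3
      ((of_int (m * k) * t1 + of_int (m * l) * t2 - of_int (k\<^sup>2 + l\<^sup>2) * t3) / c7 k l m)
      ((of_int l * t1 - of_int k * t2) / c8 k l)"
  shows comp_m_sig: "comp_m k l m (sig p1 q1 t1, sig p2 q2 t2, sig p3 q3 t3) = x0"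
    and comp_m_sig_unique: "\<And>x. (sig p1 q1 t1, sig p2 q2 t2, sig p3 q3 t3) - frame k l m x \<in> hh k l m \<Longrightarrow> x = x0"
proof -
  define K L M where "K = real_of_int k" "L = real_of_int l" "M = real_of_int m"
  note KLM = this
  define C7 C8 where "C7 = c7 k l m" and "C8 = c8 k l"
  have pos: "K\<^sup>2 + L\<^sup>2 > 0" "K\<^sup>2 + L\<^sup>2 + M\<^sup>2 > 0"
    using assms by (auto simp: KLM add_nonneg_pos add_pos_nonneg)
  have C8: "C8 * C8 = K\<^sup>2 + L\<^sup>2" "C8 \<noteq> 0" and C7: "C7 * C7 = (K\<^sup>2 + L\<^sup>2) * (K\<^sup>2 + L\<^sup>2 + M\<^sup>2)" "C7 \<noteq> 0"
    using pos by (auto simp: C7_def C8_def c7_def c8_def KLM[symmetric] mult_ac)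
  have x0: "x0 = vec8_of p1 q1 p2 q2 p3 q3 ((M * K * t1 + M * L * t2 - (K\<^sup>2 + L\<^sup>2) * t3) / C7) ((L * t1 - K * t2) / C8)"
    by (simp add: x0_def KLM C7_def C8_def)
  have hh: "hh k l m = {(sig 0 0 (t * K), sig 0 0 (t * L), sig 0 0 (t * M)) | t. True}"
    by (simp add: hh_def sig_def KLM)
  have rot: "rot1 k l m x = M * K / C7 * x $ 7 + L / C8 * x $ 8" "rot2 k l m x = M * L / C7 * x $ 7 - K / C8 * x $ 8"
    "rot3 k l m x = - (K\<^sup>2 + L\<^sup>2) / C7 * x $ 7" for x
    by (simp_all add: rot1_def rot2_def rot3_def KLM C7_def C8_def)
  show uniq: "x = x0" if "(sig p1 q1 t1, sig p2 q2 t2, sig p3 q3 t3) - frame k l m x \<in> hh k l m" for x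
  proof -
    from that obtain t where x: "x $ 1 = p1" "x $ 2 = q1" "x $ 3 = p2" "x $ 4 = q2" "x $ 5 = p3" "x $ 6 = q3"
      and t: "t1 - rot1 k l m x = t * K" "t2 - rot2 k l m x = t * L" "t3 - rot3 k l m x = t * M"
      unfolding frame_sig hh by (auto simp: sig_diff sig_eq_iff)
    have t: "t1 = rot1 k l m x + t * K" "t2 = rot2 k l m x + t * L" "t3 = rot3 k l m x + t * M"
      using t by linarith+
    have "M * K * t1 + M * L * t2 - (K\<^sup>2 + L\<^sup>2) * t3 = (C7 * C7) * x $ 7 / C7"
      unfolding t rot C7(1) using C7(2) C8(2)
      by (simp add: divide_simps) (simp add: algebra_simps power2_eq_square)
    moreover have "L * t1 - K * t2 = (C8 * C8) * x $ 8 / C8"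
      unfolding t rot C8(1) using C7(2) C8(2)
      by (simp add: divide_simps) (simp add: algebra_simps power2_eq_square)
    ultimately show ?thesis
      using x C7(2) C8(2) by (simp add: vec8_eq_iff x0)
  qed
  define N2 N3 where "N2 = K\<^sup>2 + L\<^sup>2" and "N3 = K\<^sup>2 + L\<^sup>2 + M\<^sup>2"
  have "N2 > 0" "N3 > 0" using pos by (simp_all only: N2_def N3_def)
  then have nz: "N2 \<noteq> 0" "N3 \<noteq> 0" by simp_all
  \<comment> \<open>The component along the isotropy algebra: the inner product with (K, L, M)
    divided by its squared length.\<close>
  define t where "t = (K * t1 + L * t2 + M * t3) / (K\<^sup>2 + L\<^sup>2 + M\<^sup>2)"
  have "t1 - (M * K * (M * K * t1 + M * L * t2 - (K\<^sup>2 + L\<^sup>2) * t3) / (C7 * C7) + L * (L * t1 - K * t2) / (C8 * C8)) = t * K"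
    "t2 - (M * L * (M * K * t1 + M * L * t2 - (K\<^sup>2 + L\<^sup>2) * t3) / (C7 * C7) - K * (L * t1 - K * t2) / (C8 * C8)) = t * L"
    "t3 - (- (K\<^sup>2 + L\<^sup>2) * (M * K * t1 + M * L * t2 - (K\<^sup>2 + L\<^sup>2) * t3) / (C7 * C7)) = t * M"
    unfolding C7(1) C8(1) t_def N2_def[symmetric] N3_def[symmetric] using nz
    by (simp_all add: divide_simps) (simp_all add: N3_def N2_def algebra_simps power2_eq_square)
  then have "(sig p1 q1 t1, sig p2 q2 t2, sig p3 q3 t3) - frame k l m x0 \<in> hh k l m"
    unfolding frame_sig rot hh x0 by (auto simp: sig_diff sig_eq_iff)
  then show "comp_m k l m (sig p1 q1 t1, sig p2 q2 t2, sig p3 q3 t3) = x0"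
    unfolding comp_m_def using uniq by (rule the_equality)
qed

lemma bracket_m_eq:
  assumes "l \<noteq> 0"
  shows "bracket_m k l m x y = vec8_of
    (rot1 k l m x * y $ 2 - x $ 2 * rot1 k l m y) (x $ 1 * rot1 k l m y - rot1 k l m x * y $ 1)
    (rot2 k l m x * y $ 4 - x $ 4 * rot2 k l m y) (x $ 3 * rot2 k l m y - rot2 k l m x * y $ 3)
    (rot3 k l m x * y $ 6 - x $ 6 * rot3 k l m y) (x $ 5 * rot3 k l m y - rot3 k l m x * y $ 5)
    ((of_int (m * k) * (x $ 2 * y $ 1 - x $ 1 * y $ 2) + of_int (m * l) * (x $ 4 * y $ 3 - x $ 3 * y $ 4)
      - of_int (k\<^sup>2 + l\<^sup>2) * (x $ 6 * y $ 5 - x $ 5 * y $ 6)) / c7 k l m)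
    ((of_int l * (x $ 2 * y $ 1 - x $ 1 * y $ 2) - of_int k * (x $ 4 * y $ 3 - x $ 3 * y $ 4)) / c8 k l)"
  unfolding bracket_m_def bracket_def frame_sig bmul.simps
  by (simp add: sig_commutator comp_m_sig[OF assms])

lemma comp_m_frame:
  assumes "l \<noteq> 0"
  shows "comp_m k l m (frame k l m x) = x"
proof -
  have *: "(sig (x $ 1) (x $ 2) (rot1 k l m x), sig (x $ 3) (x $ 4) (rot2 k l m x),
     sig (x $ 5) (x $ 6) (rot3 k l m x)) - frame k l m x \<in> hh k l m"
    unfolding frame_sig hh_def by (auto simp: zero_prod_def intro!: exI[of _ 0])
  show ?thesis
    by (subst frame_sig) (simp only: comp_m_sig[OF assms] comp_m_sig_unique[OF assms *, symmetric])
qed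

lemma u1_entries:
  "u1 j z $ 1 $ 1 = z powi j" "u1 j z $ 1 $ 2 = 0" "u1 j z $ 2 $ 1 = 0" "u1 j z $ 2 $ 2 = z powi (- j)"
  by (simp_all add: u1_def vector_2)

lemma matrix_inv_u1:
  assumes "z \<noteq> 0"
  shows "matrix_inv (u1 j z) = u1 (- j) z"
  using assms
  by (intro matrix_inv_eqI)
     (simp_all add: vec_eq_iff forall_2 sum_2 matrix_matrix_mult_def u1_entries mat_def power_int_minus)

text \<open>\<open>Ad(u1 j z)\<close> multiplies \<open>q + ip\<close> by \<open>z\<^sup>2\<^sup>j\<close>.\<close>

lemma sig_conjugate:
  fixes j :: int
  assumes "cmod z = 1"
  defines "w \<equiv> z powi (2 * j)"
  shows "u1 j z ** sig p q r ** matrix_inv (u1 j z) = sig (Im (w * Complex q p)) (Re (w * Complex q p)) r"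
proof -
  have z: "z \<noteq> 0" using assms by auto
  define v where "v = z powi j"
  have "cmod v = 1" using assms by (simp add: v_def norm_power_int)
  then have vv: "v * cnj v = 1"
    using complex_norm_square[of v] by simp
  then have v: "inverse v = cnj v"
    by (rule inverse_unique)
  have v': "Re v * Re v + Im v * Im v = 1"
    using arg_cong[OF vv, of Re] by simp
  have r: "r * (Im v * Im v) + r * (Re v * Re v) = r"
    unfolding distrib_left[symmetric] add.commute[of "Im v * Im v"] v' by simp
  have w: "w = v * v"
    using z by (simp add: w_def v_def power_int_add[symmetric])
  have u: "u1 j z $ 1 $ 1 = v" "u1 j z $ 2 $ 2 = cnj v" "u1 (- j) z $ 1 $ 1 = cnj v" "u1 (- j) z $ 2 $ 2 = v"
    using v by (simp_all add: u1_entries v_def[symmetric] power_int_minus)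
  show ?thesis
    unfolding matrix_inv_u1[OF z]
    by (simp add: vec_eq_iff forall_2 sum_2 matrix_matrix_mult_def u u1_entries(2,3) sig_entries w complex_eq_iff)
       (simp add: field_simps, use r in simp)
qed

lemma isotropy_eq:
  assumes "l \<noteq> 0" "cmod z = 1"
  defines "w \<equiv> \<lambda>j. z powi (2 * j)"
  shows "isotropy k l m (u1 k z, u1 l z, u1 m z) x = vec8_of
    (Im (w k * Complex (x $ 2) (x $ 1))) (Re (w k * Complex (x $ 2) (x $ 1)))
    (Im (w l * Complex (x $ 4) (x $ 3))) (Re (w l * Complex (x $ 4) (x $ 3)))
    (Im (w m * Complex (x $ 6) (x $ 5))) (Re (w m * Complex (x $ 6) (x $ 5)))
    (x $ 7) (x $ 8)"
proof -
  \<comment> \<open>Conjugation leaves the \<open>\<sigma>3\<close>-parts alone, so the coordinates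
    7 and 8 of the result can be read off from those of \<open>x\<close>.\<close>
  have x: "comp_m k l m (sig (x $ 1) (x $ 2) (rot1 k l m x), sig (x $ 3) (x $ 4) (rot2 k l m x),
     sig (x $ 5) (x $ 6) (rot3 k l m x)) = x"
    using comp_m_frame[OF assms(1)] unfolding frame_sig .
  show ?thesis
    using x unfolding isotropy_def frame_sig bmul.simps binv.simps sig_conjugate[OF assms(2)] comp_m_sig[OF assms(1)]
    by (simp add: vec8_eq_iff w_def)
qed

section \<open>Invariance under the isotropy group\<close>

lemma detform_of_real:
  "detform (map (\<lambda>f x. complex_of_real (f x)) fs) X = complex_of_real (detform fs X)"
  by (simp add: detform_def)

lemma detform_comp: "detform fs (\<lambda>n. h (X n)) = detform (map (\<lambda>f x. f (h x)) fs) X"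
  by (simp add: detform_def)

lemma detform_quad_scale:
  "detform [\<lambda>x. a * f x, \<lambda>x. b * g x, \<lambda>x. c * h x, \<lambda>x. d * k x] X =
   a * b * c * d * detform [f, g, h, k] X"
  using detform_scale[of "[]" a f "[\<lambda>x. b * g x, \<lambda>x. c * h x, \<lambda>x. d * k x]" X]
    detform_scale[of "[f]" b g "[\<lambda>x. c * h x, \<lambda>x. d * k x]" X]
    detform_scale[of "[f, g]" c h "[\<lambda>x. d * k x]" X]
    detform_scale[of "[f, g, h]" d k "[]" X]
  by simp

lemma i_squared [simp]: "\<i> * (\<i> * x) = - x"
  by (simp flip: mult.assoc)

lemma detform_quad_conj:
  "detform [\<lambda>x. a x + \<i> * b x, \<lambda>x. a x - \<i> * b x, c, d] X = - 2 * \<i> * detform [a, b, c, d] X"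
  "detform [c, d, \<lambda>x. a x + \<i> * b x, \<lambda>x. a x - \<i> * b x] X = - 2 * \<i> * detform [c, d, a, b] X"
  unfolding detform_quad by (simp_all add: algebra_simps)

text \<open>For real entries \<open>Z'\<close> is the conjugate of \<open>Z\<close>, so these
  formulas give the real and imaginary parts of \<open>Z\<close>.\<close>

lemma detform_quad_complex:
  fixes a b a' b' a'' b'' c :: "'v \<Rightarrow> complex" and X
  defines "Z \<equiv> detform [\<lambda>x. a x - \<i> * b x, \<lambda>x. a' x + \<i> * b' x, \<lambda>x. a'' x + \<i> * b'' x, c] X"
    and "Z' \<equiv> detform [\<lambda>x. a x + \<i> * b x, \<lambda>x. a' x - \<i> * b' x, \<lambda>x. a'' x - \<i> * b'' x, c] X"
  shows "Z + Z' = 2 * (detform [a, a', a'', c] X - detform [a, b', b'', c] X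
      + detform [b, a', b'', c] X + detform [b, b', a'', c] X)"
    and "Z - Z' = 2 * \<i> * (detform [a, a', b'', c] X + detform [a, b', a'', c] X
      - detform [b, a', a'', c] X + detform [b, b', b'', c] X)"
proof -
  have add: "detform (us @ (\<lambda>x. f x + g x) # vs) X = detform (us @ f # vs) X + detform (us @ g # vs) X"
    for us f g vs by (rule detform_add)
  have sub: "detform (us @ (\<lambda>x. f x - \<i> * g x) # vs) X = detform (us @ f # vs) X - \<i> * detform (us @ g # vs) X"
    for us f g vs
    using detform_add[of us f "\<lambda>x. (- \<i>) * g x" vs X] detform_scale[of us "- \<i>" g vs X] by simp
  have addi: "detform (us @ (\<lambda>x. f x + \<i> * g x) # vs) X = detform (us @ f # vs) X + \<i> * detform (us @ g # vs) X"
    for us f g vs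
    using detform_add[of us f "\<lambda>x. \<i> * g x" vs X] detform_scale[of us "\<i>" g vs X] by simp
  note exp = sub[of "[]", simplified] addi[of "[]", simplified] sub[of "[u]" for u, simplified]
    addi[of "[u]" for u, simplified] sub[of "[u, v]" for u v, simplified] addi[of "[u, v]" for u v, simplified]
  show "Z + Z' = 2 * (detform [a, a', a'', c] X - detform [a, b', b'', c] X
      + detform [b, a', b'', c] X + detform [b, b', a'', c] X)"
    and "Z - Z' = 2 * \<i> * (detform [a, a', b'', c] X + detform [a, b', a'', c] X
      - detform [b, a', a'', c] X + detform [b, b', b'', c] X)"
    unfolding Z_def Z'_def by (simp_all add: exp algebra_simps)
qed

definition cx :: "8 \<Rightarrow> vec8 \<Rightarrow> complex" where
  "cx i x = complex_of_real (x $ i)"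

text \<open>In the complex coframe \<open>e\<^sup>2 \<plusminus> ie\<^sup>1, e\<^sup>4 \<plusminus> ie\<^sup>3, e\<^sup>6 \<plusminus> ie\<^sup>5\<close> the isotropy group acts diagonally.\<close>

definition hol :: "8 \<Rightarrow> 8 \<Rightarrow> vec8 \<Rightarrow> complex" where
  "hol i j x = cx j x + \<i> * cx i x"

definition antihol :: "8 \<Rightarrow> 8 \<Rightarrow> vec8 \<Rightarrow> complex" where
  "antihol i j x = cx j x - \<i> * cx i x"

text \<open>Each term is an eigenform of the isotropy action: a \<open>hol\<close>,
  \<open>antihol\<close> pair has weight 0, and the cubic factors have weights \<plusminus>2(l + m -
  k).\<close>

lemma Phi_m_complex:
  "complex_of_real (Phi_m X) =
     - (1/4) * detform [hol 1 2, antihol 1 2, hol 3 4, antihol 3 4] X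
     - (1/4) * detform [hol 1 2, antihol 1 2, hol 5 6, antihol 5 6] X
     + (1/4) * detform [hol 3 4, antihol 3 4, hol 5 6, antihol 5 6] X
     + (\<i>/2) * detform [hol 1 2, antihol 1 2, cx 7, cx 8] X
     - (\<i>/2) * detform [hol 3 4, antihol 3 4, cx 7, cx 8] X
     - (\<i>/2) * detform [hol 5 6, antihol 5 6, cx 7, cx 8] X
     - (\<i>/2) * (detform [antihol 1 2, hol 3 4, hol 5 6, cx 7] X - detform [hol 1 2, antihol 3 4, antihol 5 6, cx 7] X)
     + (1/2) * (detform [antihol 1 2, hol 3 4, hol 5 6, cx 8] X + detform [hol 1 2, antihol 3 4, antihol 5 6, cx 8] X)"
proof -
  have cx: "detform [cx a, cx b, cx c, cx d] X = complex_of_real (wmono e_form [a, b, c, d] X)" for a b c d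
    using detform_of_real[of "map e_form [a, b, c, d]" X]
    by (simp add: wmono_eq_detform cx_def[abs_def] e_form_def[abs_def])
  \<comment> \<open>\<open>hol i j\<close> has coordinate \<open>j\<close> as its real part, so each
    pair of indices appears in reversed order after expansion.\<close>
  have swap: "wmono e_form [b, a, c, d] X = - wmono e_form [a, b, c, d] X"
    "wmono e_form [c, d, b, a] X = - wmono e_form [c, d, a, b] X" for a b c d
    using detform_swap[of "[]" "e_form b" "e_form a" "[e_form c, e_form d]" X]
      detform_swap[of "[e_form c, e_form d]" "e_form b" "e_form a" "[]" X]
    by (simp_all add: wmono_eq_detform)
  show ?thesis
    unfolding hol_def[abs_def] antihol_def[abs_def] detform_quad_conj detform_quad_complex
    by (simp add: Phi_m_eq_spin7_form spin7_form_def swap[where a = 1 and b = 2] swap[where a = 3 and b = 4] swap[where a = 5 and b = 6] cx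
      add_divide_distrib diff_divide_distrib del: wmono.simps)
qed

lemma Phi_m_isotropy:
  assumes "l \<noteq> 0" "k = l + m" "cmod z = 1"
  shows "Phi_m (\<lambda>n. isotropy k l m (u1 k z, u1 l z, u1 m z) (X n)) = Phi_m X"
proof -
  define h where "h = isotropy k l m (u1 k z, u1 l z, u1 m z)"
  define w where "w j = z powi (2 * j)" for j
  have w: "cmod (w j) = 1" for j
    using assms(3) by (simp add: w_def norm_power_int)
  have cw: "w j * cnj (w j) = 1" for j
    using complex_norm_square[of "w j"] w by simp
  have "z \<noteq> 0" using assms(3) by auto
  \<comment> \<open>Here \<open>k = l + m\<close> enters: it makes the total weight of the cubic
    forms zero.\<close>
  then have "w k = w l * w m"
    by (simp add: assms(2) w_def power_int_add distrib_left)
  then have wk: "cnj (w k) * w l * w m = 1" "w k * cnj (w l) * cnj (w m) = 1"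
    using cw[of k] by (simp_all add: mult_ac)
  have hx: "h x = vec8_of
    (Im (w k * hol 1 2 x)) (Re (w k * hol 1 2 x)) (Im (w l * hol 3 4 x)) (Re (w l * hol 3 4 x))
    (Im (w m * hol 5 6 x)) (Re (w m * hol 5 6 x)) (x $ 7) (x $ 8)" for x
    unfolding h_def isotropy_eq[OF assms(1,3)] w_def by (simp add: hol_def cx_def complex_eq_iff Complex_eq)
  have ah: "antihol i j x = cnj (hol i j x)" for i j x
    by (simp add: hol_def antihol_def cx_def)
  have hol: "hol 1 2 (h x) = w k * hol 1 2 x" "hol 3 4 (h x) = w l * hol 3 4 x" "hol 5 6 (h x) = w m * hol 5 6 x" for x
    unfolding hx by (simp_all add: hol_def[of _ _ "vec8_of _ _ _ _ _ _ _ _"] cx_def[of _ "vec8_of _ _ _ _ _ _ _ _"] complex_eq_iff)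
  then have antihol: "antihol 1 2 (h x) = cnj (w k) * antihol 1 2 x" "antihol 3 4 (h x) = cnj (w l) * antihol 3 4 x"
    "antihol 5 6 (h x) = cnj (w m) * antihol 5 6 x" for x
    by (simp_all add: ah)
  \<comment> \<open>The factors 1 give all four rows the form required by
    \<open>detform_quad_scale\<close>.\<close>
  have c78: "cx 7 (h x) = 1 * cx 7 x" "cx 8 (h x) = 1 * cx 8 x" for x
    by (simp_all add: hx cx_def)
  have "complex_of_real (Phi_m (\<lambda>n. h (X n))) = complex_of_real (Phi_m X)"
    unfolding Phi_m_complex detform_comp list.map hol antihol c78 detform_quad_scale
    using cw wk by (simp add: mult.assoc)
  then show ?thesis by (simp add: h_def)
qed

text \<open>The constants are closed under derivation along left-invariant fields, so they form a
  coinduction invariant.\<close>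

lemma smooth_const: "smooth (\<lambda>a. c)"
proof (coinduction arbitrary: c)
  case smooth
  have "\<exists>f'. (\<exists>c. f' = (\<lambda>a. c)) \<and>
      (\<forall>a\<in>GG. ((\<lambda>t. c) has_real_derivative f' a) (at 0))"
    by (intro exI[of _ "\<lambda>a. 0"]) auto
  then show ?case by auto
qed

lemma one_in_GG: "(mat 1, mat 1, mat 1) \<in> GG"
  by (simp add: GG_def SU2_def dagger_def vec_eq_iff mat_def forall_2 sum_2 matrix_matrix_mult_def det_2)

lemma spin7_structure_Phi_inv:
  assumes "l \<noteq> 0" "k = l + m"
  shows "spin7_structure k l m Phi_inv"
  unfolding spin7_structure_def smooth_equivariant_def admissible_def Phi_inv_def
  using adapted_e_form Phi_m_isotropy[OF assms] smooth_const by (auto simp: HH_def)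

section \<open>The exterior derivative\<close>

abbreviation E :: "nat \<Rightarrow> vec8 \<Rightarrow> real" where
  "E \<equiv> \<lambda>n. e_form (of_nat n)"

lemma omit_omit: "i \<le> j \<Longrightarrow> omit j (omit i X) = omit i (omit (Suc j) X)"
  by (auto simp: omit_def fun_eq_iff)

text \<open>Laplace expansion along the first two rows, with the signs arranged as in the bracket
  part of \<open>ext_d\<close>.\<close>

lemma detform_two_rows:
  fixes gs :: "('v \<Rightarrow> 'b::comm_ring_1) list"
  assumes "length gs = 3"
  shows "detform (u # w # gs) X = - (\<Sum>j\<le>4. \<Sum>i<j. (-1) ^ (i + j) *
     ((u (X i) * w (X j) - w (X i) * u (X j)) * detform gs (omit i (omit j X))))"
proof -
  have "detform (u # w # gs) X =
    (\<Sum>n\<le>4. (-1) ^ n * u (X n) * (\<Sum>m\<le>3. (-1) ^ m * w (omit n X m) * detform gs (omit m (omit n X))))"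
    unfolding detform_Cons[of u] detform_Cons[of w] using assms by (simp add: sum_distrib_left)
  also have "\<dots> = - (\<Sum>j\<le>4. \<Sum>i<j. (-1) ^ (i + j) *
     ((u (X i) * w (X j) - w (X i) * u (X j)) * detform gs (omit i (omit j X))))"
  proof -
    define G where "G i j = detform gs (omit i (omit j X))" for i j
    \<comment> \<open>Columns deleted in succession are renumbered, so that each pair of columns is
      named by its ordered original positions.\<close>
    have 1: "detform gs (omit m (omit n X)) = (if m < n then G m n else G n (Suc m))" for m n
      by (simp add: G_def omit_omit)
    have 2: "w (omit n X m) = (if m < n then w (X m) else w (X (Suc m)))" for m n
      by (simp add: omit_def)
    have 3: "(\<Sum>n\<le>4. f n) = f 0 + f 1 + f 2 + f 3 + f 4" "(\<Sum>n\<le>3. f n) = f 0 + f 1 + f 2 + f 3"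
      "(\<Sum>n<4. f n) = f 0 + f 1 + f 2 + f 3" "(\<Sum>n<3. f n) = f 0 + f 1 + f 2" "(\<Sum>n<2. f n) = f 0 + f 1"
      for f :: "nat \<Rightarrow> 'b"
      by (simp_all add: atMost_Suc lessThan_Suc numeral_eq_Suc add_ac)
    show ?thesis
      unfolding 1 2 G_def[symmetric] 3 by (simp add: 3 algebra_simps) (simp add: numeral_2_eq_2 mult_ac)
  qed
  finally show ?thesis .
qed

lemma detform_first_column:
  "detform [f, g, h, k] (case_nat v Z) = f v * detform [g, h, k] Z - g v * detform [f, h, k] Z
     + h v * detform [f, g, k] Z - k v * detform [f, g, h] Z"
  by (simp add: detform_quad detform_triple detform_pair numeral_eq_Suc algebra_simps)

lemma comb_two_rows:
  assumes "length gs = 3" "\<forall>(c, us)\<in>set L. length us = 2"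
  shows "(\<Sum>j\<le>4. \<Sum>i<j. (-1) ^ (i + j) *
     ((\<Sum>(c, us)\<leftarrow>L. c * (F (us ! 0) (X i) * F (us ! 1) (X j) - F (us ! 1) (X i) * F (us ! 0) (X j))) *
       emono F gs (omit i (omit j X)))) = - comb F (map (\<lambda>(c, us). (c, us @ gs)) L) X"
  using assms(2)
proof (induction L)
  case (Cons a L)
  obtain c u w where a: "a = (c, [u, w])"
    using Cons.prems by (cases a) (auto simp: length_Suc_conv numeral_2_eq_2)
  have "emono F ([u, w] @ gs) X = - (\<Sum>j\<le>4. \<Sum>i<j. (-1) ^ (i + j) *
     ((F u (X i) * F w (X j) - F w (X i) * F u (X j)) * emono F gs (omit i (omit j X))))"
    using detform_two_rows[of "map F gs" "F u" "F w" X] assms(1) by (simp add: emono_def)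
  moreover have "(\<Sum>j\<le>4. \<Sum>i<j. (-1) ^ (i + j) *
     ((\<Sum>(c, us)\<leftarrow>a # L. c * (F (us ! 0) (X i) * F (us ! 1) (X j) - F (us ! 1) (X i) * F (us ! 0) (X j))) *
       emono F gs (omit i (omit j X)))) =
     c * (\<Sum>j\<le>4. \<Sum>i<j. (-1) ^ (i + j) *
       ((F u (X i) * F w (X j) - F w (X i) * F u (X j)) * emono F gs (omit i (omit j X))))
     + (\<Sum>j\<le>4. \<Sum>i<j. (-1) ^ (i + j) *
       ((\<Sum>(c, us)\<leftarrow>L. c * (F (us ! 0) (X i) * F (us ! 1) (X j) - F (us ! 1) (X i) * F (us ! 0) (X j))) *
         emono F gs (omit i (omit j X))))"
    unfolding sum_distrib_left sum.distrib[symmetric]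
    by (intro sum.cong refl) (simp add: a algebra_simps)
  ultimately show ?case
    using Cons by (simp add: a comb_def)
qed (simp add: comb_def)

text \<open>The 2-form \<open>de\<^sup>n(x,y) = -e\<^sup>n([x,y]\<^sub>\<mm>)\<close>, in terms of the coefficients of \<open>de\<^sup>7\<close> and \<open>de\<^sup>8\<close>.\<close>

definition mc_terms :: "real \<Rightarrow> real \<Rightarrow> real \<Rightarrow> real \<Rightarrow> real \<Rightarrow> nat \<Rightarrow> (real \<times> nat list) list" where
  "mc_terms a b c d e n =
     (if n = 1 then [(a, [2,7]), (d, [2,8])] else if n = 2 then [(- a, [1,7]), (- d, [1,8])]
      else if n = 3 then [(b, [4,7]), (e, [4,8])] else if n = 4 then [(- b, [3,7]), (- e, [3,8])]
      else if n = 5 then [(c, [6,7])] else if n = 6 then [(- c, [5,7])]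
      else if n = 7 then [(a, [1,2]), (b, [3,4]), (c, [5,6])] else [(d, [1,2]), (e, [3,4])])"

lemma mc_terms_bracket:
  assumes "l \<noteq> 0" "1 \<le> n" "n \<le> 8"
  shows "E n (bracket_m k l m x y) = - (\<Sum>(c, us)\<leftarrow>mc_terms (of_int (m * k) / c7 k l m)
       (of_int (m * l) / c7 k l m) (- of_int (k\<^sup>2 + l\<^sup>2) / c7 k l m)
       (of_int l / c8 k l) (- of_int k / c8 k l) n.
     c * (E (us ! 0) x * E (us ! 1) y - E (us ! 1) x * E (us ! 0) y))"
proof -
  have "n \<in> {1,2,3,4,5,6,7,8}" using assms(2,3) by auto
  then show ?thesis
    unfolding bracket_m_eq[OF assms(1)]
    by (elim insertE emptyE)
       (simp_all add: mc_terms_def e_form_def rot1_def rot2_def rot3_def algebra_simps add_divide_distrib diff_divide_distrib)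
qed

text \<open>The Leibniz rule: each index in turn is replaced by the terms of its differential
  \<open>T\<close>, which move to the front. Being of degree two they cause no sign, so only the
  position of the index alternates it.\<close>

definition d_terms :: "(nat \<Rightarrow> (real \<times> nat list) list) \<Rightarrow> real \<times> nat list \<Rightarrow> (real \<times> nat list) list" where
  "d_terms T x = (case x of (c, J) \<Rightarrow>
     map (\<lambda>(t, us). (c * t, us @ [J ! 1, J ! 2, J ! 3])) (T (J ! 0)) @
     map (\<lambda>(t, us). (- c * t, us @ [J ! 0, J ! 2, J ! 3])) (T (J ! 1)) @
     map (\<lambda>(t, us). (c * t, us @ [J ! 0, J ! 1, J ! 3])) (T (J ! 2)) @
     map (\<lambda>(t, us). (- c * t, us @ [J ! 0, J ! 1, J ! 2])) (T (J ! 3)))"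

lemma comb_append: "comb F (L @ K) X = comb F L X + comb F K X"
  by (simp add: comb_def)

lemma comb_map_scale: "comb F (map (\<lambda>(t, us). (c * t, us @ gs)) L) X = c * comb F (map (\<lambda>(t, us). (t, us @ gs)) L) X"
  by (induction L) (auto simp: comb_def algebra_simps)

text \<open>Expansion along the bracket column produces the coordinates of the bracket, which are
  minus the values of the differentials. \<open>comb_two_rows\<close> recombines them with the other
  columns, and its minus sign cancels this one.\<close>

lemma ext_d_emono:
  fixes k l m :: int
  assumes "l \<noteq> 0" "terms 4 [x]"
  defines "T \<equiv> mc_terms (of_int (m * k) / c7 k l m)
       (of_int (m * l) / c7 k l m) (- of_int (k\<^sup>2 + l\<^sup>2) / c7 k l m)
       (of_int l / c8 k l) (- of_int k / c8 k l)"
  shows "(\<Sum>j\<le>4. \<Sum>i<j. (-1) ^ (i + j) *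
     (fst x * emono E (snd x) (case_nat (bracket_m k l m (X i) (X j)) (omit i (omit j X))))) =
    comb E (d_terms T x) X"
proof -
  obtain c p q r s where x: "x = (c, [p, q, r, s])" and pqrs: "{p, q, r, s} \<subseteq> {1..8}"
    using assms(2) by (cases x) (auto simp: terms_def length_Suc_conv numeral_eq_Suc)
  let ?\<epsilon> = "\<lambda>i j. (-1 :: real) ^ (i + j)"
  let ?v = "\<lambda>i j. bracket_m k l m (X i) (X j)" and ?Z = "\<lambda>i j. omit i (omit j X)"
  have T: "\<forall>(c, us)\<in>set (T n). length us = 2" for n
    by (simp add: T_def mc_terms_def)
  have bm: "E n (bracket_m k l m x y) =
      - (\<Sum>(c, us)\<leftarrow>T n. c * (E (us ! 0) x * E (us ! 1) y - E (us ! 1) x * E (us ! 0) y))"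
    if "n \<in> {1..8}" for n x y
    unfolding T_def by (rule mc_terms_bracket) (use assms(1) that in auto)
  have D: "(\<Sum>j\<le>4. \<Sum>i<j. ?\<epsilon> i j * (E n (?v i j) * emono E gs (?Z i j))) = comb E (map (\<lambda>(t, us). (t, us @ gs)) (T n)) X"
    if "n \<in> {1..8}" "length gs = 3" for n gs
    by (simp only: bm[OF that(1)] mult_minus_left mult_minus_right sum_negf comb_two_rows[OF that(2) T, where F = E and X = X] minus_minus)
  have "(\<Sum>j\<le>4. \<Sum>i<j. ?\<epsilon> i j * (c * emono E [p, q, r, s] (case_nat (?v i j) (?Z i j)))) =
     c * (\<Sum>j\<le>4. \<Sum>i<j. ?\<epsilon> i j * (E p (?v i j) * emono E [q, r, s] (?Z i j)))
   - c * (\<Sum>j\<le>4. \<Sum>i<j. ?\<epsilon> i j * (E q (?v i j) * emono E [p, r, s] (?Z i j)))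
   + c * (\<Sum>j\<le>4. \<Sum>i<j. ?\<epsilon> i j * (E r (?v i j) * emono E [p, q, s] (?Z i j)))
   - c * (\<Sum>j\<le>4. \<Sum>i<j. ?\<epsilon> i j * (E s (?v i j) * emono E [p, q, r] (?Z i j)))"
    unfolding sum_distrib_left sum_subtractf[symmetric] sum.distrib[symmetric]
    by (intro sum.cong refl) (simp add: emono_def detform_first_column algebra_simps)
  also have "\<dots> = comb E (d_terms T x) X"
    using pqrs by (simp add: D d_terms_def x comb_append comb_map_scale comb_map_scale[of E "- c", simplified])
  finally show ?thesis by (simp add: x)
qed

section \<open>Components of forms on basis vectors\<close>

lemma of_nat_8_eq_iff:
  assumes "a \<in> {1..8}" "b \<in> {1..8}"
  shows "(of_nat a :: 8) = of_nat b \<longleftrightarrow> a = b"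
proof -
  have *: "{1..8} = {1,2,3,4,5,6,7,8::nat}" by auto
  show ?thesis
    using assms unfolding * by (elim insertE emptyE) simp_all
qed

lemma e_form_axis: "e_form i (axis j 1) = (if i = j then 1 else 0)"
  by (simp add: e_form_def axis_def)

lemma detform_zero_row:
  assumes "f \<in> set fs" "\<And>n. n < length fs \<Longrightarrow> f (X n) = 0"
  shows "detform fs X = 0"
proof -
  obtain a where a: "a < length fs" "fs ! a = f"
    using assms(1) by (auto simp: in_set_conv_nth)
  have "(\<Prod>a<length fs. (fs ! a) (X (\<pi> a))) = 0" if "\<pi> permutes {..<length fs}" for \<pi>
    using a assms(2) permutes_in_image[OF that, of a] by (intro prod_zero) auto
  then show ?thesis by (simp add: detform_def)
qed

lemma detform_zero_column:
  assumes "fs \<noteq> []" "\<And>f. f \<in> set fs \<Longrightarrow> f (X 0) = 0"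
  shows "detform fs X = 0"
proof -
  have "(\<Prod>a<length fs. (fs ! a) (X (\<pi> a))) = 0" if \<pi>: "\<pi> permutes {..<length fs}" for \<pi>
  proof -
    have "0 \<in> \<pi> ` {..<length fs}"
      using assms(1) by (simp add: permutes_image[OF \<pi>])
    then obtain a where "a < length fs" "\<pi> a = 0" by force
    then show ?thesis using assms(2) by (intro prod_zero) (auto intro!: bexI[of _ a])
  qed
  then show ?thesis by (simp add: detform_def)
qed

lemma detform_permute_args:
  assumes "\<rho> permutes {..<length fs}"
  shows "detform fs (\<lambda>n. X (\<rho> n)) = of_int (sign \<rho>) * detform fs X"
proof -
  have "permutation p" if "p permutes {..<length fs}" for p
    using that by (auto simp: permutation_permutes)
  then have "detform fs X = (\<Sum>\<pi> | \<pi> permutes {..<length fs}. of_int (sign \<rho>) *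
      (of_int (sign \<pi>) * (\<Prod>a<length fs. (fs ! a) (X (\<rho> (\<pi> a))))))"
    unfolding detform_def
    by (subst setum_permutations_compose_left[OF assms])
       (use assms in \<open>auto simp: sign_compose mult.assoc intro!: sum.cong\<close>)
  also have "\<dots> = of_int (sign \<rho>) * detform fs (\<lambda>n. X (\<rho> n))"
    by (simp add: detform_def sum_distrib_left)
  finally have "of_int (sign \<rho>) * detform fs X = of_int (sign \<rho> * sign \<rho>) * detform fs (\<lambda>n. X (\<rho> n))"
    by (simp add: mult.assoc del: sign_idempotent)
  then show ?thesis by simp
qed

text \<open>If the index lists agree, the evaluation matrix is the identity. Otherwise
  \<open>t\<close>, being of the same length, has an index missing from the other list, and its row
  vanishes.\<close>

lemma emono_axis:
  assumes js: "sorted_wrt (<) (map j [0..<p])" "set (map j [0..<p]) \<subseteq> {1..8}"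
    and t: "sorted_wrt (<) t" "set t \<subseteq> {1..8}" "length t = p"
  shows "emono E t (\<lambda>n. axis (of_nat (j n)) 1) = (if t = map j [0..<p] then 1 else 0)"
proof (cases "t = map j [0..<p]")
  case True
  have "distinct (map j [0..<p])"
    using js(1) by (simp add: strict_sorted_iff)
  then have "(j a = j b) = (a = b)" if "a < p" "b < p" for a b
    using that by (auto simp: distinct_map inj_on_def)
  moreover have "j a \<in> {1..8}" if "a < p" for a
    using js(2) that by (auto simp: image_subset_iff)
  ultimately have "Matrix.mat p p (\<lambda>(a, b). (map E t ! a) (axis (of_nat (j b)) 1)) = 1\<^sub>m p"
    using True by (intro eq_matI) (auto simp: e_form_axis of_nat_8_eq_iff)
  then show ?thesis
    using True by (simp add: emono_def detform_eq_det)
next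
  case False
  have "\<not> set t \<subseteq> set (map j [0..<p])"
  proof
    assume "set t \<subseteq> set (map j [0..<p])"
    moreover have "card (set t) = p" "card (set (map j [0..<p])) = p"
      using js(1) t(1,3) by (simp_all add: strict_sorted_iff distinct_card del: set_map)
    ultimately have "set t = set (map j [0..<p])"
      by (intro card_subset_eq) auto
    then have "t = map j [0..<p]"
      using js(1) t(1) by (intro strict_sorted_equal)
    with False show False by simp
  qed
  then obtain a where a: "a \<in> set t" "a \<notin> j ` {..<p}"
    by (auto simp: lessThan_atLeast0)
  have "E a (axis (of_nat (j n)) 1) = 0" if "n < p" for n
    using a that t(2) js(2) of_nat_8_eq_iff[of a "j n"] by (auto simp: e_form_axis image_subset_iff)
  then have "emono E t (\<lambda>n. axis (of_nat (j n)) 1) = 0"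
    unfolding emono_def using a(1) t(3) by (intro detform_zero_row[of "E a"]) auto
  with False show ?thesis by simp
qed

definition comb_coeff :: "(real \<times> nat list) list \<Rightarrow> nat list \<Rightarrow> real" where
  "comb_coeff L js = (\<Sum>(c, is)\<leftarrow>L. c * (case sort_sign is of (s, t) \<Rightarrow> if t = js then of_int s else 0))"

lemma comb_axis:
  assumes "terms p L" "sorted_wrt (<) (map j [0..<p])" "set (map j [0..<p]) \<subseteq> {1..8}"
  shows "comb E L (\<lambda>n. axis (of_nat (j n)) 1) = comb_coeff L (map j [0..<p])"
proof -
  have "emono E is (\<lambda>n. axis (of_nat (j n)) 1) =
      (case sort_sign is of (s, t) \<Rightarrow> if t = map j [0..<p] then of_int s else 0)"
    if "length is = p" "set is \<subseteq> {1..8}" for "is"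
  proof (cases "fst (sort_sign is) = 0")
    case True
    then show ?thesis
      using emono_sort_sign[of E "[]" "is"] by (auto simp: case_prod_unfold)
  next
    case False
    show ?thesis
      using emono_sort_sign[of E "[]" "is"] emono_axis[OF assms(2,3), of "snd (sort_sign is)"]
        sort_sign_sorted[OF False] sort_sign_length[of "is"] that
      by (auto simp: case_prod_unfold)
  qed
  then show ?thesis
    unfolding comb_def comb_coeff_def using assms(1)
    by (intro arg_cong[of _ _ sum_list] map_cong) (auto simp: terms_def)
qed

definition sort_terms :: "(real \<times> nat list) list \<Rightarrow> (real \<times> nat list) list" where
  "sort_terms L = map (\<lambda>(c, is). case sort_sign is of (s, t) \<Rightarrow> (c * of_int s, t)) L"

lemma comb_sort_terms: "comb F L X = comb F (sort_terms L) X"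
proof -
  have *: "fst x * of_int (fst (sort_sign (snd x))) * emono F (snd (sort_sign (snd x))) X = fst x * emono F (snd x) X" for x
    using emono_sort_sign[of F "[]" "snd x" X] by simp
  show ?thesis
    by (simp only: comb_def sort_terms_def case_prod_unfold map_map comp_def fst_conv snd_conv *)
qed

text \<open>The 14 remaining components of d\<Phi>, sorted and collected; a, b, c and d, e are the
  coefficients in the differentials of coframe elements 7 and 8.\<close>

definition dPhi_terms :: "real \<Rightarrow> real \<Rightarrow> real \<Rightarrow> real \<Rightarrow> real \<Rightarrow> (real \<times> nat list) list" where
  "dPhi_terms a b c d e =
     [(e - d, [1,2,3,4,7]), (a - b, [1,2,3,4,8]), (- d, [1,2,5,6,7]), (a - c, [1,2,5,6,8]),
      (- e, [3,4,5,6,7]), (b + c, [3,4,5,6,8]),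
      (a - b - c, [1,3,5,7,8]), (d - e, [1,3,6,7,8]), (d - e, [1,4,5,7,8]), (b + c - a, [1,4,6,7,8]),
      (e - d, [2,3,5,7,8]), (a - b - c, [2,3,6,7,8]), (a - b - c, [2,4,5,7,8]), (d - e, [2,4,6,7,8])]"

lemma dPhi_terms:
  "comb F (concat (map (d_terms (mc_terms a b c d e)) (of_int_terms spin7_terms))) X =
   comb F (dPhi_terms a b c d e) X"
  unfolding comb_sort_terms[of F "concat _"]
  by (simp add: spin7_terms_def d_terms_def mc_terms_def sort_terms_def dPhi_terms_def comb_def)
     (simp only: distrib_right left_diff_distrib mult_minus_left)

lemma terms_single: "terms p L \<Longrightarrow> x \<in> set L \<Longrightarrow> terms p [x]"
  by (auto simp: terms_def)

lemma sum_sum_list: "(\<Sum>j\<in>A. \<Sum>x\<leftarrow>L. g j x) = (\<Sum>x\<leftarrow>L. \<Sum>j\<in>A. (g j x :: 'a::comm_monoid_add))"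
  by (induction L) (simp_all add: sum.distrib)

lemma comb_concat: "comb F (concat (map h L)) X = (\<Sum>x\<leftarrow>L. comb F (h x) X)"
  by (induction L) (simp_all add: comb_append, simp add: comb_def)

text \<open>\<open>Phi_inv\<close> is constant on the group, so the derivative part of the formula
  vanishes; the bracket part is treated monomial by monomial.\<close>

lemma ext_d_Phi_inv:
  assumes "l \<noteq> 0"
  shows "ext_d k l m 4 Phi_inv a X = comb E (dPhi_terms (of_int (m * k) / c7 k l m)
       (of_int (m * l) / c7 k l m) (- of_int (k\<^sup>2 + l\<^sup>2) / c7 k l m)
       (of_int l / c8 k l) (- of_int k / c8 k l)) X"
proof -
  let ?T = "mc_terms (of_int (m * k) / c7 k l m) (of_int (m * l) / c7 k l m)
    (- of_int (k\<^sup>2 + l\<^sup>2) / c7 k l m) (of_int l / c8 k l) (- of_int k / c8 k l)"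
  let ?L = "of_int_terms spin7_terms"
  have L: "terms 4 ?L"
    by (rule terms_of_int[OF terms_spin7])
  have "ext_d k l m 4 Phi_inv a X = (\<Sum>j\<le>4. \<Sum>i<j. (-1) ^ (i + j) *
      comb E ?L (case_nat (bracket_m k l m (X i) (X j)) (omit i (omit j X))))"
    by (simp add: ext_d_def Phi_inv_def Phi_m_eq_spin7_form spin7_form_comb)
  also have "\<dots> = (\<Sum>j\<le>4. \<Sum>i<j. \<Sum>x\<leftarrow>?L. (-1) ^ (i + j) *
      (fst x * emono E (snd x) (case_nat (bracket_m k l m (X i) (X j)) (omit i (omit j X)))))"
    unfolding comb_def case_prod_unfold sum_list_const_mult ..
  also have "\<dots> = (\<Sum>x\<leftarrow>?L. \<Sum>j\<le>4. \<Sum>i<j. (-1) ^ (i + j) *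
      (fst x * emono E (snd x) (case_nat (bracket_m k l m (X i) (X j)) (omit i (omit j X)))))"
    unfolding sum_sum_list ..
  also have "\<dots> = (\<Sum>x\<leftarrow>?L. comb E (d_terms ?T x) X)"
    by (intro arg_cong[of _ _ sum_list] map_cong refl ext_d_emono assms terms_single[OF L])
  also have "\<dots> = comb E (concat (map (d_terms ?T) ?L)) X"
    unfolding comb_concat ..
  finally show ?thesis by (simp only: dPhi_terms)
qed

section \<open>The Hodge operator\<close>

lemma detform_cong:
  assumes "\<And>n. n < length fs \<Longrightarrow> X n = Y n"
  shows "detform fs X = detform fs Y"
proof -
  have "(\<Prod>a<length fs. (fs ! a) (X (\<pi> a))) = (\<Prod>a<length fs. (fs ! a) (Y (\<pi> a)))"
    if "\<pi> permutes {..<length fs}" for \<pi>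
  proof (rule prod.cong[OF refl])
    fix a assume "a \<in> {..<length fs}"
    then have "\<pi> a < length fs" using permutes_in_image[OF that, of a] by simp
    then show "(fs ! a) (X (\<pi> a)) = (fs ! a) (Y (\<pi> a))" by (simp add: assms)
  qed
  then show ?thesis by (simp add: detform_def)
qed

lemma detform_first_column_zero:
  assumes "\<And>f. f \<in> set fs \<Longrightarrow> f (X 0) = 0"
  shows "detform (u # fs) X = u (X 0) * detform fs (\<lambda>n. X (Suc n))"
proof -
  have "(-1) ^ n * u (X n) * detform fs (omit n X) = 0" if "n \<in> {..length fs} - {0}" for n
  proof -
    have "detform fs (omit n X) = 0"
      using that assms by (intro detform_zero_column) (auto simp: omit_def)
    then show ?thesis by simp
  qed
  then have "detform (u # fs) X = (\<Sum>n\<in>{0}. (-1) ^ n * u (X n) * detform fs (omit n X))"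
    unfolding detform_Cons by (intro sum.mono_neutral_right) auto
  also have "omit 0 X = (\<lambda>n. X (Suc n))" by (simp add: fun_eq_iff omit_def)
  ultimately show ?thesis by simp
qed

text \<open>The first argument pairs only with the first index, since the indices are distinct; each
  index of \<open>J\<close> thus removes one row and one column.\<close>

lemma emono_block:
  assumes "distinct (J @ J')" "set (J @ J') \<subseteq> {1..8}"
  shows "emono E (J @ J') (\<lambda>n. if n < length J then axis (of_nat (J ! n)) 1 else Y (n - length J)) = emono E J' Y"
  using assms
proof (induction J)
  case (Cons j J)
  let ?X = "\<lambda>n. if n < length (j # J) then axis (of_nat ((j # J) ! n)) 1 else Y (n - length (j # J))"
  have "E i (?X 0) = (if i = j then 1 else 0)" if "i \<in> {1..8}" for i
    using of_nat_8_eq_iff[OF that, of j] Cons.prems by (auto simp: e_form_axis)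
  moreover have "(\<lambda>n. ?X (Suc n)) = (\<lambda>n. if n < length J then axis (of_nat (J ! n)) 1 else Y (n - length J))"
    by (auto simp: fun_eq_iff)
  ultimately show ?case
    using Cons unfolding emono_def
    by (simp only: append_Cons list.map) (subst detform_first_column_zero, force, force)
qed simp

definition compl :: "nat list \<Rightarrow> nat list" where
  "compl J = filter (\<lambda>x. x \<notin> set J) [1,2,3,4,5,6,7,8]"

lemma distinct_compl: "distinct (compl J)"
  unfolding compl_def by (rule distinct_filter) simp

lemma set_compl: "set (compl J) = {1..8} - set J"
proof -
  have N: "set [1,2,3,4,5,6,7,8::nat] = {1..8}" by auto
  show ?thesis unfolding compl_def set_filter N by auto
qed

lemma ins_sign_set: "set (snd (ins_sign x ys)) = insert x (set ys)"
  by (induction ys) (auto simp: split_beta)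

lemma sort_sign_set: "set (snd (sort_sign xs)) = set xs"
  by (induction xs) (auto simp: split_beta ins_sign_set)

lemma ins_sign_distinct: "x \<notin> set ys \<Longrightarrow> fst (ins_sign x ys) * fst (ins_sign x ys) = 1"
  by (induction ys) (auto simp: split_beta)

lemma sort_sign_distinct: "distinct xs \<Longrightarrow> fst (sort_sign xs) * fst (sort_sign xs) = 1"
proof (induction xs)
  case (Cons x xs)
  then have 1: "fst (ins_sign x (snd (sort_sign xs))) * fst (ins_sign x (snd (sort_sign xs))) = 1"
    by (intro ins_sign_distinct) (simp add: sort_sign_set)
  have 2: "fst (sort_sign xs) * fst (sort_sign xs) = 1"
    using Cons by simp
  have 3: "fst (sort_sign (x # xs)) = fst (sort_sign xs) * fst (ins_sign x (snd (sort_sign xs)))"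
    by (simp add: split_beta)
  have 4: "a * b * (a * b) = (a * a) * (b * b)" for a b :: int
    by (simp only: mult_ac)
  show ?case unfolding 3 4 1 2 by simp
qed simp

text \<open>Expanding \<open>emono E J\<close> over permutations leaves one index function per
  permutation. All these contributions are equal, since the sign of the permutation occurs twice,
  and their number cancels \<open>fact p\<close>.\<close>

lemma hodge_emono:
  assumes J: "length J = p" "distinct J" "set J \<subseteq> {1..8}"
  shows "hodge g_std (wmono e_form [1,2,3,4,5,6,7,8]) p (emono E J) Y =
    of_int (fst (sort_sign (J @ compl J))) * emono E (compl J) Y"
proof -
  let ?top = "[1,2,3,4,5,6,7,8::nat]"
  let ?I = "{..<p} \<rightarrow>\<^sub>E (UNIV :: 8 set)"
  define K where "K = (\<lambda>n. of_nat (J ! n) :: 8)"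
  define X where "X I = (\<lambda>n. if n < p then axis (I n) 1 else Y (n - p))" for I :: "nat \<Rightarrow> 8"
  define V where "V I = emono E ?top (X I)" for I
  have dist: "distinct (J @ compl J)" "set (J @ compl J) = {1..8}"
    using J by (auto simp: distinct_compl set_compl)
  have len: "length (J @ compl J) = 8"
    using distinct_card[OF dist(1)] unfolding dist(2) by simp
  then have p: "p \<le> 8" using J(1) by simp
  let ?s = "fst (sort_sign (J @ compl J))"
  have up: "[1..<Suc 8] = ?top" by code_simp
  have swap: "emono E (J @ compl J) Z = of_int ?s * emono E ?top Z" for Z
    unfolding up[symmetric] by (rule emono_top[OF len eq_refl[OF dist(2)]])
  have "emono E (compl J) Y = emono E (J @ compl J) (X K)"
    unfolding X_def K_def J(1)[symmetric] by (rule emono_block[OF dist(1) eq_refl[OF dist(2)], symmetric])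
  also have "\<dots> = of_int ?s * V K"
    by (simp add: swap V_def)
  finally have "of_int ?s * emono E (compl J) Y = of_int (?s * ?s) * V K"
    by (simp add: mult.assoc)
  then have VK: "V K = of_int ?s * emono E (compl J) Y"
    using sort_sign_distinct[OF dist(1)] by simp
  \<comment> \<open>The surviving index function is \<open>K\<close> composed with the inverse of
    \<rho>, restricted to \<open>{..<p}\<close> because members of \<open>?I\<close> are
    extensional.\<close>
  have one: "(\<Prod>a<p. E (J ! a) (axis (I (\<rho> a)) 1)) * V I =
      (if I = (\<lambda>b\<in>{..<p}. K (inv_into UNIV \<rho> b)) then of_int (sign \<rho>) * V K else 0)"
    if \<rho>: "\<rho> permutes {..<p}" and I: "I \<in> ?I" for \<rho> I
  proof (cases "\<forall>a<p. I (\<rho> a) = K a")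
    case True
    have "I b = (\<lambda>b\<in>{..<p}. K (inv_into UNIV \<rho> b)) b" for b
    proof (cases "b < p")
      case b: True
      have "inv_into UNIV \<rho> b < p"
        using permutes_in_image[OF permutes_inv[OF \<rho>], of b] b by simp
      then have "I (\<rho> (inv_into UNIV \<rho> b)) = K (inv_into UNIV \<rho> b)" using True by blast
      then show ?thesis using b permutes_inverses(1)[OF \<rho>] by simp
    qed (use I in \<open>auto simp: PiE_def extensional_def\<close>)
    then have eq: "I = (\<lambda>b\<in>{..<p}. K (inv_into UNIV \<rho> b))" ..
    have "\<rho> permutes {..<length (map E ?top)}"
      using \<rho> p by (auto elim!: permutes_subset)
    from detform_permute_args[OF this, of "X I"]
    have "emono E ?top (\<lambda>n. X I (\<rho> n)) = of_int (sign \<rho>) * V I"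
      by (simp add: emono_def V_def)
    also have "(\<lambda>n. X I (\<rho> n)) = X K"
    proof
      fix n
      show "X I (\<rho> n) = X K n"
        using True permutes_in_image[OF \<rho>, of n] permutes_not_in[OF \<rho>, of n] by (cases "n < p") (auto simp: X_def)
    qed
    finally have "of_int (sign \<rho>) * V K = of_int (sign \<rho> * sign \<rho>) * V I"
      by (simp add: V_def[of K] mult.assoc del: sign_idempotent)
    then have "V I = of_int (sign \<rho>) * V K" by simp
    moreover have "(\<Prod>a<p. E (J ! a) (axis (I (\<rho> a)) 1)) = 1"
      using True by (intro prod.neutral) (auto simp: e_form_axis K_def)
    ultimately show ?thesis using eq by simp
  next
    case False
    then obtain a where a: "a < p" "I (\<rho> a) \<noteq> K a" by blast
    then have "(\<Prod>a<p. E (J ! a) (axis (I (\<rho> a)) 1)) = 0"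
      by (intro prod_zero) (auto simp: e_form_axis K_def intro!: bexI[of _ a])
    moreover have "I \<noteq> (\<lambda>b\<in>{..<p}. K (inv_into UNIV \<rho> b))"
    proof
      assume *: "I = (\<lambda>b\<in>{..<p}. K (inv_into UNIV \<rho> b))"
      have "I (\<rho> a) = K a"
        using permutes_in_image[OF \<rho>, of a] a(1) permutes_inverses(2)[OF \<rho>] by (simp add: *)
      with a(2) show False ..
    qed
    ultimately show ?thesis by simp
  qed
  have "hodge g_std (wmono e_form [1,2,3,4,5,6,7,8]) p (emono E J) Y =
     (\<Sum>I\<in>?I. emono E J (\<lambda>n. axis (I n) 1) * V I) / fact p"
    by (simp add: hodge_def dual_axis_g_std V_def X_def wmono_eq_detform emono_def)
  also have "(\<Sum>I\<in>?I. emono E J (\<lambda>n. axis (I n) 1) * V I) =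
      (\<Sum>I\<in>?I. \<Sum>\<rho> | \<rho> permutes {..<p}. of_int (sign \<rho>) * ((\<Prod>a<p. E (J ! a) (axis (I (\<rho> a)) 1)) * V I))"
    by (simp add: emono_def detform_def J(1) sum_distrib_right mult.assoc)
  also have "\<dots> = (\<Sum>\<rho> | \<rho> permutes {..<p}. \<Sum>I\<in>?I. of_int (sign \<rho>) *
      (if I = (\<lambda>b\<in>{..<p}. K (inv_into UNIV \<rho> b)) then of_int (sign \<rho>) * V K else 0))"
    by (subst sum.swap) (intro sum.cong refl, simp add: one)
  also have "\<dots> = (\<Sum>\<rho> | \<rho> permutes {..<p}. V K)"
    by (intro sum.cong refl)
       (simp add: sum_distrib_left[symmetric] finite_PiE, simp flip: mult.assoc of_int_mult)
  also have "\<dots> = fact p * V K"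
    by (simp add: card_permutations[OF refl])
  finally show ?thesis
    by (simp add: VK)
qed


lemma hodge_comb:
  assumes "terms p L" "\<forall>x\<in>set L. distinct (snd x)"
  shows "hodge g_std (wmono e_form [1,2,3,4,5,6,7,8]) p (comb E L) =
    comb E (map (\<lambda>(c, J). (c * of_int (fst (sort_sign (J @ compl J))), compl J)) L)"
proof
  fix Y
  let ?h = "hodge g_std (wmono e_form [1,2,3,4,5,6,7,8]) p"
  have "?h (\<lambda>X. \<Sum>x\<leftarrow>L. fst x * emono E (snd x) X) Y = (\<Sum>x\<leftarrow>L. fst x * ?h (emono E (snd x)) Y)" for L
    by (induction L) (simp_all add: hodge_def algebra_simps sum.distrib sum_distrib_left add_divide_distrib)
  then have "?h (comb E L) Y = (\<Sum>x\<leftarrow>L. fst x * ?h (emono E (snd x)) Y)"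
    by (simp add: comb_def[abs_def] case_prod_unfold)
  also have "\<dots> = (\<Sum>x\<leftarrow>L. fst x * (of_int (fst (sort_sign (snd x @ compl (snd x)))) * emono E (compl (snd x)) Y))"
    using assms by (intro arg_cong[of _ _ sum_list] map_cong refl arg_cong2[of _ _ _ _ "(*)"] hodge_emono)
      (auto simp: terms_def)
  finally show "?h (comb E L) Y = comb E (map (\<lambda>(c, J). (c * of_int (fst (sort_sign (J @ compl J))), compl J)) L) Y"
    by (simp add: comb_def case_prod_unfold comp_def mult.assoc)
qed

text \<open>Applied with \<theta> the Lee form, whose explicit value is not computed.\<close>

lemma wedge_one_form_comb:
  assumes "terms p L"
  shows "wedge 1 p (one_form \<theta>) (comb E L) X = (\<Sum>n\<le>p. (-1) ^ n * \<theta> (X n) * comb E L (omit n X))"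
proof -
  have one: "one_form \<theta> = detform [\<theta>]"
    by (simp add: fun_eq_iff one_form_def detform_singleton)
  have *: "wedge 1 p (one_form \<theta>) (emono E (snd x)) X = (\<Sum>n\<le>p. (-1) ^ n * \<theta> (X n) * emono E (snd x) (omit n X))"
    if "x \<in> set L" for x
  proof -
    have "length (snd x) = p" using assms that by (auto simp: terms_def)
    then show ?thesis
      using wedge_detform[of "[\<theta>]" "map E (snd x)"] by (simp add: one emono_def detform_Cons[of \<theta>])
  qed
  have "wedge 1 p (one_form \<theta>) (comb E L) X = (\<Sum>x\<leftarrow>L. fst x * wedge 1 p (one_form \<theta>) (emono E (snd x)) X)"
    unfolding comb_def case_prod_unfold wedge_sum_list_right ..
  also have "\<dots> = (\<Sum>x\<leftarrow>L. \<Sum>n\<le>p. (-1) ^ n * \<theta> (X n) * (fst x * emono E (snd x) (omit n X)))"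
    by (intro arg_cong[of _ _ sum_list] map_cong refl) (subst *, assumption, simp add: sum_distrib_left mult_ac)
  also have "\<dots> = (\<Sum>n\<le>p. (-1) ^ n * \<theta> (X n) * comb E L (omit n X))"
    unfolding sum_sum_list[symmetric] comb_def case_prod_unfold sum_list_const_mult ..
  finally show ?thesis .
qed

text \<open>The volume form reads eight arguments, of which the first seven are basis vectors in the
  Hodge sum; the last one is \<open>X (7 - 7)\<close>.\<close>

lemma lee_form_first: "lee_form k l m Phi_inv a X = lee_form k l m Phi_inv a (\<lambda>_. X 0)"
proof -
  have "wmono e_form [1,2,3,4,5,6,7,8] (\<lambda>n. if n < 7 then axis (I n) 1 else X (n - 7)) =
        wmono e_form [1,2,3,4,5,6,7,8] (\<lambda>n. if n < 7 then axis (I n) 1 else X 0)" for I :: "nat \<Rightarrow> 8"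
    unfolding wmono_eq_detform by (rule detform_cong) auto
  then show ?thesis
    by (simp add: lee_form_def spin7_hodge_def hodge_def Phi_inv_def spin7_vol_Phi_m del: wmono.simps)
qed

lemma Phi_m_axis:
  assumes "sorted_wrt (<) (map j [0..<4])" "set (map j [0..<4]) \<subseteq> {1..8}"
  shows "comb E (of_int_terms spin7_terms) (\<lambda>n. axis (of_nat (j n)) 1) = comb_coeff (of_int_terms spin7_terms) (map j [0..<4])"
  by (rule comb_axis[OF terms_of_int[OF terms_spin7] assms])

lemma wedge_one_form_Phi_m:
  assumes "sorted_wrt (<) (map j [0..<5])" "set (map j [0..<5]) \<subseteq> {1..8}"
  shows "wedge 1 4 (one_form \<theta>) Phi_m (\<lambda>n. axis (of_nat (j n)) 1) =
    (\<Sum>n\<le>4. (-1) ^ n * \<theta> (axis (of_nat (j n)) 1) * comb_coeff (of_int_terms spin7_terms) (map (omit n j) [0..<4]))"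
proof -
  have "comb E (of_int_terms spin7_terms) (omit n (\<lambda>i. axis (of_nat (j i)) 1)) =
      comb_coeff (of_int_terms spin7_terms) (map (omit n j) [0..<4])" if "n \<le> 4" for n
  proof -
    have "omit n (\<lambda>i. axis (of_nat (j i)) (1::real)) = (\<lambda>i. axis (of_nat (omit n j i) :: 8) 1)"
      by (auto simp: omit_def fun_eq_iff)
    moreover have "sorted_wrt (<) (map (omit n j) [0..<4])"
      using assms(1) that by (auto simp: sorted_wrt_iff_nth_less omit_def)
    moreover have "set (map (omit n j) [0..<4]) \<subseteq> {1..8}"
      using assms(2) that by (auto simp: omit_def image_subset_iff)
    ultimately show ?thesis using Phi_m_axis by simp
  qed
  then show ?thesis
    unfolding Phi_m_eq_spin7_form spin7_form_comb
    by (subst wedge_one_form_comb[OF terms_of_int[OF terms_spin7]]) (intro sum.cong refl, simp)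
qed

section \<open>Mixed type\<close>

lemma not_locally_conformal_parallel_Phi_inv:
  assumes "l \<noteq> 0" "0 \<le> m * l"
  shows "\<not> locally_conformal_parallel k l m Phi_inv"
proof
  assume "locally_conformal_parallel k l m Phi_inv"
  then have eq: "ext_d k l m 4 Phi_inv (mat 1, mat 1, mat 1) =
      wedge 1 4 (lee_form k l m Phi_inv (mat 1, mat 1, mat 1)) (Phi_inv (mat 1, mat 1, mat 1))"
    using one_in_GG by (auto simp: locally_conformal_parallel_def)
  define \<theta> where "\<theta> v = lee_form k l m Phi_inv (mat 1, mat 1, mat 1) (\<lambda>_. v)" for v
  have \<theta>: "lee_form k l m Phi_inv (mat 1, mat 1, mat 1) = one_form \<theta>"
    unfolding one_form_def \<theta>_def by (rule ext, rule lee_form_first)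
  have pm: "Phi_inv (mat 1, mat 1, mat 1) = Phi_m"
    by (simp add: Phi_inv_def)
  define a b c d e where "a = real_of_int (m * k) / c7 k l m" and "b = of_int (m * l) / c7 k l m"
    and "c = - of_int (k\<^sup>2 + l\<^sup>2) / c7 k l m" and "d = of_int l / c8 k l" and "e = - of_int k / c8 k l"
  note abcde = this
  have terms: "terms 5 (dPhi_terms a b c d e)"
    by (simp add: terms_def dPhi_terms_def)
  have dPhi: "comb_coeff (dPhi_terms a b c d e) (map j [0..<5]) =
      (\<Sum>n\<le>4. (-1) ^ n * \<theta> (axis (of_nat (j n)) 1) * comb_coeff (of_int_terms spin7_terms) (map (omit n j) [0..<4]))"
    if "sorted_wrt (<) (map j [0..<5])" "set (map j [0..<5]) \<subseteq> {1..8}" for j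
    using fun_cong[OF eq[unfolded \<theta> pm], of "\<lambda>n. axis (of_nat (j n)) 1"]
    unfolding wedge_one_form_Phi_m[OF that] ext_d_Phi_inv[OF assms(1)] abcde[symmetric] comb_axis[OF terms that] .
  have upt: "[0..<5] = [0,1,2,3,4::nat]" "[0..<4] = [0,1,2,3::nat]" by code_simp+
  have sum4: "(\<Sum>n\<le>4. f n) = f 0 + f 1 + f 2 + f 3 + f 4" for f :: "nat \<Rightarrow> real"
    by (simp add: atMost_Suc numeral_eq_Suc add_ac)
  \<comment> \<open>On the indices 1, 2, 3, 4, 8 the only term of \<Phi> that fits is 1234, with
    coefficient 1, which leaves the eighth component of \<theta>; for 1, 2, 5, 6, 8 it is
    1256.\<close>
  have "a - b = \<theta> (axis 8 1)"
    using dPhi[of "\<lambda>n. [1,2,3,4,8] ! n"]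
    unfolding upt sum4 by (simp add: comb_coeff_def dPhi_terms_def spin7_terms_def omit_def)
  moreover have "a - c = \<theta> (axis 8 1)"
    using dPhi[of "\<lambda>n. [1,2,5,6,8] ! n"]
    unfolding upt sum4 by (simp add: comb_coeff_def dPhi_terms_def spin7_terms_def omit_def)
  ultimately have "b = c" by simp
  have "k\<^sup>2 + l\<^sup>2 > 0" "k\<^sup>2 + l\<^sup>2 + m\<^sup>2 > 0"
    using assms(1) by (auto simp: add_nonneg_pos add_pos_nonneg)
  then have c7: "c7 k l m > 0" unfolding c7_def by (intro mult_pos_pos) (simp_all only: real_sqrt_gt_0_iff of_int_0_less_iff)
  from \<open>b = c\<close> c7 have "real_of_int (m * l) = - of_int (k\<^sup>2 + l\<^sup>2)"
    by (simp add: b_def c_def)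
  then have "m * l = - (k\<^sup>2 + l\<^sup>2)" by linarith
  with assms(2) \<open>k\<^sup>2 + l\<^sup>2 > 0\<close> show False by linarith
qed

lemma not_balanced_Phi_inv:
  assumes "l \<noteq> 0" "0 \<le> m * (k - l)"
  shows "\<not> balanced k l m Phi_inv"
proof
  assume "balanced k l m Phi_inv"
  then have eq: "star_d_wedge k l m Phi_inv (mat 1, mat 1, mat 1) = (\<lambda>X. 0)"
    using one_in_GG by (auto simp: balanced_def)
  have pm: "Phi_inv (mat 1, mat 1, mat 1) = Phi_m"
    by (simp add: Phi_inv_def)
  define a b c d e where "a = real_of_int (m * k) / c7 k l m" and "b = of_int (m * l) / c7 k l m"
    and "c = - of_int (k\<^sup>2 + l\<^sup>2) / c7 k l m" and "d = of_int l / c8 k l" and "e = - of_int k / c8 k l"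
  note abcde = this
  define S where "S = map (\<lambda>(c, J). (c * of_int (fst (sort_sign (J @ compl J))), compl J)) (dPhi_terms a b c d e)"
  have ext: "ext_d k l m 4 Phi_inv a' = comb E (dPhi_terms a b c d e)" for a'
    using ext_d_Phi_inv[OF assms(1)] by (simp add: fun_eq_iff abcde)
  have S: "terms 3 S"
    by (simp add: terms_def S_def dPhi_terms_def compl_def)
  have hc: "hodge g_std (wmono e_form [1,2,3,4,5,6,7,8]) 5 (comb E (dPhi_terms a b c d e)) = comb E S"
    unfolding S_def by (rule hodge_comb) (simp_all add: terms_def dPhi_terms_def)
  have pc: "Phi_m = comb E (of_int_terms spin7_terms)"
    by (simp only: Phi_m_eq_spin7_form spin7_form_comb)
  have "star_d_wedge k l m Phi_inv (mat 1, mat 1, mat 1) = wedge 3 4 (comb E S) Phi_m"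
    unfolding star_d_wedge_def ext pm spin7_hodge_def spin7_metric_Phi_m spin7_vol_Phi_m hc ..
  also have "\<dots> = comb E (comb_mult S (of_int_terms spin7_terms))"
    unfolding pc by (rule wedge_comb[OF S terms_of_int[OF terms_spin7]])
  finally have star: "star_d_wedge k l m Phi_inv (mat 1, mat 1, mat 1) = comb E (comb_mult S (of_int_terms spin7_terms))" .
  have "comb E (comb_mult S (of_int_terms spin7_terms)) X = 0" for X
    using fun_cong[OF eq, of X] unfolding star .
  moreover have upt: "map Suc [0..<7] = [1,2,3,4,5,6,7]" by code_simp
  moreover have "comb E (comb_mult S (of_int_terms spin7_terms)) (\<lambda>n. axis (of_nat (Suc n)) 1) =
      comb_coeff (comb_mult S (of_int_terms spin7_terms)) (map Suc [0..<7])"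
    by (rule comb_axis)
       (use terms_comb_mult[OF S terms_of_int[OF terms_spin7]] in \<open>simp_all add: upt del: upt_Suc\<close>)
  ultimately have "comb_coeff (comb_mult S (of_int_terms spin7_terms)) [1,2,3,4,5,6,7] = 0"
    by simp
  \<comment> \<open>Up to the common sign -1, the components 12348, 12568 and 34568 of d\<Phi>
    contribute 2(a - b - c) together, and 13578, 14678, 23678 and 24578 contribute a - b - c
    each.\<close>
  moreover have "comb_coeff (comb_mult S (of_int_terms spin7_terms)) [1,2,3,4,5,6,7] = - 6 * (a - b - c)"
    by (simp add: comb_coeff_def comb_mult_def S_def dPhi_terms_def spin7_terms_def compl_def)
  ultimately have "a - b - c = 0" by simp
  have "k\<^sup>2 + l\<^sup>2 > 0" "k\<^sup>2 + l\<^sup>2 + m\<^sup>2 > 0"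
    using assms(1) by (auto simp: add_nonneg_pos add_pos_nonneg)
  then have c7: "c7 k l m > 0" unfolding c7_def by (intro mult_pos_pos) (simp_all only: real_sqrt_gt_0_iff of_int_0_less_iff)
  \<comment> \<open>The numerator is positive, as \<open>m * (k - l)\<close> is nonnegative and
    \<open>l\<close> is nonzero.\<close>
  have "a - b - c = of_int (m * (k - l) + k\<^sup>2 + l\<^sup>2) / c7 k l m"
    by (simp add: a_def b_def c_def algebra_simps add_divide_distrib diff_divide_distrib)
  with \<open>a - b - c = 0\<close> c7 have "m * (k - l) + k\<^sup>2 + l\<^sup>2 = 0"
    by (simp del: of_int_add of_int_mult of_int_diff of_int_power)
  with assms(2) \<open>k\<^sup>2 + l\<^sup>2 > 0\<close> show False by linarith
qed

section \<open>The stabiliser algebra and the characteristic connection\<close>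

lemma detform_quad_upd:
  assumes "i < 4"
  shows "detform [f, g, h, k] (Y(i := v)) = (-1) ^ i * detform [f, g, h, k] (case_nat v (omit i Y))"
proof -
  have "i \<in> {0, 1, 2, 3}" using assms by auto
  then show ?thesis
    by (elim insertE emptyE) (simp_all add: detform_quad omit_def numeral_2_eq_2 numeral_3_eq_3 algebra_simps)
qed

text \<open>The value of \<open>\<Phi>\<close> on \<open>v\<close> and the three basis vectors with indices \<open>js\<close>.\<close>

definition spin7_slot :: "vec8 \<Rightarrow> nat list \<Rightarrow> real" where
  "spin7_slot v js = (\<Sum>(c, J)\<leftarrow>spin7_terms. of_int c *
     ((if [J ! 1, J ! 2, J ! 3] = js then E (J ! 0) v else 0) - (if [J ! 0, J ! 2, J ! 3] = js then E (J ! 1) v else 0)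
    + (if [J ! 0, J ! 1, J ! 3] = js then E (J ! 2) v else 0) - (if [J ! 0, J ! 1, J ! 2] = js then E (J ! 3) v else 0)))"

lemma upt3: "[0..<3] = [0, 1, 2::nat]" by code_simp

lemma Phi_m_slot:
  assumes "length q = 4" "sorted_wrt (<) q" "set q \<subseteq> {1..8}" "i < 4"
  shows "Phi_m ((\<lambda>n. axis (of_nat (q ! n)) 1)(i := v)) = (-1) ^ i * spin7_slot v (map (\<lambda>n. q ! omit i id n) [0..<3])"
proof -
  define j where "j n = q ! omit i id n" for n
  have j: "sorted_wrt (<) (map j [0..<3])" "set (map j [0..<3]) \<subseteq> {1..8}"
    using assms by (auto simp: sorted_wrt_iff_nth_less j_def omit_def)
  have om: "omit i (\<lambda>n. axis (of_nat (q ! n)) (1::real)) = (\<lambda>n. axis (of_nat (j n) :: 8) 1)"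
    by (auto simp: fun_eq_iff omit_def j_def)
  have slot: "emono E J ((\<lambda>n. axis (of_nat (q ! n)) 1)(i := v)) = (-1) ^ i *
     ((if [J ! 1, J ! 2, J ! 3] = map j [0..<3] then E (J ! 0) v else 0) - (if [J ! 0, J ! 2, J ! 3] = map j [0..<3] then E (J ! 1) v else 0)
    + (if [J ! 0, J ! 1, J ! 3] = map j [0..<3] then E (J ! 2) v else 0) - (if [J ! 0, J ! 1, J ! 2] = map j [0..<3] then E (J ! 3) v else 0))"
    if J: "(c, J) \<in> set spin7_terms" for c J
  proof -
    obtain a b c d where J': "J = [a, b, c, d]" "a < b" "b < c" "c < d" "{a, b, c, d} \<subseteq> {1..8}"
      using J by (auto simp: spin7_terms_def)
    have ax: "emono E t (\<lambda>n. axis (of_nat (j n)) 1) = (if t = map j [0..<3] then 1 else 0)"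
      if "t \<in> {[b, c, d], [a, c, d], [a, b, d], [a, b, c]}" for t
      using that J'(2-) by (intro emono_axis[OF j]) auto
    show ?thesis
      using ax[of "[b, c, d]"] ax[of "[a, c, d]"] ax[of "[a, b, d]"] ax[of "[a, b, c]"]
      by (simp add: J'(1) emono_def detform_quad_upd[OF assms(4)] detform_first_column om)
  qed
  have "Phi_m ((\<lambda>n. axis (of_nat (q ! n)) 1)(i := v)) =
      (\<Sum>x\<leftarrow>spin7_terms. of_int (fst x) * emono E (snd x) ((\<lambda>n. axis (of_nat (q ! n)) 1)(i := v)))"
    by (simp add: Phi_m_eq_spin7_form spin7_form_comb comb_def case_prod_unfold comp_def)
  also have "\<dots> = (-1) ^ i * spin7_slot v (map j [0..<3])"
    unfolding spin7_slot_def sum_list_const_mult[symmetric]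
    by (intro arg_cong[of _ _ sum_list] map_cong refl) (auto simp: slot)
  finally show ?thesis unfolding j_def[abs_def] .
qed

text \<open>On \<open>so(8)\<close> these seven equations, one for each splitting of \<open>{1,...,8}\<close> into pairs that is
  compatible with \<open>\<Phi>\<close>, cut out the subalgebra \<open>spin(7)\<close>.\<close>

lemma spin7_stabiliser:
  fixes f :: "vec8 \<Rightarrow> vec8"
  assumes "\<And>Y. (\<Sum>j<4. Phi_m (Y(j := f (Y j)))) = 0"
  defines "A \<equiv> \<lambda>i j. f (axis i 1) $ j"
  shows "A 1 8 + A 2 7 - A 3 6 + A 5 4 = 0"
    and "- A 1 7 + A 2 8 + A 3 5 + A 6 4 = 0"
    and "A 1 6 - A 2 5 + A 3 8 + A 7 4 = 0"
    and "- A 1 5 - A 2 6 - A 3 7 + A 8 4 = 0"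
    and "- A 1 4 + A 2 3 + A 5 8 + A 7 6 = 0"
    and "A 1 3 + A 2 4 - A 5 7 + A 8 6 = 0"
    and "- A 1 2 + A 3 4 + A 5 6 + A 8 7 = 0"
proof -
  have sum4: "(\<Sum>j<4. h j) = h 0 + h 1 + h 2 + h 3" for h :: "nat \<Rightarrow> real"
    by (simp add: lessThan_Suc numeral_eq_Suc add_ac)
  have 1: "(\<Sum>i<4. (-1) ^ i * spin7_slot (f (axis (of_nat (q ! i)) 1)) (map (\<lambda>n. q ! omit i id n) [0..<3])) = 0"
    if "length q = 4" "sorted_wrt (<) q" "set q \<subseteq> {1..8}" for q :: "nat list"
    using assms(1)[of "\<lambda>n. axis (of_nat (q ! n)) 1"] Phi_m_slot[OF that] by simp
  note 1 = 1[unfolded sum4 upt3 list.map omit_def id_def]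
  \<comment> \<open>The quadruple 1235 is not a term of \<Phi>, but each of its triples extends to
    exactly one term; the added index and the omitted one name an entry of \<open>A\<close>. The
    other six quadruples work in the same way.\<close>
  show "A 1 8 + A 2 7 - A 3 6 + A 5 4 = 0"
    using 1[of "[1,2,3,5]"] by (simp add: spin7_slot_def spin7_terms_def A_def e_form_def)
  show "- A 1 7 + A 2 8 + A 3 5 + A 6 4 = 0"
    using 1[of "[1,2,3,6]"] by (simp add: spin7_slot_def spin7_terms_def A_def e_form_def)
  show "A 1 6 - A 2 5 + A 3 8 + A 7 4 = 0"
    using 1[of "[1,2,3,7]"] by (simp add: spin7_slot_def spin7_terms_def A_def e_form_def)
  show "- A 1 5 - A 2 6 - A 3 7 + A 8 4 = 0"
    using 1[of "[1,2,3,8]"] by (simp add: spin7_slot_def spin7_terms_def A_def e_form_def)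
  show "- A 1 4 + A 2 3 + A 5 8 + A 7 6 = 0"
    using 1[of "[1,2,5,7]"] by (simp add: spin7_slot_def spin7_terms_def A_def e_form_def)
  show "A 1 3 + A 2 4 - A 5 7 + A 8 6 = 0"
    using 1[of "[1,2,5,8]"] by (simp add: spin7_slot_def spin7_terms_def A_def e_form_def)
  show "- A 1 2 + A 3 4 + A 5 6 + A 8 7 = 0"
    using 1[of "[1,3,5,8]"] by (simp add: spin7_slot_def spin7_terms_def A_def e_form_def)
qed

lemma g_std_axis: "g_std v (axis j 1) = v $ j"
  by (simp add: g_std_def e_form_def axis_def if_distrib[of "\<lambda>t. _ * t"] cong: if_cong)

lemma g_std_eq: "g_std x y = x $ 1 * y $ 1 + x $ 2 * y $ 2 + x $ 3 * y $ 3 + x $ 4 * y $ 4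
    + x $ 5 * y $ 5 + x $ 6 * y $ 6 + x $ 7 * y $ 7 + x $ 8 * y $ 8"
  by (simp add: g_std_def e_form_def sum_8)

text \<open>This reflects the bi-invariance of the product on the Lie algebra; here it is checked in
  coordinates.\<close>

lemma naturally_reductive_g_std:
  assumes "l \<noteq> 0"
  shows "naturally_reductive k l m g_std"
  unfolding naturally_reductive_def totally_skew_def g_std_eq bracket_m_eq[OF assms]
  by (auto simp: rot1_def rot2_def rot3_def algebra_simps add_divide_distrib diff_divide_distrib)

text \<open>For each vector \<open>e\<^sub>p\<close> the seven components of a 3-form that a triple cross product maps to \<open>e\<^sub>p\<close> satisfy
  seven equations, indexed by the lines of a Fano plane; this system is invertible.\<close>

lemma spin7_three_form_zero:
  fixes T :: "8 \<Rightarrow> 8 \<Rightarrow> 8 \<Rightarrow> real"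
  assumes sw12: "\<And>x y z. T x y z = - T y x z" and sw23: "\<And>x y z. T x y z = - T x z y"
    and eq: "\<And>p. T p 1 8 + T p 2 7 - T p 3 6 + T p 5 4 = 0"
      "\<And>p. - T p 1 7 + T p 2 8 + T p 3 5 + T p 6 4 = 0"
      "\<And>p. T p 1 6 - T p 2 5 + T p 3 8 + T p 7 4 = 0"
      "\<And>p. - T p 1 5 - T p 2 6 - T p 3 7 + T p 8 4 = 0"
      "\<And>p. - T p 1 4 + T p 2 3 + T p 5 8 + T p 7 6 = 0"
      "\<And>p. T p 1 3 + T p 2 4 - T p 5 7 + T p 8 6 = 0"
      "\<And>p. - T p 1 2 + T p 3 4 + T p 5 6 + T p 8 7 = 0"
  shows "T x y z = 0"
proof -
  have cyc: "T x y z = T y z x" for x y z using sw12[of x y z] sw23[of y x z] by simp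
  have cyc2: "T x y z = T z x y" for x y z using cyc[of z x y] by simp
  have sw13: "T x y z = - T z y x" for x y z using cyc[of x y z] sw12[of y z x] by simp
  have zero: "T x x z = 0" "T x z x = 0" for x z
    using sw12[of x x z] sw13[of x z x] by simp_all
  \<comment> \<open>Block \<open>zp\<close> treats the triples that the index p completes to a term
    of \<Phi>. In each equation used, one term has a repeated index and drops out, leaving three
    unknowns.\<close>
  have z1: "T 2 3 4 = 0" "T 2 5 6 = 0" "T 2 7 8 = 0" "T 3 5 7 = 0" "T 3 6 8 = 0" "T 4 5 8 = 0"
    "T 4 6 7 = 0"
    using eq(7)[of 2] eq(6)[of 3] eq(5)[of 4] eq(4)[of 5] eq(3)[of 6] eq(2)[of 7] eq(1)[of 8]
    unfolding zero sw23[of 2 8 7] sw12[of 3 2 4] sw23[of 3 8 6] cyc[of 4 2 3] sw23[of 4 7 6]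
      sw12[of 5 2 6] sw12[of 5 3 7] cyc2[of 5 8 4] cyc[of 6 2 5] sw12[of 6 3 8] cyc2[of 6 7 4]
      sw12[of 7 2 8] cyc[of 7 3 5] sw13[of 7 6 4] cyc[of 8 2 7] cyc[of 8 3 6] sw13[of 8 5 4]
    by linarith+
  have z2: "T 1 3 4 = 0" "T 1 5 6 = 0" "T 1 7 8 = 0" "T 4 6 8 = 0" "T 4 5 7 = 0" "T 3 5 8 = 0"
    "T 3 6 7 = 0"
    using eq(7)[of 1] eq(5)[of 3] eq(6)[of 4] eq(3)[of 5] eq(4)[of 6] eq(1)[of 7] eq(2)[of 8]
    unfolding zero sw23[of 1 8 7] sw12[of 3 1 4] sw23[of 3 7 6] cyc[of 4 1 3] sw23[of 4 8 6]
      sw12[of 5 1 6] sw12[of 5 3 8] cyc2[of 5 7 4] cyc[of 6 1 5] sw12[of 6 3 7] cyc2[of 6 8 4]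
      sw12[of 7 1 8] cyc[of 7 3 6] sw13[of 7 5 4] cyc[of 8 1 7] cyc[of 8 3 5] sw13[of 8 6 4]
    by linarith+
  have z3: "T 1 2 4 = 0" "T 1 5 7 = 0" "T 1 6 8 = 0" "T 4 7 8 = 0" "T 4 5 6 = 0" "T 2 5 8 = 0"
    "T 2 6 7 = 0"
    using eq(6)[of 1] eq(5)[of 2] eq(7)[of 4] eq(2)[of 5] eq(1)[of 6] eq(4)[of 7] eq(3)[of 8]
    unfolding zero sw23[of 1 8 6] sw12[of 2 1 4] sw23[of 2 7 6] cyc[of 4 1 2] sw23[of 4 8 7]
      sw12[of 5 1 7] sw12[of 5 2 8] cyc2[of 5 6 4] sw12[of 6 1 8] sw12[of 6 2 7] sw13[of 6 5 4]
      cyc[of 7 1 5] cyc[of 7 2 6] cyc2[of 7 8 4] cyc[of 8 1 6] cyc[of 8 2 5] sw13[of 8 7 4]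
    by linarith+
  have z4: "T 1 2 3 = 0" "T 1 5 8 = 0" "T 1 6 7 = 0" "T 3 7 8 = 0" "T 3 5 6 = 0" "T 2 6 8 = 0"
    "T 2 5 7 = 0"
    using eq(5)[of 1] eq(6)[of 2] eq(7)[of 3] eq(1)[of 5] eq(2)[of 6] eq(3)[of 7] eq(4)[of 8]
    unfolding zero sw23[of 1 7 6] sw12[of 2 1 3] sw23[of 2 8 6] cyc[of 3 1 2] sw23[of 3 8 7]
      sw12[of 5 1 8] sw12[of 5 2 7] sw12[of 5 3 6] sw12[of 6 1 7] sw12[of 6 2 8] cyc[of 6 3 5]
      cyc[of 7 1 6] cyc[of 7 2 5] sw12[of 7 3 8] cyc[of 8 1 5] cyc[of 8 2 6] cyc[of 8 3 7]
    by linarith+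
  have z5: "T 1 2 6 = 0" "T 1 3 7 = 0" "T 1 4 8 = 0" "T 6 7 8 = 0" "T 3 4 6 = 0" "T 2 4 7 = 0"
    "T 2 3 8 = 0"
    using eq(4)[of 1] eq(3)[of 2] eq(2)[of 3] eq(1)[of 4] eq(7)[of 6] eq(6)[of 7] eq(5)[of 8]
    unfolding zero sw23[of 1 8 4] sw12[of 2 1 6] sw23[of 2 7 4] sw12[of 3 1 7] sw12[of 3 2 8]
      sw23[of 3 6 4] sw12[of 4 1 8] sw12[of 4 2 7] sw12[of 4 3 6] cyc[of 6 1 2] cyc[of 6 3 4]
      sw23[of 6 8 7] cyc[of 7 1 3] cyc[of 7 2 4] cyc2[of 7 8 6] cyc[of 8 1 4] cyc[of 8 2 3]
      sw13[of 8 7 6]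
    by linarith+
  have z6: "T 1 2 5 = 0" "T 1 3 8 = 0" "T 1 4 7 = 0" "T 5 7 8 = 0" "T 3 4 5 = 0" "T 2 4 8 = 0"
    "T 2 3 7 = 0"
    using eq(3)[of 1] eq(4)[of 2] eq(1)[of 3] eq(2)[of 4] eq(7)[of 5] eq(5)[of 7] eq(6)[of 8]
    unfolding zero sw23[of 1 7 4] sw12[of 2 1 5] sw23[of 2 8 4] sw12[of 3 1 8] sw12[of 3 2 7]
      sw23[of 3 5 4] sw12[of 4 1 7] sw12[of 4 2 8] sw12[of 4 3 5] cyc[of 5 1 2] cyc[of 5 3 4]
      sw23[of 5 8 7] cyc[of 7 1 4] cyc[of 7 2 3] sw12[of 7 5 8] cyc[of 8 1 3] cyc[of 8 2 4]
      cyc[of 8 5 7]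
    by linarith+
  have z7: "T 1 2 8 = 0" "T 1 3 5 = 0" "T 1 4 6 = 0" "T 5 6 8 = 0" "T 3 4 8 = 0" "T 2 4 5 = 0"
    "T 2 3 6 = 0"
    using eq(2)[of 1] eq(1)[of 2] eq(4)[of 3] eq(3)[of 4] eq(6)[of 5] eq(5)[of 6] eq(7)[of 8]
    unfolding zero sw23[of 1 6 4] sw12[of 2 1 8] sw23[of 2 5 4] sw12[of 3 1 5] sw12[of 3 2 6]
      sw23[of 3 8 4] sw12[of 4 1 6] sw12[of 4 2 5] sw12[of 4 3 8] cyc[of 5 1 3] cyc[of 5 2 4]
      sw23[of 5 8 6] cyc[of 6 1 4] cyc[of 6 2 3] sw12[of 6 5 8] cyc[of 8 1 2] cyc[of 8 3 4]
      cyc[of 8 5 6]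
    by linarith+
  have z8: "T 1 2 7 = 0" "T 1 3 6 = 0" "T 1 4 5 = 0" "T 5 6 7 = 0" "T 3 4 7 = 0" "T 2 4 6 = 0"
    "T 2 3 5 = 0"
    using eq(1)[of 1] eq(2)[of 2] eq(3)[of 3] eq(4)[of 4] eq(5)[of 5] eq(6)[of 6] eq(7)[of 7]
    unfolding zero sw23[of 1 5 4] sw12[of 2 1 7] sw23[of 2 6 4] sw12[of 3 1 6] sw12[of 3 2 5]
      sw23[of 3 7 4] sw12[of 4 1 5] sw12[of 4 2 6] sw12[of 4 3 7] cyc[of 5 1 4] cyc[of 5 2 3]
      sw23[of 5 7 6] cyc[of 6 1 3] cyc[of 6 2 4] sw12[of 6 5 7] cyc[of 7 1 2] cyc[of 7 3 4]
      cyc[of 7 5 6]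
    by linarith+
  have perm: "T x z y = 0 \<and> T y x z = 0 \<and> T y z x = 0 \<and> T z x y = 0 \<and> T z y x = 0" if "T x y z = 0" for x y z
    using that sw12[of x y z] sw23[of x y z] sw13[of x y z] cyc[of x y z] cyc2[of x y z] by simp
  have zero': "T z x x = 0" for x z using sw23[of z x x] by simp
  have "x \<in> {1, 2, 3, 4, 5, 6, 7, 8}" "y \<in> {1, 2, 3, 4, 5, 6, 7, 8}" "z \<in> {1, 2, 3, 4, 5, 6, 7, 8}"
    unfolding UNIV_8(1)[symmetric] by simp_all
  then show ?thesis
    by (elim insertE emptyE; simp add: z1 z2 z3 z4 z5 z6 z7 z8 zero zero' z1[THEN perm] z2[THEN
      perm] z3[THEN perm] z4[THEN perm] z5[THEN perm] z6[THEN perm] z7[THEN perm] z8[THEN perm])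
qed

section \<open>Uniqueness and existence of the characteristic connection\<close>

lemma bilinear_zero: "bilinear (\<lambda>x y :: vec8. 0 :: vec8)"
  by (simp add: bilinear_def linear_iff)

lemma bilinear_eq_zero:
  fixes f :: "vec8 \<Rightarrow> vec8 \<Rightarrow> vec8"
  assumes "bilinear f" "\<And>i j. f (axis i 1) (axis j 1) = 0"
  shows "f = (\<lambda>x y. 0)"
proof -
  show ?thesis
    by (rule bilinear_eq_stdbasis[OF assms(1) bilinear_zero]) (auto simp: Basis_vec_def assms(2))
qed

lemma metric_skew_parallel_unique:
  assumes "l \<noteq> 0" "metric_skew_parallel k l m Phi_inv \<Lambda>" "a \<in> GG"
  shows "\<Lambda> a = (\<lambda>x y. 0)"
proof (rule bilinear_eq_zero)
  have pm: "Phi_inv b = Phi_m" for b by (simp add: Phi_inv_def)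
  show "bilinear (\<Lambda> a)"
    using assms(2,3) by (auto simp: metric_skew_parallel_def connection_def)
  define T where "T p i j = \<Lambda> a (axis p 1) (axis i 1) $ j" for p i j
  have metric: "g_std (\<Lambda> a x y) z + g_std y (\<Lambda> a x z) = 0" for x y z
  proof -
    have "parallel k l m \<Lambda> 2 (\<lambda>a X. g_std (X 0) (X 1))"
      using assms(2) by (simp add: metric_skew_parallel_def pm spin7_metric_Phi_m)
    \<comment> \<open>The sequence \<open>case_nat y (\<lambda>_. z)\<close> encodes the pair (y,
      z). The metric is constant on the group, so only the terms in \<Lambda> remain.\<close>
    then have "cov_deriv k l m \<Lambda> 2 (\<lambda>a X. g_std (X 0) (X 1)) a x (case_nat y (\<lambda>_. z)) = 0"
      using assms(3) unfolding parallel_def by blast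
    then show ?thesis
      by (simp add: cov_deriv_def numeral_2_eq_2 lessThan_Suc)
  qed
  have g_sym: "g_std x y = g_std y x" for x y by (simp add: g_std_def mult.commute)
  have sw23: "T p i j = - T p j i" for p i j
    using metric[of "axis p 1" "axis i 1" "axis j 1"] g_sym[of "axis i 1"]
    by (simp add: g_std_axis T_def)
  have g_diff: "g_std (x - y) z = g_std x z - g_std y z" for x y z
    by (simp add: g_std_eq algebra_simps)
  have "totally_skew (\<lambda>x y z. g_std (torsion k l m \<Lambda> a x y) z)"
    using assms(2,3) by (simp add: metric_skew_parallel_def pm spin7_metric_Phi_m)
  moreover have "g_std (bracket_m k l m x y) z = - g_std (bracket_m k l m x z) y" for x y z
    using naturally_reductive_g_std[OF assms(1), of k m] unfolding naturally_reductive_def totally_skew_def by blast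
  \<comment> \<open>The bracket part of the torsion is already skew by natural reductivity, so the
    skewness condition passes to the part in \<Lambda>.\<close>
  ultimately have tors: "g_std (\<Lambda> a x y) z - g_std (\<Lambda> a y x) z = - (g_std (\<Lambda> a x z) y - g_std (\<Lambda> a z x) y)" for x y z
    unfolding totally_skew_def torsion_def g_diff by (smt (verit))
  have tors: "T p i j - T i p j = - (T p j i - T j p i)" for p i j
    using tors[of "axis p 1" "axis i 1" "axis j 1"] by (simp add: g_std_axis T_def)
  \<comment> \<open>In \<open>tors\<close> the terms with \<open>p\<close> in front cancel by
    \<open>sw23\<close>, which leaves skewness in the first and third index; with
    \<open>sw23\<close> this gives total skewness.\<close>
  have sw12: "T p i j = - T i p j" for p i j
    using tors[of p i j] sw23[of p i j] tors[of i j p] sw23[of i j p] tors[of j p i] sw23[of j p i] by linarith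
  have stab: "(\<Sum>j<4. Phi_m (Y(j := \<Lambda> a x (Y j)))) = 0" for x Y
  proof -
    have "cov_deriv k l m \<Lambda> 4 Phi_inv a x Y = 0"
      using assms(2,3) unfolding metric_skew_parallel_def parallel_def by blast
    then show ?thesis by (simp add: cov_deriv_def pm)
  qed
  have "T p i j = 0" for p i j
    by (rule spin7_three_form_zero[OF sw12 sw23]) (unfold T_def, (rule spin7_stabiliser[OF stab])+)
  then show "\<Lambda> a (axis i 1) (axis j 1) = 0" for i j
    by (simp add: vec_eq_iff T_def)
qed

text \<open>For \<Lambda> = 0 and constant tensors, parallelism only asks that the tensors vanish
  when one argument is 0, and skewness of the torsion is natural reductivity.\<close>

lemma metric_skew_parallel_canonical:
  assumes "l \<noteq> 0"
  shows "metric_skew_parallel k l m Phi_inv canonical_connection"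
proof -
  have pm: "Phi_inv b = Phi_m" for b by (simp add: Phi_inv_def)
  have "isotropy k l m h 0 = 0" if "h \<in> HH k l m" for h
    using that by (auto simp: HH_def isotropy_eq[OF assms] vec8_eq_iff complex_eq_iff)
  then have "connection k l m canonical_connection"
    by (simp add: connection_def canonical_connection_def bilinear_zero smooth_const)
  moreover have "parallel k l m canonical_connection 2 (\<lambda>a X. spin7_metric (Phi_inv a) (X 0) (X 1))"
    by (simp add: parallel_def cov_deriv_def canonical_connection_def pm spin7_metric_Phi_m numeral_2_eq_2 lessThan_Suc g_std_eq)
  moreover have "totally_skew (\<lambda>x y z. spin7_metric (Phi_inv a) (torsion k l m canonical_connection a x y) z)" for a
  proof -
    have "g_std (torsion k l m canonical_connection a x y) z = - g_std (bracket_m k l m x y) z" for x y z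
      by (simp add: torsion_def canonical_connection_def g_std_eq)
    moreover have "g_std (bracket_m k l m x y) z = - g_std (bracket_m k l m y x) z"
      "g_std (bracket_m k l m x y) z = - g_std (bracket_m k l m x z) y" for x y z
      using naturally_reductive_g_std[OF assms, of k m]
      unfolding naturally_reductive_def totally_skew_def by blast+
    ultimately show ?thesis
      unfolding totally_skew_def pm spin7_metric_Phi_m by metis
  qed
  moreover have "Phi_m (Y(i := 0)) = 0" if "i < 4" for Y i
  proof -
    have "detform [f, g, h, q] (Y(i := 0)) = 0" if "f 0 = 0" "g 0 = 0" "h 0 = 0" "q 0 = 0" for f g h q :: "vec8 \<Rightarrow> real"
      unfolding detform_quad_upd[OF \<open>i < 4\<close>] using that by (simp add: detform_first_column)
    then show ?thesis
      by (simp add: Phi_m_eq_spin7_form spin7_form_def wmono_eq_detform e_form_def)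
  qed
  then have "parallel k l m canonical_connection 4 Phi_inv"
    by (simp add: parallel_def cov_deriv_def canonical_connection_def pm)
  ultimately show ?thesis
    by (simp add: metric_skew_parallel_def)
qed

lemma parallel_torsion_canonical:
  assumes "l \<noteq> 0"
  shows "parallel k l m canonical_connection 3 (torsion_form k l m Phi_inv canonical_connection)"
proof -
  have "bracket_m k l m 0 y = 0" "bracket_m k l m x 0 = 0" for x y
    by (simp_all add: bracket_m_eq[OF assms] vec8_eq_iff rot1_def rot2_def rot3_def)
  then show ?thesis
    by (simp add: parallel_def cov_deriv_def torsion_form_def torsion_def canonical_connection_def
        Phi_inv_def spin7_metric_Phi_m numeral_3_eq_3 lessThan_Suc g_std_eq)
qed

theorem corollary7p11:
  fixes k l m :: int
  assumes "0 < m" and "m < l" and "coprime l m" and "k = l + m"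
  shows "spin7_structure k l m Phi_inv \<and> G_invariant Phi_inv \<and>
         mixed_type k l m Phi_inv \<and>
         (\<forall>a\<in>GG. spin7_metric (Phi_inv a) = g_std) \<and>
         naturally_reductive k l m g_std \<and>
         characteristic_connection k l m Phi_inv canonical_connection \<and>
         parallel k l m canonical_connection 3
           (torsion_form k l m Phi_inv canonical_connection)"
proof -
  have l: "l \<noteq> 0" using assms by simp
  \<comment> \<open>Since \<open>k - l = m\<close>, the numbers \<open>m * (k - l)\<close> and
    \<open>m * l\<close> are nonnegative.\<close>
  have "mixed_type k l m Phi_inv"
    unfolding mixed_type_def
    using not_balanced_Phi_inv[OF l] not_locally_conformal_parallel_Phi_inv[OF l] assms by simp
  moreover have "characteristic_connection k l m Phi_inv canonical_connection"
    unfolding characteristic_connection_def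
    using metric_skew_parallel_canonical[OF l] metric_skew_parallel_unique[OF l]
    by (auto simp: canonical_connection_def)
  ultimately show ?thesis
    using spin7_structure_Phi_inv[OF l assms(4)] naturally_reductive_g_std[OF l] parallel_torsion_canonical[OF l]
    by (simp add: G_invariant_def Phi_inv_def spin7_metric_Phi_m)
qed

end
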